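(* Let $a: [0,+\infty[\, \to \mathbb{R}$ be a continuous function for which there exist an integer $m\ge1$ and points $$0 = \tau_{0} < \sigma_{1} < \tau_{1} < \ldots < \sigma_{i} < \tau_{i} < \ldots < \sigma_{m} < \tau_{m}$$ such that - $a(r)\geq 0$ on $[\sigma_{i},\tau_{i}]$ and $a\not\equiv0$ on $[\sigma_{i},\tau_{i}]$, for $i=1,\ldots,m$; - $a(r)\leq 0$ on $[\tau_{i},\sigma_{i+1}]$ and $a\not\equiv0$ on $[\tau_{i},\sigma_{i+1}]$, for $i=0,\ldots,m-1$; - $a(r) < 0$ on $]\tau_m,+\infty[$ and $\displaystyle\lim_{r \to +\infty} \int_{\tau_m}^r a(s) s^{N-1}\,ds = - \infty$. Let $g: \mathbb{R}^+ \to \mathbb{R}$ be a locally Lipschitz continuous function such that, with $G(u):=\int_0^u g(\xi)\,d\xi$: - $g(0)=0$ and $g(u)>0$ for every $u>0$; - $\lim_{u \to 0^+} g(u)/u = 0$; - $\lim_{u \to +\infty} g(u)/u = +\infty$; - $\displaystyle\int_1^{+\infty}\frac{d\xi}{\sqrt{G(\xi)}} <+\infty$ and $\displaystyle\lim_{u \to +\infty} \int_u^{+\infty}\frac{d\xi}{\sqrt{G(\xi)-G(u)}} = 0$. Then there exists $\mu^* > 0$ such that for any $\mu > \mu^*$ the equation $$\Delta u + \bigl(a^+(|x|)-\mu a^-(|x|)\bigr) g(u) = 0, \qquad x \in \mathbb{R}^N,$$ has at least $2^m-1$ distinct positive radial homoclinic solutions.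
   Context: $\mathbb{R}^+=[0,+\infty)$; $N$ is a positive integer. $a^+=\max(a,0)$ and $a^-=\max(-a,0)$ are the positive and negative parts of $a$. A radial homoclinic solution is a (classical) radial solution $u(x)=u(r)$, $r=|x|$, i.e. $(r^{N-1}u')' + r^{N-1}(a^+(r)-\mu a^-(r))g(u)=0$ for $r>0$ with $u'(0)=0$, such that $(u(r),u'(r)) \to (0,0)$ as $r \to +\infty$. Positive means $u>0$ on $\mathbb{R}^N$. *)

theory Defs
  imports "HOL-Analysis.Analysis"
begin

definition C2 :: "('a::euclidean_space \<Rightarrow> real) \<Rightarrow> bool" where
  "C2 U \<longleftrightarrow> (\<exists>(D :: 'a \<Rightarrow> 'a \<Rightarrow>\<^sub>L real) (D2 :: 'a \<Rightarrow> 'a \<Rightarrow>\<^sub>L 'a \<Rightarrow>\<^sub>L real).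
     (\<forall>x. (U has_derivative blinfun_apply (D x)) (at x)) \<and>
     (\<forall>x. (D has_derivative blinfun_apply (D2 x)) (at x)) \<and>
     continuous_on UNIV D2)"

(* Sum of the pure second partial derivatives along the standard basis;
   deriv is unspecified where these do not exist, so this is only used
   together with C2. *)
definition laplacian :: "('a::euclidean_space \<Rightarrow> real) \<Rightarrow> 'a \<Rightarrow> real" where
  "laplacian U x = (\<Sum>b\<in>Basis. deriv (deriv (\<lambda>t. U (x + t *\<^sub>R b))) 0)"

definition weight :: "(real \<Rightarrow> real) \<Rightarrow> real \<Rightarrow> real \<Rightarrow> real" where
  "weight a \<mu> r = max (a r) 0 - \<mu> * max (- a r) 0"

definition classical_solution ::
    "(real \<Rightarrow> real) \<Rightarrow> (real \<Rightarrow> real) \<Rightarrow> ('a::euclidean_space \<Rightarrow> real) \<Rightarrow> bool" where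
  "classical_solution q g U \<longleftrightarrow>
     C2 U \<and> (\<forall>x. laplacian U x + q (norm x) * g (U x) = 0)"

(* The radial form of the equation in dimension N; v' is the derivative of the
   profile v on the closed half-line (one-sided at 0), and values of v at
   negative arguments play no role. *)
definition radial_profile_solution ::
    "nat \<Rightarrow> (real \<Rightarrow> real) \<Rightarrow> (real \<Rightarrow> real) \<Rightarrow> (real \<Rightarrow> real) \<Rightarrow> (real \<Rightarrow> real) \<Rightarrow> bool" where
  "radial_profile_solution N q g v v' \<longleftrightarrow>
     (\<forall>r\<ge>0. (v has_real_derivative v' r) (at r within {0..})) \<and>
     v' 0 = 0 \<and>
     (\<forall>r>0. \<exists>d. ((\<lambda>s. s ^ (N - 1) * v' s) has_real_derivative d) (at r) \<and>
                d + r ^ (N - 1) * q r * g (v r) = 0)"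

(* Both the equation on the whole space and its radial form are recorded.
   The nonlinearity g is meaningful only on {0..}, so this is to be used for
   nonnegative U. *)
definition radial_homoclinic_solution ::
    "(real \<Rightarrow> real) \<Rightarrow> (real \<Rightarrow> real) \<Rightarrow> ('a::euclidean_space \<Rightarrow> real) \<Rightarrow> bool" where
  "radial_homoclinic_solution q g U \<longleftrightarrow>
     classical_solution q g U \<and>
     (\<exists>v v'. (\<forall>x. U x = v (norm x)) \<and>
             radial_profile_solution DIM('a) q g v v' \<and>
             (v \<longlongrightarrow> 0) at_top \<and> (v' \<longlongrightarrow> 0) at_top)"

end

(* Truncating g to linear growth above a large M makes the initial value problem globally
   solvable. Let u(r;d) be the radial solution with u(0) = d, and v = r^(N-1) u'.
   On an interval where a >= 0, a positive solution is concave in the variable with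
   dt = r^(1-N) dr, so superlinearity bounds it by a constant below M that does not depend on mu;
   hence every positive decaying solution of the truncated problem solves the original one.
   Shoot in d through the points sigma_1 < ... < sigma_m < tau_m + 1. If u(sigma_i;d) > M, then u
   vanishes before sigma_(i+1). If max(u, v)(sigma_i;d) equals a small e_i, then u stays small up to
   tau_i and, for large mu, the negative part of the weight forces u(sigma_(i+1);d) > M. So a
   d-interval on which u(sigma_i) goes from nonpositive to above M splits at a point with
   max(u, v)(sigma_i) = e_i into two such intervals for sigma_(i+1). After tau_m, the values d for
   which u becomes negative and those for which u' becomes positive form disjoint open sets, so each
   final interval contains a d outside both, which is a decaying solution. Starting from the trivial
   solution d = 0 one of the 2^m branches is lost. *)

theory Submission
  imports Defs
begin

text \<open>The constants have to be fixed in the order M, e_i, mu*: the truncated problem depends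
  on M, the levels e_i depend on the truncated nonlinearity, and the threshold for mu depends on
  both. This works because on the intervals where a >= 0 the weight is a itself, so that every
  estimate there is free of mu. The a priori bound serves three purposes: read contrapositively it
  says that a start above M leads to a zero, at the end it removes the truncation, and it limits how
  steeply a positive solution can descend at tau_i. The last purpose answers an obstacle that the
  overview passes over. The level max(u, v) = e_i bounds v only from above, and at a point with u =
  e_i the growth argument also wants v >= 0. A descent down to height e_i at sigma_i would keep u
  above e_i on the whole preceding interval where a <= 0; there a large mu raises v by more than the
  slope, bounded independently of mu, with which the descent began.\<close>

section \<open>The singular initial value problem\<close>

(* The value at 0 is 0, also for n = 0, because the integral vanishes there. *)
definition radial_mean :: "nat \<Rightarrow> (real \<Rightarrow> real) \<Rightarrow> real \<Rightarrow> real" where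
  "radial_mean n f r = integral {0..r} (\<lambda>s. s ^ n * f s) / r ^ n"

lemma continuous_on_integral_from_0:
  fixes f :: "real \<Rightarrow> real"
  assumes "continuous_on {0..} f"
  shows "continuous_on {0..} (\<lambda>r. integral {0..r} f)"
  unfolding continuous_on_eq_continuous_within
proof
  fix x :: real assume x: "x \<in> {0..}"
  have "continuous_on {0..x+1} f" by (rule continuous_on_subset[OF assms]) auto
  then have "continuous_on {0..x+1} (\<lambda>r. integral {0..r} f)"
    by (intro indefinite_integral_continuous_1 integrable_continuous_interval)
  then have "continuous (at x within {0..x+1}) (\<lambda>r. integral {0..r} f)"
    using x by (auto simp: continuous_on_eq_continuous_within)
  moreover have "at x within {0..x+1} = at x within {0..}"
    by (rule at_within_nhd[where S="{..<x+1}"]) (use x in auto)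
  ultimately show "continuous (at x within {0..}) (\<lambda>r. integral {0..r} f)" by (simp add: continuous_within)
qed

lemma has_real_derivative_integral_from_0:
  fixes f :: "real \<Rightarrow> real"
  assumes "continuous_on {0..} f" "0 \<le> r"
  shows "((\<lambda>r. integral {0..r} f) has_real_derivative f r) (at r within {0..})"
proof -
  have "continuous_on {0..r+1} f" by (rule continuous_on_subset[OF assms(1)]) auto
  then have "((\<lambda>r. integral {0..r} f) has_real_derivative f r) (at r within {0..r+1})"
    using assms(2) by (intro integral_has_real_derivative) auto
  moreover have "at r within {0..r+1} = at r within {0..}"
    by (rule at_within_nhd[where S="{..<r+1}"]) (use assms in auto)
  ultimately show ?thesis by simp
qed

lemma has_real_derivative_integral_from_0_at:
  fixes f :: "real \<Rightarrow> real"
  assumes "continuous_on {0..} f" "0 < r"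
  shows "((\<lambda>r. integral {0..r} f) has_real_derivative f r) (at r)"
proof -
  have "at r within {0..} = at r"
    by (rule at_within_interior) (use assms in simp)
  then show ?thesis using has_real_derivative_integral_from_0[OF assms(1), of r] assms by simp
qed

text \<open>Since \<open>(s / r) ^ n \<le> 1\<close> for \<open>0 \<le> s \<le> r\<close>, the
  division by \<open>r ^ n\<close> is harmless. This is how the singularity at 0 disappears from the
  estimates.\<close>

lemma radial_mean_bound:
  fixes f F :: "real \<Rightarrow> real"
  assumes f: "continuous_on {0..} f" and F: "continuous_on {0..} F" and r: "0 \<le> r"
    and le: "\<And>s. 0 \<le> s \<Longrightarrow> s \<le> r \<Longrightarrow> \<bar>f s\<bar> \<le> F s"
  shows "\<bar>radial_mean n f r\<bar> \<le> integral {0..r} F"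
proof (cases "r = 0")
  case True then show ?thesis by (simp add: radial_mean_def)
next
  case False
  then have r: "r > 0" using r by simp
  have cf: "continuous_on {0..r} f" and cF: "continuous_on {0..r} F"
    by (auto intro: continuous_on_subset[OF f] continuous_on_subset[OF F])
  have "norm (integral {0..r} (\<lambda>s. s ^ n * f s)) \<le> integral {0..r} (\<lambda>s. r ^ n * F s)"
  proof (rule integral_norm_bound_integral)
    show "(\<lambda>s. s ^ n * f s) integrable_on {0..r}" "(\<lambda>s. r ^ n * F s) integrable_on {0..r}"
      by (intro integrable_continuous_interval continuous_intros cf cF)+
    fix s assume s: "s \<in> {0..r}"
    then show "norm (s ^ n * f s) \<le> r ^ n * F s"
      using le[of s] by (auto simp: abs_mult intro!: mult_mono power_mono)
  qed
  then show ?thesis using r by (simp add: radial_mean_def field_simps)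
qed

lemma continuous_on_radial_mean:
  fixes f :: "real \<Rightarrow> real"
  assumes f: "continuous_on {0..} f"
  shows "continuous_on {0..} (radial_mean n f)"
  unfolding continuous_on_eq_continuous_within
proof
  fix x :: real assume x: "x \<in> {0..}"
  have cI: "continuous_on {0..} (\<lambda>r. integral {0..r} (\<lambda>s. s ^ n * f s))"
    by (intro continuous_on_integral_from_0 continuous_intros f)
  show "continuous (at x within {0..}) (radial_mean n f)"
  proof (cases "x = 0")
    case False
    then show ?thesis unfolding radial_mean_def [abs_def]
      using cI x by (intro continuous_intros) (auto simp: continuous_on_eq_continuous_within)
  next
    case True
    \<comment> \<open>At 0 the quotient is squeezed by the integral of \<open>\<bar>f\<bar>\<close>,
      which tends to 0.\<close>
    have cF: "continuous_on {0..} (\<lambda>s. \<bar>f s\<bar>)" by (intro continuous_intros f)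
    have "continuous_on {0..} (\<lambda>r. integral {0..r} (\<lambda>s. \<bar>f s\<bar>))"
      by (rule continuous_on_integral_from_0[OF cF])
    then have "((\<lambda>r. integral {0..r} (\<lambda>s. \<bar>f s\<bar>)) \<longlongrightarrow> 0) (at 0 within {0..})"
      by (auto simp: continuous_on_def dest: bspec[where x=0])
    moreover have "\<forall>\<^sub>F r in at 0 within {0..}. norm (radial_mean n f r) \<le> integral {0..r} (\<lambda>s. \<bar>f s\<bar>)"
      by (auto simp: eventually_at_filter intro!: always_eventually radial_mean_bound f cF)
    ultimately have "(radial_mean n f \<longlongrightarrow> 0) (at 0 within {0..})"
      by (rule Lim_null_comparison[rotated])
    then show ?thesis using True by (simp add: continuous_within radial_mean_def)
  qed
qed

lemma radial_mean_diff:
  fixes f g :: "real \<Rightarrow> real"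
  assumes f: "continuous_on {0..} f" and g: "continuous_on {0..} g"
  shows "radial_mean n (\<lambda>s. f s - g s) r = radial_mean n f r - radial_mean n g r"
proof -
  have "continuous_on {0..r} f" "continuous_on {0..r} g"
    by (auto intro: continuous_on_subset[OF f] continuous_on_subset[OF g])
  then have "continuous_on {0..r} (\<lambda>s. s ^ n * f s)" "continuous_on {0..r} (\<lambda>s. s ^ n * g s)"
    by (auto intro!: continuous_intros)
  then have "(\<lambda>s. s ^ n * f s) integrable_on {0..r}" "(\<lambda>s. s ^ n * g s) integrable_on {0..r}"
    by (auto intro: integrable_continuous_interval)
  then show ?thesis
    by (simp add: radial_mean_def right_diff_distrib integral_diff diff_divide_distrib)
qed

section \<open>Picard iteration in an exponentially weighted norm\<close>

lemma continuous_on_Icc_abs_bound: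
  fixes f :: "real \<Rightarrow> real"
  assumes "continuous_on {x..y} f"
  obtains B where "0 \<le> B" "\<And>s. x \<le> s \<Longrightarrow> s \<le> y \<Longrightarrow> \<bar>f s\<bar> \<le> B"
proof -
  have "bounded (f ` {x..y})"
    by (intro compact_imp_bounded compact_continuous_image assms compact_Icc)
  then obtain B where "\<forall>s\<in>{x..y}. \<bar>f s\<bar> \<le> B" by (auto simp: bounded_iff)
  then show thesis by (intro that[of "max 0 B"]) force+
qed

text \<open>The equation \<open>(r ^ n * u')' = - q * r ^ n * h u\<close> integrated twice from 0;
  the condition that \<open>r ^ n * u'\<close> vanishes at 0 is built in.\<close>

definition picard_step ::
    "nat \<Rightarrow> (real \<Rightarrow> real) \<Rightarrow> (real \<Rightarrow> real) \<Rightarrow> real \<Rightarrow> (real \<Rightarrow> real) \<Rightarrow> real \<Rightarrow> real" where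
  "picard_step n q h d f r = d - integral {0..r} (radial_mean n (\<lambda>s. q s * h (f s)))"

text \<open>Each integration against the exponential weight gains a factor \<open>1 / lm\<close>. A
  Picard step integrates twice, so \<open>lm\<^sup>2\<close> competes with the Lipschitz
  constant.\<close>

lemma integral_exp_le:
  fixes lm :: real
  assumes "lm > 0" "0 \<le> r" "0 \<le> E"
  shows "integral {0..r} (\<lambda>s. E * exp (lm * s)) \<le> E / lm * exp (lm * r)"
proof -
  have "((\<lambda>s. E * exp (lm * s)) has_integral (E / lm * exp (lm * r) - E / lm * exp (lm * 0))) {0..r}"
    using assms
    by (intro fundamental_theorem_of_calculus)
       (auto intro!: derivative_eq_intros simp flip: has_real_derivative_iff_has_vector_derivative)
  then have "integral {0..r} (\<lambda>s. E * exp (lm * s)) = E / lm * exp (lm * r) - E / lm"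
    by (subst integral_unique) auto
  then show ?thesis using assms by (simp del: integral_mult_right)
qed

(* Contraction by the factor 1/2 in the supremum norm on {0..R} weighted by exp (- lm * s). *)
lemma picard_step_contraction:
  fixes q h f f' :: "real \<Rightarrow> real"
  assumes q: "continuous_on {0..} q" and h: "L-lipschitz_on UNIV h"
    and f: "continuous_on {0..} f" and f': "continuous_on {0..} f'"
    and Q: "\<And>s. 0 \<le> s \<Longrightarrow> s \<le> R \<Longrightarrow> \<bar>q s\<bar> \<le> Q"
    and lam: "lm > 0" "2 * (Q * L) \<le> lm\<^sup>2"
    and E: "\<And>s. 0 \<le> s \<Longrightarrow> s \<le> R \<Longrightarrow> \<bar>f s - f' s\<bar> \<le> E * exp (lm * s)"
    and r: "0 \<le> r" "r \<le> R"
  shows "\<bar>picard_step n q h d f r - picard_step n q h d' f' r\<bar> \<le> \<bar>d - d'\<bar> + E / 2 * exp (lm * r)"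
proof -
  have ch: "continuous_on UNIV h" by (rule lipschitz_on_continuous_on[OF h])
  have L: "L \<ge> 0" by (rule lipschitz_on_nonneg[OF h])
  have Q0: "Q \<ge> 0" using Q[of 0] r by force
  have E0: "E \<ge> 0" using E[of 0] r by force
  define F where "F = (\<lambda>s. q s * h (f s))"
  define F' where "F' = (\<lambda>s. q s * h (f' s))"
  have cF: "continuous_on {0..} F" "continuous_on {0..} F'" unfolding F_def F'_def
    by (intro continuous_intros q continuous_on_compose2[OF ch] f f'; simp)+
  have FF: "\<bar>F s - F' s\<bar> \<le> (Q * L * E) * exp (lm * s)" if "0 \<le> s" "s \<le> R" for s
  proof -
    have "\<bar>F s - F' s\<bar> = \<bar>q s\<bar> * \<bar>h (f s) - h (f' s)\<bar>" by (simp add: F_def F'_def right_diff_distrib flip: abs_mult)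
    also have "\<dots> \<le> Q * (L * (E * exp (lm * s)))"
    proof (intro mult_mono Q that)
      have "\<bar>h (f s) - h (f' s)\<bar> \<le> L * \<bar>f s - f' s\<bar>"
        using lipschitz_onD[OF h, of "f s" "f' s"] by (simp add: dist_real_def)
      also have "\<dots> \<le> L * (E * exp (lm * s))" using E[OF that] L by (intro mult_left_mono) auto
      finally show "\<bar>h (f s) - h (f' s)\<bar> \<le> L * (E * exp (lm * s))" .
    qed (use Q0 in auto)
    finally show ?thesis by (simp add: mult_ac)
  qed
  have mean: "\<bar>radial_mean n (\<lambda>s. F s - F' s) s\<bar> \<le> (Q * L * E / lm) * exp (lm * s)" if s: "0 \<le> s" "s \<le> r" for s
  proof -
    have "\<bar>radial_mean n (\<lambda>s. F s - F' s) s\<bar> \<le> integral {0..s} (\<lambda>s. (Q * L * E) * exp (lm * s))"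
      using s r by (intro radial_mean_bound continuous_intros cF FF) auto
    also have "\<dots> \<le> (Q * L * E / lm) * exp (lm * s)"
      using s lam L Q0 E0 by (intro integral_exp_le) auto
    finally show ?thesis .
  qed
  have cm: "continuous_on {0..} (radial_mean n F)" "continuous_on {0..} (radial_mean n F')"
    by (intro continuous_on_radial_mean cF)+
  have int: "(radial_mean n F) integrable_on {0..r}" "(radial_mean n F') integrable_on {0..r}"
    by (intro integrable_continuous_interval continuous_on_subset[OF cm(1)] continuous_on_subset[OF cm(2)]; simp)+
  have "\<bar>integral {0..r} (radial_mean n F) - integral {0..r} (radial_mean n F')\<bar>
      = norm (integral {0..r} (radial_mean n (\<lambda>s. F s - F' s)))"
    using int by (simp add: radial_mean_diff[OF cF, abs_def] integral_diff)
  also have "\<dots> \<le> integral {0..r} (\<lambda>s. (Q * L * E / lm) * exp (lm * s))"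
  proof (rule integral_norm_bound_integral)
    have "continuous_on {0..} (radial_mean n (\<lambda>s. F s - F' s))"
      by (intro continuous_on_radial_mean continuous_intros cF)
    then show "radial_mean n (\<lambda>s. F s - F' s) integrable_on {0..r}"
      by (intro integrable_continuous_interval) (erule continuous_on_subset, simp)
    show "(\<lambda>s. (Q * L * E / lm) * exp (lm * s)) integrable_on {0..r}"
      by (intro integrable_continuous_interval continuous_intros)
  qed (use mean in auto)
  also have "\<dots> \<le> (Q * L * E / lm) / lm * exp (lm * r)"
    using lam L Q0 E0 r by (intro integral_exp_le) auto
  also have "(Q * L * E / lm) / lm \<le> E / 2"
  proof -
    have "2 * (Q * L) * E \<le> lm\<^sup>2 * E" using lam E0 by (intro mult_right_mono)
    then show ?thesis using lam by (simp add: field_simps power2_eq_square)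
  qed
  finally have "\<bar>integral {0..r} (radial_mean n F) - integral {0..r} (radial_mean n F')\<bar> \<le> E / 2 * exp (lm * r)"
    by simp
  then show ?thesis unfolding picard_step_def F_def[symmetric] F'_def[symmetric] by linarith
qed

lemma continuous_on_picard_step:
  fixes q h f :: "real \<Rightarrow> real"
  assumes "continuous_on {0..} q" "continuous_on UNIV h" "continuous_on {0..} f"
  shows "continuous_on {0..} (picard_step n q h d f)"
  unfolding picard_step_def [abs_def]
  by (intro continuous_intros continuous_on_integral_from_0 continuous_on_radial_mean assms
        continuous_on_compose2[OF assms(2)]) auto

text \<open>A bound for \<open>q\<close>, and with it the weight \<open>lm\<close>, is available
  only on bounded intervals. Convergence is therefore shown on each \<open>{0..R}\<close>; the limit
  \<open>u\<close> is defined beforehand as a telescoping series, so that one function serves every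
  \<open>R\<close>.\<close>

lemma picard_fixpoint:
  fixes q h :: "real \<Rightarrow> real"
  assumes q: "continuous_on {0..} q" and h: "L-lipschitz_on UNIV h"
  shows "\<exists>u. continuous_on {0..} u \<and> (\<forall>r\<ge>0. u r = picard_step n q h d u r)"
proof -
  have ch: "continuous_on UNIV h" by (rule lipschitz_on_continuous_on[OF h])
  have L: "L \<ge> 0" by (rule lipschitz_on_nonneg[OF h])
  define w where "w k = (picard_step n q h d ^^ k) (\<lambda>_. d)" for k
  have w_Suc: "w (Suc k) = picard_step n q h d (w k)" for k by (simp add: w_def)
  have cw: "continuous_on {0..} (w k)" for k
    by (induction k) (simp_all add: w_Suc continuous_on_picard_step[OF q ch], simp add: w_def)
  define u where "u r = d + (\<Sum>k. w (Suc k) r - w k r)" for r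
  have w_sum: "w k r = d + (\<Sum>i<k. w (Suc i) r - w i r)" for k r
    using sum_lessThan_telescope[of "\<lambda>i. w i r" k] by (simp add: w_def[of 0])
  have local: "uniform_limit {0..R} w u sequentially \<and> (\<forall>r\<in>{0..R}. u r = picard_step n q h d u r)
       \<and> continuous_on {0..R} u" if R: "R > 0" for R
  proof -
    have cq: "continuous_on {0..R} q" by (rule continuous_on_subset[OF q]) auto
    obtain Q where Q0: "Q \<ge> 0" and Q: "\<And>s. 0 \<le> s \<Longrightarrow> s \<le> R \<Longrightarrow> \<bar>q s\<bar> \<le> Q"
      using continuous_on_Icc_abs_bound[OF cq] by blast
    \<comment> \<open>A positive number with \<open>2 * (Q * L) \<le> lm\<^sup>2\<close>, chosen so
      as to avoid a square root.\<close>
    define lm where "lm = 1 + 2 * (Q * L)"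
    have lam: "lm > 0" "2 * (Q * L) \<le> lm\<^sup>2"
  proof -
    have "Q * L \<ge> 0" using Q0 L by simp
    moreover have "lm\<^sup>2 = 1 + 4 * (Q * L) + (2 * (Q * L))\<^sup>2"
      by (simp add: lm_def power2_eq_square algebra_simps)
    ultimately show "lm > 0" "2 * (Q * L) \<le> lm\<^sup>2"
      using zero_le_power2[of "2 * (Q * L)"] by (simp add: lm_def, linarith)
  qed
    note contr = picard_step_contraction[OF q h _ _ Q lam]
    have "continuous_on {0..R} (\<lambda>s. w 1 s - w 0 s)"
      by (intro continuous_intros continuous_on_subset[OF cw]) auto
    then obtain E where E0: "E \<ge> 0" and E: "\<And>s. 0 \<le> s \<Longrightarrow> s \<le> R \<Longrightarrow> \<bar>w 1 s - w 0 s\<bar> \<le> E"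
      using continuous_on_Icc_abs_bound by blast
    have step: "\<bar>w (Suc k) s - w k s\<bar> \<le> E / 2 ^ k * exp (lm * s)" if "0 \<le> s" "s \<le> R" for k s
      using that
    proof (induction k arbitrary: s)
      case 0
      have "\<bar>w 1 s - w 0 s\<bar> \<le> E * 1" using E 0 by simp
      also have "\<dots> \<le> E * exp (lm * s)" using E0 lam 0 by (intro mult_left_mono) auto
      finally show ?case by simp
    next
      case (Suc k)
      have "\<bar>picard_step n q h d (w (Suc k)) s - picard_step n q h d (w k) s\<bar>
          \<le> \<bar>d - d\<bar> + (E / 2 ^ k) / 2 * exp (lm * s)"
        using Suc by (intro contr cw) auto
      then show ?case unfolding w_Suc[of "Suc k", symmetric] w_Suc[of k, symmetric] by (simp add: field_simps)
    qed
    have "uniform_limit {0..R} (\<lambda>k r. \<Sum>i<k. w (Suc i) r - w i r) (\<lambda>r. \<Sum>i. w (Suc i) r - w i r) sequentially"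
    proof (rule Weierstrass_m_test)
      show "norm (w (Suc k) r - w k r) \<le> E * exp (lm * R) * (1/2) ^ k" if "r \<in> {0..R}" for k r
      proof -
        have "norm (w (Suc k) r - w k r) \<le> E / 2 ^ k * exp (lm * r)" using step[of r k] that by simp
        also have "\<dots> \<le> E / 2 ^ k * exp (lm * R)"
          using that E0 lam by (intro mult_left_mono) auto
        finally show ?thesis by (simp add: field_simps power_divide)
      qed
      show "summable (\<lambda>k. E * exp (lm * R) * (1/2) ^ k)"
        by (intro summable_mult summable_geometric) simp
    qed
    then have "uniform_limit {0..R} (\<lambda>k r. d + (\<Sum>i<k. w (Suc i) r - w i r)) u sequentially"
      unfolding u_def[abs_def] by (intro uniform_limit_intros)
    moreover have "(\<lambda>k r. d + (\<Sum>i<k. w (Suc i) r - w i r)) = w"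
      by (intro ext, rule w_sum[symmetric])
    ultimately have ul: "uniform_limit {0..R} w u sequentially" by simp
    have cu: "continuous_on {0..R} u"
      by (rule uniform_limit_theorem[OF _ ul]) (auto intro!: always_eventually continuous_on_subset[OF cw])
    \<comment> \<open>So far \<open>u\<close> is continuous only on \<open>{0..R}\<close>, while
      \<open>contr\<close> asks for continuity on \<open>{0..}\<close>. Freezing the value beyond
      \<open>R\<close> provides it, and a Picard step evaluated in \<open>{0..R}\<close> does not
      see the change.\<close>
    define u' where "u' s = u (min s R)" for s
    have cu': "continuous_on {0..} u'" unfolding u'_def
      by (rule continuous_on_compose2[OF cu]) (use R in \<open>auto intro!: continuous_intros\<close>)
    have same: "picard_step n q h d u r = picard_step n q h d u' r" if "r \<in> {0..R}" for r
    proof -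
      have "radial_mean n (\<lambda>s. q s * h (u s)) s = radial_mean n (\<lambda>s. q s * h (u' s)) s" if "s \<in> {0..r}" for s
        using that \<open>r \<in> {0..R}\<close> unfolding radial_mean_def u'_def
        by (intro arg_cong2[where f="(/)"] integral_cong) (auto simp: min_def)
      then show ?thesis unfolding picard_step_def by (intro arg_cong2[where f="(-)"] integral_cong) auto
    qed
    have "u r = picard_step n q h d u' r" if r: "r \<in> {0..R}" for r
    proof -
      have "(\<lambda>k. w (Suc k) r) \<longlonglongrightarrow> u r"
        using tendsto_uniform_limitI[OF ul r] by (rule LIMSEQ_Suc)
      moreover have "(\<lambda>k. picard_step n q h d (w k) r) \<longlonglongrightarrow> picard_step n q h d u' r"
      proof (rule LIMSEQ_I)
        fix \<epsilon> :: real assume "\<epsilon> > 0"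
        define \<eta> where "\<eta> = \<epsilon> / exp (lm * R)"
        have eta: "\<eta> > 0" using \<open>\<epsilon> > 0\<close> by (simp add: \<eta>_def)
        have "\<forall>\<^sub>F k in sequentially. \<forall>s\<in>{0..R}. dist (w k s) (u s) < \<eta>"
          using uniform_limitD[OF ul eta] .
        then obtain k0 where k0: "\<And>k s. k \<ge> k0 \<Longrightarrow> s \<in> {0..R} \<Longrightarrow> dist (w k s) (u s) < \<eta>"
          unfolding eventually_sequentially by blast
        have "norm (picard_step n q h d (w k) r - picard_step n q h d u' r) < \<epsilon>" if "k \<ge> k0" for k
        proof -
          have "\<bar>picard_step n q h d (w k) r - picard_step n q h d u' r\<bar> \<le> \<bar>d - d\<bar> + \<eta> / 2 * exp (lm * r)"
          proof (rule contr)
            fix s assume s: "0 \<le> s" "s \<le> R"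
            then have "\<bar>w k s - u' s\<bar> \<le> \<eta> * 1" using k0[OF that, of s] by (simp add: dist_real_def u'_def min_def)
            also have "\<dots> \<le> \<eta> * exp (lm * s)" using s lam eta by (intro mult_left_mono) auto
            finally show "\<bar>w k s - u' s\<bar> \<le> \<eta> * exp (lm * s)" .
          qed (use r cw cu' in auto)
          also have "\<eta> / 2 * exp (lm * r) \<le> \<eta> / 2 * exp (lm * R)"
            using r lam eta by (intro mult_left_mono) auto
          also have "\<dots> = \<epsilon> / 2" by (simp add: \<eta>_def)
          finally show ?thesis using \<open>\<epsilon> > 0\<close> by simp
        qed
        then show "\<exists>k0. \<forall>k\<ge>k0. norm (picard_step n q h d (w k) r - picard_step n q h d u' r) < \<epsilon>" by blast
      qed
      ultimately show ?thesis unfolding w_Suc by (rule LIMSEQ_unique)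
    qed
    then show ?thesis using ul cu same by auto
  qed
  have "continuous_on {0..} u" unfolding continuous_on_eq_continuous_within
  proof
    fix x :: real assume x: "x \<in> {0..}"
    have "continuous (at x within {0..x+1}) u"
      using local[of "x+1"] x by (auto simp: continuous_on_eq_continuous_within)
    moreover have "at x within {0..x+1} = at x within {0..}"
      by (rule at_within_nhd[where S="{..<x+1}"]) (use x in auto)
    ultimately show "continuous (at x within {0..}) u" by (simp add: continuous_within)
  qed
  moreover have "u r = picard_step n q h d u r" if "r \<ge> 0" for r
    using local[of "r+1"] that by auto
  ultimately show ?thesis by blast
qed

text \<open>By the contraction, the weighted supremum \<open>E\<close> of the difference of two
  fixed points satisfies \<open>E \<le> \<bar>d - d'\<bar> + E / 2\<close>, hence
  \<open>E \<le> 2 * \<bar>d - d'\<bar>\<close>. The case \<open>d = d'\<close> is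
  uniqueness.\<close>

lemma picard_fixpoint_lipschitz:
  fixes q h :: "real \<Rightarrow> real"
  assumes q: "continuous_on {0..} q" and h: "L-lipschitz_on UNIV h" and R: "R \<ge> 0"
  shows "\<exists>C. \<forall>d d' u u'. continuous_on {0..} u \<and> (\<forall>r\<ge>0. u r = picard_step n q h d u r) \<longrightarrow>
     continuous_on {0..} u' \<and> (\<forall>r\<ge>0. u' r = picard_step n q h d' u' r) \<longrightarrow>
     (\<forall>r\<in>{0..R}. \<bar>u r - u' r\<bar> \<le> C * \<bar>d - d'\<bar>)"
proof -
  have L: "L \<ge> 0" by (rule lipschitz_on_nonneg[OF h])
  have cq: "continuous_on {0..R} q" by (rule continuous_on_subset[OF q]) auto
  obtain Q where Q0: "Q \<ge> 0" and Q: "\<And>s. 0 \<le> s \<Longrightarrow> s \<le> R \<Longrightarrow> \<bar>q s\<bar> \<le> Q"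
    using continuous_on_Icc_abs_bound[OF cq] by blast
  define lm where "lm = 1 + 2 * (Q * L)"
  have lam: "lm > 0" "2 * (Q * L) \<le> lm\<^sup>2"
  proof -
    have "Q * L \<ge> 0" using Q0 L by simp
    moreover have "lm\<^sup>2 = 1 + 4 * (Q * L) + (2 * (Q * L))\<^sup>2"
      by (simp add: lm_def power2_eq_square algebra_simps)
    ultimately show "lm > 0" "2 * (Q * L) \<le> lm\<^sup>2"
      using zero_le_power2[of "2 * (Q * L)"] by (simp add: lm_def, linarith)
  qed
  note contr = picard_step_contraction[OF q h _ _ Q lam]
  have main: "\<bar>u r - u' r\<bar> \<le> 2 * exp (lm * R) * \<bar>d - d'\<bar>"
    if u: "continuous_on {0..} u" "\<And>r. r\<ge>0 \<Longrightarrow> u r = picard_step n q h d u r"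
      and u': "continuous_on {0..} u'" "\<And>r. r\<ge>0 \<Longrightarrow> u' r = picard_step n q h d' u' r"
      and r: "r \<in> {0..R}" for d d' u u' r
  proof -
    define e where "e s = \<bar>u s - u' s\<bar> * exp (- (lm * s))" for s
    have "continuous_on {0..R} e" unfolding e_def
      by (intro continuous_intros continuous_on_subset[OF u(1)] continuous_on_subset[OF u'(1)]) auto
    then obtain x where x: "x \<in> {0..R}" "\<And>s. s \<in> {0..R} \<Longrightarrow> e s \<le> e x"
      using continuous_attains_sup[of "{0..R}" e] R by auto
    have bound: "\<bar>u s - u' s\<bar> \<le> e x * exp (lm * s)" if "s \<in> {0..R}" for s
    proof -
      have "\<bar>u s - u' s\<bar> = e s * exp (lm * s)" by (simp add: e_def mult.assoc flip: exp_add)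
      also have "\<dots> \<le> e x * exp (lm * s)" using x(2)[OF that] by simp
      finally show ?thesis .
    qed
    have "\<bar>picard_step n q h d u x - picard_step n q h d' u' x\<bar> \<le> \<bar>d - d'\<bar> + e x / 2 * exp (lm * x)"
      by (rule contr) (use u u' x bound in auto)
    then have "\<bar>u x - u' x\<bar> \<le> \<bar>d - d'\<bar> + e x / 2 * exp (lm * x)"
      using u(2)[of x] u'(2)[of x] x(1) by simp
    then have "e x \<le> (\<bar>d - d'\<bar> + e x / 2 * exp (lm * x)) * exp (- (lm * x))"
      unfolding e_def by (intro mult_right_mono) auto
    also have "\<dots> = \<bar>d - d'\<bar> * exp (- (lm * x)) + e x / 2"
      by (simp add: distrib_right mult.assoc flip: exp_add)
    also have "\<dots> \<le> \<bar>d - d'\<bar> * 1 + e x / 2"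
      using lam x by (intro add_mono mult_left_mono) auto
    finally have ex: "e x \<le> 2 * \<bar>d - d'\<bar>" by simp
    have "\<bar>u r - u' r\<bar> \<le> e x * exp (lm * r)" using bound r .
    also have "\<dots> \<le> (2 * \<bar>d - d'\<bar>) * exp (lm * R)"
      using ex r lam by (intro mult_mono) auto
    finally show ?thesis by (simp add: mult_ac)
  qed
  show ?thesis by (rule exI[where x="2 * exp (lm * R)"]) (use main in blast)
qed

(* Here v stands for r ^ n * u', where n + 1 is the dimension. *)
definition radial_system ::
    "nat \<Rightarrow> (real \<Rightarrow> real) \<Rightarrow> (real \<Rightarrow> real) \<Rightarrow> (real \<Rightarrow> real) \<Rightarrow> (real \<Rightarrow> real) \<Rightarrow> bool" where
  "radial_system n q h u v \<longleftrightarrow>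
     continuous_on {0..} u \<and> continuous_on {0..} v \<and> v 0 = 0 \<and>
     (\<forall>r>0. (u has_real_derivative v r / r ^ n) (at r) \<and>
            (v has_real_derivative - (q r * r ^ n * h (u r))) (at r))"

lemma radial_systemD:
  assumes "radial_system n q h u v"
  shows "continuous_on {0..} u" "continuous_on {0..} v" "v 0 = 0"
    "r > 0 \<Longrightarrow> (u has_real_derivative v r / r ^ n) (at r)"
    "r > 0 \<Longrightarrow> (v has_real_derivative - (q r * r ^ n * h (u r))) (at r)"
  using assms by (auto simp: radial_system_def)

text \<open>Continuity of \<open>v d r\<close> in \<open>d\<close> comes from its integral formula
  and the Lipschitz dependence of \<open>u\<close>. The last clause identifies the trivial solution,
  which is the left end of the first shooting interval.\<close>

lemma radial_flow_exists:
  fixes q h :: "real \<Rightarrow> real"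
  assumes q: "continuous_on {0..} q" and h: "L-lipschitz_on UNIV h"
  shows "\<exists>u v. (\<forall>d. radial_system n q h (u d) (v d) \<and> u d 0 = d) \<and>
     (\<forall>r\<ge>0. continuous_on UNIV (\<lambda>d. u d r) \<and> continuous_on UNIV (\<lambda>d. v d r)) \<and>
     (h 0 = 0 \<longrightarrow> (\<forall>r\<ge>0. u 0 r = 0 \<and> v 0 r = 0))"
proof -
  have ch: "continuous_on UNIV h" by (rule lipschitz_on_continuous_on[OF h])
  have L: "L \<ge> 0" by (rule lipschitz_on_nonneg[OF h])
  obtain u where cu: "\<And>d. continuous_on {0..} (u d)"
    and u: "\<And>d r. r \<ge> 0 \<Longrightarrow> u d r = picard_step n q h d (u d) r"
    using picard_fixpoint[OF q h] by metis
  define v where "v d r = - integral {0..r} (\<lambda>s. s ^ n * (q s * h (u d s)))" for d r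
  have cf: "continuous_on {0..} (\<lambda>s. q s * h (u d s))" for d
    by (intro continuous_intros q continuous_on_compose2[OF ch] cu) auto
  have cf': "continuous_on {0..} (\<lambda>s. s ^ n * (q s * h (u d s)))" for d
    by (intro continuous_intros cf)
  have "radial_system n q h (u d) (v d)" for d
    unfolding radial_system_def
  proof (intro conjI allI impI)
    show "continuous_on {0..} (v d)" unfolding v_def
      by (intro continuous_intros continuous_on_integral_from_0 cf')
    fix r :: real assume r: "r > 0"
    show "(v d has_real_derivative - (q r * r ^ n * h (u d r))) (at r)"
      unfolding v_def using has_real_derivative_integral_from_0_at[OF cf' r]
      by (auto intro!: derivative_eq_intros simp: mult_ac)
    have "((\<lambda>r. d - integral {0..r} (radial_mean n (\<lambda>s. q s * h (u d s)))) has_real_derivative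
            v d r / r ^ n) (at r)"
      using has_real_derivative_integral_from_0_at[OF continuous_on_radial_mean[OF cf] r]
      by (auto intro!: derivative_eq_intros simp: v_def radial_mean_def)
    then show "(u d has_real_derivative v d r / r ^ n) (at r)"
    proof (rule has_field_derivative_transform_within_open)
      show "open {0::real<..}" "r \<in> {0<..}" using r by auto
    qed (use u in \<open>auto simp: picard_step_def\<close>)
  qed (use cu in \<open>auto simp: v_def\<close>)
  moreover have "u d 0 = d" for d using u[of 0 d] by (simp add: picard_step_def)
  moreover have "continuous_on UNIV (\<lambda>d. u d r) \<and> continuous_on UNIV (\<lambda>d. v d r)" if r: "r \<ge> 0" for r
  proof -
    obtain C where C: "\<And>d d' s. s \<in> {0..r} \<Longrightarrow> \<bar>u d s - u d' s\<bar> \<le> C * \<bar>d - d'\<bar>"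
      using picard_fixpoint_lipschitz[OF q h r, of n] cu u by meson
    have "0 \<le> C" using C[of 0 1 0] r by force
    have "C-lipschitz_on UNIV (\<lambda>d. u d r)"
      using C[of r] r \<open>0 \<le> C\<close> by (intro lipschitz_onI) (auto simp: dist_real_def)
    then have 1: "continuous_on UNIV (\<lambda>d. u d r)" by (rule lipschitz_on_continuous_on)
    have cq: "continuous_on {0..r} q" by (rule continuous_on_subset[OF q]) auto
    obtain Q where Q0: "Q \<ge> 0" and Q: "\<And>s. 0 \<le> s \<Longrightarrow> s \<le> r \<Longrightarrow> \<bar>q s\<bar> \<le> Q"
      using continuous_on_Icc_abs_bound[OF cq] by blast
    have "\<bar>v d r - v d' r\<bar> \<le> r ^ n * (Q * (L * C)) * r * \<bar>d - d'\<bar>" for d d'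
    proof -
      have int: "(\<lambda>s. s ^ n * (q s * h (u d s))) integrable_on {0..r}" for d
        by (intro integrable_continuous_interval continuous_on_subset[OF cf']) auto
      have "\<bar>v d r - v d' r\<bar> = \<bar>v d' r - v d r\<bar>" by simp
      also have "\<dots> = norm (integral {0..r} (\<lambda>s. s ^ n * (q s * h (u d s)) - s ^ n * (q s * h (u d' s))))"
        using int by (simp add: v_def integral_diff)
      also have "\<dots> \<le> integral {0..r} (\<lambda>s. r ^ n * (Q * (L * (C * \<bar>d - d'\<bar>))))"
      proof (rule integral_norm_bound_integral)
        show "(\<lambda>s. s ^ n * (q s * h (u d s)) - s ^ n * (q s * h (u d' s))) integrable_on {0..r}"
          by (intro integrable_diff int)
        fix s assume s: "s \<in> {0..r}"
        have "norm (s ^ n * (q s * h (u d s)) - s ^ n * (q s * h (u d' s)))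
            = s ^ n * (\<bar>q s\<bar> * \<bar>h (u d s) - h (u d' s)\<bar>)"
          using s by (simp add: abs_mult flip: right_diff_distrib)
        also have "\<dots> \<le> r ^ n * (Q * (L * (C * \<bar>d - d'\<bar>)))"
        proof (intro mult_mono power_mono)
          show "\<bar>q s\<bar> \<le> Q" using Q s by auto
          have "\<bar>h (u d s) - h (u d' s)\<bar> \<le> L * \<bar>u d s - u d' s\<bar>"
            using lipschitz_onD[OF h, of "u d s" "u d' s"] by (simp add: dist_real_def)
          also have "\<dots> \<le> L * (C * \<bar>d - d'\<bar>)" using C[OF s] L by (intro mult_left_mono)
          finally show "\<bar>h (u d s) - h (u d' s)\<bar> \<le> L * (C * \<bar>d - d'\<bar>)" .
        qed (use s Q0 in auto)
        finally show "norm (s ^ n * (q s * h (u d s)) - s ^ n * (q s * h (u d' s)))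
          \<le> r ^ n * (Q * (L * (C * \<bar>d - d'\<bar>)))" .
      qed auto
      also have "\<dots> = r ^ n * (Q * (L * C)) * r * \<bar>d - d'\<bar>" using r by simp
      finally show ?thesis .
    qed
    then have "(r ^ n * (Q * (L * C)) * r)-lipschitz_on UNIV (\<lambda>d. v d r)"
      using r Q0 L \<open>0 \<le> C\<close> by (intro lipschitz_onI) (auto simp: dist_real_def)
    then have 2: "continuous_on UNIV (\<lambda>d. v d r)" by (rule lipschitz_on_continuous_on)
    show ?thesis using 1 2 by simp
  qed
  moreover have "u 0 r = 0 \<and> v 0 r = 0" if h0: "h 0 = 0" and r: "0 \<le> r" for r
  proof -
    \<comment> \<open>The zero function is a fixed point for \<open>d = 0\<close>, so Lipschitz
      dependence between equal initial values forces \<open>u 0\<close> to vanish.\<close>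
    have step0: "picard_step n q h 0 (\<lambda>_. 0) s = 0" for s
      by (simp add: picard_step_def radial_mean_def [abs_def] h0)
    have zero: "u 0 s = 0" if s: "0 \<le> s" for s
    proof -
      obtain C where C: "\<forall>d d' u u'. continuous_on {0..} u \<and> (\<forall>r\<ge>0. u r = picard_step n q h d u r) \<longrightarrow>
          continuous_on {0..} u' \<and> (\<forall>r\<ge>0. u' r = picard_step n q h d' u' r) \<longrightarrow>
          (\<forall>r\<in>{0..s}. \<bar>u r - u' r\<bar> \<le> C * \<bar>d - d'\<bar>)"
        using picard_fixpoint_lipschitz[OF q h s, of n] by (elim exE)
      have "\<forall>r\<in>{0..s}. \<bar>u 0 r - 0\<bar> \<le> C * \<bar>0 - 0\<bar>"
        by (rule C[THEN spec, THEN spec, THEN spec, THEN spec, THEN mp, THEN mp])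
           (intro conjI allI impI cu u continuous_on_const step0[symmetric]; assumption)+
      then show ?thesis using s by force
    qed
    have "integral {0..r} (\<lambda>s. s ^ n * (q s * h (u 0 s))) = integral {0..r} (\<lambda>_. 0)"
      using zero h0 by (intro integral_cong) auto
    then show ?thesis using zero[OF r] by (simp add: v_def)
  qed
  ultimately show ?thesis by blast
qed

section \<open>Mean value bounds and uniqueness away from the origin\<close>

lemma deriv_lower_bound_imp:
  fixes f f' :: "real \<Rightarrow> real"
  assumes "x \<le> y" "continuous_on {x..y} f"
    and "\<And>r. x < r \<Longrightarrow> r < y \<Longrightarrow> (f has_real_derivative f' r) (at r)"
    and "\<And>r. x < r \<Longrightarrow> r < y \<Longrightarrow> c \<le> f' r"
  shows "c * (y - x) \<le> f y - f x"
proof -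
  have "f x - c * x \<le> f y - c * y"
  proof (rule DERIV_nonneg_imp_increasing_open[of x y "\<lambda>r. f r - c * r"])
    fix r assume r: "x < r" "r < y"
    have "((\<lambda>r. f r - c * r) has_real_derivative f' r - c) (at r)"
      using assms(3)[OF r] by (auto intro!: derivative_eq_intros)
    then show "\<exists>z. ((\<lambda>r. f r - c * r) has_real_derivative z) (at r) \<and> 0 \<le> z"
      using assms(4)[OF r] by auto
  qed (use assms in \<open>auto intro!: continuous_intros\<close>)
  then show ?thesis by (simp add: algebra_simps)
qed

lemma deriv_upper_bound_imp:
  fixes f f' :: "real \<Rightarrow> real"
  assumes "x \<le> y" "continuous_on {x..y} f"
    and "\<And>r. x < r \<Longrightarrow> r < y \<Longrightarrow> (f has_real_derivative f' r) (at r)"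
    and "\<And>r. x < r \<Longrightarrow> r < y \<Longrightarrow> f' r \<le> c"
  shows "f y - f x \<le> c * (y - x)"
proof -
  have "- c * (y - x) \<le> - f y - - f x"
    by (rule deriv_lower_bound_imp[where f'="\<lambda>r. - f' r"])
       (use assms in \<open>auto intro!: derivative_intros continuous_intros\<close>)
  then show ?thesis by simp
qed

text \<open>The squared distance \<open>e\<close> of the two solutions satisfies
  \<open>\<bar>e'\<bar> \<le> C * e\<close>. Hence \<open>e r * exp (C * r)\<close> increases and
  \<open>e r * exp (- C * r)\<close> decreases, and a zero of \<open>e\<close> propagates in both
  directions. The backward direction is what excludes a double zero of a positive solution.\<close>

lemma radial_system_unique:
  assumes h: "L-lipschitz_on UNIV h" and q: "continuous_on {x..y} q" and x: "0 < x" "x \<le> y"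
    and cu: "continuous_on {x..y} u1" "continuous_on {x..y} v1" "continuous_on {x..y} u2" "continuous_on {x..y} v2"
    and d1: "\<And>r. x < r \<Longrightarrow> r < y \<Longrightarrow> (u1 has_real_derivative v1 r / r ^ n) (at r)"
            "\<And>r. x < r \<Longrightarrow> r < y \<Longrightarrow> (v1 has_real_derivative - (q r * r ^ n * h (u1 r))) (at r)"
    and d2: "\<And>r. x < r \<Longrightarrow> r < y \<Longrightarrow> (u2 has_real_derivative v2 r / r ^ n) (at r)"
            "\<And>r. x < r \<Longrightarrow> r < y \<Longrightarrow> (v2 has_real_derivative - (q r * r ^ n * h (u2 r))) (at r)"
    and eq: "(u1 x = u2 x \<and> v1 x = v2 x) \<or> (u1 y = u2 y \<and> v1 y = v2 y)"
  shows "u1 x = u2 x \<and> v1 x = v2 x \<and> u1 y = u2 y \<and> v1 y = v2 y"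
proof -
  have L: "L \<ge> 0" by (rule lipschitz_on_nonneg[OF h])
  obtain Q where Q0: "Q \<ge> 0" and Q: "\<And>s. x \<le> s \<Longrightarrow> s \<le> y \<Longrightarrow> \<bar>q s\<bar> \<le> Q"
    using continuous_on_Icc_abs_bound[OF q] by blast
  \<comment> \<open>The sum of the Lipschitz constants on \<open>{x..y}\<close>:
    \<open>1 / x ^ n\<close> for the equation of \<open>u\<close>, \<open>Q * y ^ n * L\<close> for
    that of \<open>v\<close>. The mixed products in \<open>e'\<close> are then absorbed by the
    inequality between \<open>2 * a * b\<close> and the sum of squares.\<close>
  define C where "C = 1 / x ^ n + Q * y ^ n * L"
  define e where "e r = (u1 r - u2 r)\<^sup>2 + (v1 r - v2 r)\<^sup>2" for r
  define e' where "e' r = 2 * ((u1 r - u2 r) * (v1 r / r ^ n - v2 r / r ^ n))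
      + 2 * ((v1 r - v2 r) * (- (q r * r ^ n * h (u1 r)) + q r * r ^ n * h (u2 r)))" for r
  have ce: "continuous_on {x..y} e" unfolding e_def by (intro continuous_intros cu)
  have de: "(e has_real_derivative e' r) (at r)" if "x < r" "r < y" for r
    unfolding e_def e'_def
    using DERIV_add[OF DERIV_power[OF DERIV_diff[OF d1(1)[OF that] d2(1)[OF that]], of 2]
        DERIV_power[OF DERIV_diff[OF d1(2)[OF that] d2(2)[OF that]], of 2]]
    by (simp add: mult_ac)
  have e'_bound: "\<bar>e' r\<bar> \<le> C * e r" if r: "x < r" "r < y" for r
  proof -
    let ?a = "\<bar>u1 r - u2 r\<bar>" and ?b = "\<bar>v1 r - v2 r\<bar>"
    have "r > 0" using r x by simp
    have "v1 r / r ^ n - v2 r / r ^ n = (v1 r - v2 r) * (1 / r ^ n)" by (simp add: diff_divide_distrib)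
    then have "\<bar>v1 r / r ^ n - v2 r / r ^ n\<bar> = ?b * (1 / r ^ n)" using \<open>r > 0\<close> by (simp add: abs_mult)
    also have "\<dots> \<le> ?b * (1 / x ^ n)"
      using r x by (intro mult_left_mono divide_left_mono power_mono) auto
    finally have A: "\<bar>v1 r / r ^ n - v2 r / r ^ n\<bar> \<le> ?b * (1 / x ^ n)" .
    have "\<bar>- (q r * r ^ n * h (u1 r)) + q r * r ^ n * h (u2 r)\<bar> = \<bar>q r * r ^ n * (h (u2 r) - h (u1 r))\<bar>"
      by (simp add: algebra_simps)
    also have "\<dots> = \<bar>q r\<bar> * r ^ n * \<bar>h (u1 r) - h (u2 r)\<bar>"
      using \<open>r > 0\<close> by (simp add: abs_mult abs_minus_commute)
    also have "\<dots> \<le> Q * y ^ n * (L * ?a)"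
      using r x Q[of r] Q0 lipschitz_onD[OF h, of "u1 r" "u2 r"]
      by (intro mult_mono power_mono) (auto simp: dist_real_def)
    finally have B: "\<bar>- (q r * r ^ n * h (u1 r)) + q r * r ^ n * h (u2 r)\<bar> \<le> Q * y ^ n * (L * ?a)" .
    have "\<bar>e' r\<bar> \<le> 2 * ?a * \<bar>v1 r / r ^ n - v2 r / r ^ n\<bar>
        + 2 * ?b * \<bar>- (q r * r ^ n * h (u1 r)) + q r * r ^ n * h (u2 r)\<bar>"
      unfolding e'_def by (rule order_trans[OF abs_triangle_ineq]) (simp add: abs_mult mult.assoc)
    also have "\<dots> \<le> 2 * ?a * (?b * (1 / x ^ n)) + 2 * ?b * (Q * y ^ n * (L * ?a))"
      using A B by (intro add_mono mult_left_mono) auto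
    also have "\<dots> = C * (2 * ?a * ?b)" by (simp add: C_def algebra_simps)
    also have "\<dots> \<le> C * e r"
    proof (rule mult_left_mono)
      show "2 * ?a * ?b \<le> e r" using sum_squares_bound[of ?a ?b] by (simp add: e_def)
      show "0 \<le> C" using x Q0 L by (simp add: C_def)
    qed
    finally show ?thesis .
  qed
  have 1: "0 * (y - x) \<le> e y * exp (C * y) - e x * exp (C * x)"
  proof (rule deriv_lower_bound_imp[where f'="\<lambda>r. e' r * exp (C * r) + e r * (exp (C * r) * C)"])
    show "((\<lambda>r. e r * exp (C * r)) has_real_derivative e' r * exp (C * r) + e r * (exp (C * r) * C)) (at r)"
      if "x < r" "r < y" for r
      by (rule derivative_eq_intros de[OF that] refl | simp)+
    show "0 \<le> e' r * exp (C * r) + e r * (exp (C * r) * C)" if "x < r" "r < y" for r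
    proof -
      have "0 \<le> (e' r + C * e r) * exp (C * r)" using e'_bound[OF that] by (intro mult_nonneg_nonneg) auto
      then show ?thesis by (simp add: algebra_simps)
    qed
  qed (use x ce in \<open>auto intro!: continuous_intros\<close>)
  have 2: "e y * exp (- C * y) - e x * exp (- C * x) \<le> 0 * (y - x)"
  proof (rule deriv_upper_bound_imp[where f'="\<lambda>r. e' r * exp (- C * r) + e r * (exp (- C * r) * - C)"])
    show "((\<lambda>r. e r * exp (- C * r)) has_real_derivative e' r * exp (- C * r) + e r * (exp (- C * r) * - C)) (at r)"
      if "x < r" "r < y" for r
      by (rule derivative_eq_intros de[OF that] refl | simp)+
    show "e' r * exp (- C * r) + e r * (exp (- C * r) * - C) \<le> 0" if "x < r" "r < y" for r
    proof -
      have "(e' r - C * e r) * exp (- C * r) \<le> 0" using e'_bound[OF that] by (intro mult_nonpos_nonneg) auto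
      then show ?thesis by (simp add: algebra_simps)
    qed
  qed (use x ce in \<open>auto intro!: continuous_intros\<close>)
  have e_iff: "e r = 0 \<longleftrightarrow> u1 r = u2 r \<and> v1 r = v2 r" for r
    by (simp add: e_def sum_power2_eq_zero_iff)
  have e0: "e r \<ge> 0" for r by (simp add: e_def)
  have "e x = 0 \<and> e y = 0"
    using eq
  proof
    assume "u1 x = u2 x \<and> v1 x = v2 x"
    then have "e x = 0" by (simp add: e_iff)
    with 2 have "e y * exp (- C * y) \<le> 0" by simp
    then have "e y = 0" using e0[of y] by (simp add: mult_le_0_iff)
    then show ?thesis using \<open>e x = 0\<close> by simp
  next
    assume "u1 y = u2 y \<and> v1 y = v2 y"
    then have "e y = 0" by (simp add: e_iff)
    with 1 have "e x * exp (C * x) \<le> 0" by simp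
    then have "e x = 0" using e0[of x] by (simp add: mult_le_0_iff)
    then show ?thesis using \<open>e y = 0\<close> by simp
  qed
  then show ?thesis by (simp add: e_iff)
qed

section \<open>Solutions on intervals where the weight has a sign\<close>

(* Beyond the first zero of u the nonlinearity vanishes, so v stays constant; it is negative there
   by uniqueness for the initial value problem. *)
lemma radial_system_persistence:
  assumes sys: "radial_system n q h u v" and q: "continuous_on {0..} q" and h: "L-lipschitz_on UNIV h"
    and h0: "\<And>x. x \<le> 0 \<Longrightarrow> h x = 0"
    and u0: "u 0 > 0" and s: "0 < s" "u s \<le> 0" "s \<le> r"
  shows "v r < 0 \<and> (s < r \<longrightarrow> u r < 0)"
proof -
  note D = radial_systemD[OF sys]
  have "compact {x\<in>{0..s}. u x \<le> 0}"
  proof -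
    have "closed {x\<in>{0..s}. u x \<le> 0}"
      by (intro continuous_on_closed_Collect_le continuous_on_subset[OF D(1)] continuous_intros) auto
    then have "compact ({x\<in>{0..s}. u x \<le> 0} \<inter> {0..s})" by (intro closed_Int_compact) auto
    then show ?thesis by (simp add: Int_def conj_ac)
  qed
  then obtain z where z: "z \<in> {0..s}" "u z \<le> 0" and z_min: "\<And>x. x \<in> {0..s} \<Longrightarrow> u x \<le> 0 \<Longrightarrow> z \<le> x"
    using compact_attains_inf[of "{x\<in>{0..s}. u x \<le> 0}"] s by fastforce
  have z0: "z > 0" using z u0 by (cases "z = 0") auto
  have before: "u x > 0" if "0 \<le> x" "x < z" for x using z_min[of x] that z by fastforce
  have uz: "u z = 0"
  proof (rule ccontr)
    assume "u z \<noteq> 0"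
    then have "u z < 0" using z by simp
    moreover have "continuous_on {0..z} u" by (rule continuous_on_subset[OF D(1)]) auto
    ultimately obtain x where "0 \<le> x" "x \<le> z" "u x = 0"
      using IVT2'[of u z 0 0] u0 z0 by auto
    then show False using before[of x] \<open>u z < 0\<close> by (cases "x = z") auto
  qed
  \<comment> \<open>If \<open>v z > 0\<close>, then \<open>u\<close> would be negative just before
    its first zero; if \<open>v z = 0\<close>, backward uniqueness would make \<open>u\<close>
    vanish at \<open>z / 2\<close>.\<close>
  have vz: "v z < 0"
  proof (rule ccontr)
    assume nv: "\<not> v z < 0"
    show False
    proof (cases "v z > 0")
      case True
      then have "v z / z ^ n > 0" using z0 by simp
      from DERIV_pos_inc_left[OF D(4)[OF z0] this]
      obtain e where e: "e > 0" "\<And>k. 0 < k \<Longrightarrow> k < e \<Longrightarrow> u (z - k) < u z" by blast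
      have "u (z - min (e / 2) (z / 2)) < u z" using e z0 by (intro e(2)) (auto simp: min_def)
      moreover have "0 < u (z - min (e / 2) (z / 2))" using e z0 by (intro before) (auto simp: min_def)
      ultimately show False using uz by simp
    next
      case False
      then have "v z = 0" using nv by simp
      have "u (z/2) = 0 \<and> v (z/2) = 0 \<and> u z = 0 \<and> v z = 0"
        using uz \<open>v z = 0\<close> z0 h0[of 0] D(4,5)
        by (intro radial_system_unique[OF h, of "z/2" z q u v "\<lambda>_. 0" "\<lambda>_. 0" n])
           (auto intro: continuous_on_subset[OF q] continuous_on_subset[OF D(1)] continuous_on_subset[OF D(2)])
      then show False using before[of "z/2"] z0 by simp
    qed
  qed
  \<comment> \<open>The candidate continuation past \<open>z\<close>: it is negative, so
    \<open>h\<close> vanishes along it, and \<open>W\<close> with constant second component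
    \<open>v z\<close> solves the system.\<close>
  define W where "W r = integral {z..r} (\<lambda>s. v z / s ^ n)" for r
  have zr: "z \<le> r" using z s by simp
  have cW: "continuous_on {z..r} (\<lambda>s. v z / s ^ n)" using z0 by (intro continuous_intros) auto
  have dW: "(W has_real_derivative v z / x ^ n) (at x within {z..r})" if "x \<in> {z..r}" for x
    unfolding W_def using integral_has_real_derivative[OF cW that] .
  have dW': "(W has_real_derivative v z / x ^ n) (at x)" if "z < x" "x < r" for x
    using dW[of x] that at_within_interior[of x "{z..r}"] by simp
  have contW: "continuous_on {z..r} W"
    using dW by (intro DERIV_continuous_on)
  have W_neg: "W x < 0" if "z < x" "x \<le> r" for x
  proof -
    have "W x - W z \<le> v z / x ^ n * (x - z)"
    proof (rule deriv_upper_bound_imp)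
      show "continuous_on {z..x} W" by (rule continuous_on_subset[OF contW]) (use that in auto)
      fix y assume y: "z < y" "y < x"
      then show "(W has_real_derivative v z / y ^ n) (at y)" using that by (intro dW') auto
      have "1 / x ^ n \<le> 1 / y ^ n" using y z0 by (intro divide_left_mono power_mono) auto
      then show "v z / y ^ n \<le> v z / x ^ n"
        using vz mult_left_mono_neg[of "1 / x ^ n" "1 / y ^ n" "v z"] by simp
    qed (use that in auto)
    moreover have "v z / x ^ n * (x - z) < 0"
      using vz that z0 by (intro mult_neg_pos) (auto simp: divide_neg_pos)
    ultimately show ?thesis by (simp add: W_def)
  qed
  have "u z = W z \<and> v z = v z \<and> u r = W r \<and> v r = v z"
  proof (rule radial_system_unique[OF h, of z r q u v W "\<lambda>_. v z" n])
    fix x assume x: "z < x" "x < r"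
    show "(W has_real_derivative v z / x ^ n) (at x)" by (rule dW'[OF x])
    show "((\<lambda>_. v z) has_real_derivative - (q x * x ^ n * h (W x))) (at x)"
      using h0[of "W x"] W_neg[of x] x by simp
  qed (use z0 zr contW uz D(4,5) in \<open>auto intro: continuous_on_subset[OF q] continuous_on_subset[OF D(1)] continuous_on_subset[OF D(2)] simp: W_def\<close>)
  then show ?thesis using vz W_neg[of r] z(1) by auto
qed

text \<open>With \<open>h\<close> nonnegative, the sign of \<open>q\<close> alone decides whether
  \<open>v\<close> increases or decreases, whatever the sign of \<open>u\<close>. All estimates
  below rest on this.\<close>

locale radial_solution =
  fixes n :: nat and q h u v :: "real \<Rightarrow> real"
  assumes sys: "radial_system n q h u v" and h_nonneg: "\<And>x. 0 \<le> h x"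
begin

lemmas sysD = radial_systemD[OF sys]

section \<open>One-sided bounds for the increments of v and u\<close>

lemma v_diff_ge:
  assumes "0 \<le> x" "x \<le> y" "\<And>r. x < r \<Longrightarrow> r < y \<Longrightarrow> c \<le> - (q r * r ^ n * h (u r))"
  shows "c * (y - x) \<le> v y - v x"
  by (rule deriv_lower_bound_imp[OF assms(2) continuous_on_subset[OF sysD(2)] sysD(5) assms(3)])
     (use assms(1) in auto)

lemma v_diff_le:
  assumes "0 \<le> x" "x \<le> y" "\<And>r. x < r \<Longrightarrow> r < y \<Longrightarrow> - (q r * r ^ n * h (u r)) \<le> c"
  shows "v y - v x \<le> c * (y - x)"
  by (rule deriv_upper_bound_imp[OF assms(2) continuous_on_subset[OF sysD(2)] sysD(5) assms(3)])
     (use assms(1) in auto)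

lemma v_diff_ge_neg:
  assumes "0 \<le> x" "x \<le> y" "\<And>r. x < r \<Longrightarrow> r < y \<Longrightarrow> q r * r ^ n * h (u r) \<le> c"
  shows "- (c * (y - x)) \<le> v y - v x"
  using v_diff_ge[OF assms(1,2), of "- c"] assms(3) by simp

lemma v_diff_le_neg:
  assumes "0 \<le> x" "x \<le> y" "\<And>r. x < r \<Longrightarrow> r < y \<Longrightarrow> c \<le> q r * r ^ n * h (u r)"
  shows "v y - v x \<le> - (c * (y - x))"
  using v_diff_le[OF assms(1,2), of "- c"] assms(3) by simp

lemma v_mono:
  assumes "0 \<le> x" "x \<le> y" "\<And>r. x < r \<Longrightarrow> r < y \<Longrightarrow> q r \<le> 0"
  shows "v x \<le> v y"
proof -
  have "0 * (y - x) \<le> v y - v x"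
  proof (rule v_diff_ge[OF assms(1,2)])
    fix r assume r: "x < r" "r < y"
    then have "q r * (r ^ n * h (u r)) \<le> 0"
      using assms(1) assms(3)[OF r] h_nonneg by (intro mult_nonpos_nonneg) auto
    then show "0 \<le> - (q r * r ^ n * h (u r))" by (simp add: mult.assoc)
  qed
  then show ?thesis by simp
qed

lemma v_antimono:
  assumes "0 \<le> x" "x \<le> y" "\<And>r. x < r \<Longrightarrow> r < y \<Longrightarrow> 0 \<le> q r"
  shows "v y \<le> v x"
proof -
  have "v y - v x \<le> 0 * (y - x)"
    by (rule v_diff_le[OF assms(1,2)]) (use assms(1,3) h_nonneg in auto)
  then show ?thesis by simp
qed

text \<open>In this and the next three bounds, \<open>\<bar>v\<bar> \<ge> c\<close> is divided by
  the largest value of \<open>r ^ n\<close>, taken at the right end \<open>b\<close>, and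
  \<open>\<bar>v\<bar> \<le> c\<close> by the smallest, taken at the left end
  \<open>a\<close>.\<close>

lemma u_diff_ge_pos:
  assumes "0 \<le> x" "x \<le> y" "y \<le> b" "0 \<le> c" "\<And>r. x < r \<Longrightarrow> r < y \<Longrightarrow> c \<le> v r"
  shows "c / b ^ n * (y - x) \<le> u y - u x"
proof (rule deriv_lower_bound_imp[OF assms(2) continuous_on_subset[OF sysD(1)] sysD(4)])
  fix r assume r: "x < r" "r < y"
  show "c / b ^ n \<le> v r / r ^ n"
    using assms(1-4) r assms(5)[OF r] by (intro frac_le power_mono) auto
qed (use assms(1) in auto)

lemma u_diff_le_pos:
  assumes "0 < a" "a \<le> x" "x \<le> y" "0 \<le> c" "\<And>r. x < r \<Longrightarrow> r < y \<Longrightarrow> v r \<le> c"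
  shows "u y - u x \<le> c / a ^ n * (y - x)"
proof (rule deriv_upper_bound_imp[OF assms(3) continuous_on_subset[OF sysD(1)] sysD(4)])
  fix r assume r: "x < r" "r < y"
  show "v r / r ^ n \<le> c / a ^ n"
    using assms(1-4) r assms(5)[OF r] by (intro frac_le power_mono) auto
qed (use assms(1,2) in auto)

lemma u_diff_ge_neg:
  assumes "0 < a" "a \<le> x" "x \<le> y" "0 \<le> c" "\<And>r. x < r \<Longrightarrow> r < y \<Longrightarrow> - c \<le> v r"
  shows "- (c / a ^ n * (y - x)) \<le> u y - u x"
proof -
  have "- (c / a ^ n) * (y - x) \<le> u y - u x"
  proof (rule deriv_lower_bound_imp[OF assms(3) continuous_on_subset[OF sysD(1)] sysD(4)])
    fix r assume r: "x < r" "r < y"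
    have "- v r / r ^ n \<le> c / a ^ n"
      using assms(1-4) r assms(5)[OF r] by (intro frac_le power_mono) auto
    then show "- (c / a ^ n) \<le> v r / r ^ n" by simp
  qed (use assms(1,2) in auto)
  then show ?thesis by simp
qed

lemma u_diff_le_neg:
  assumes "0 \<le> x" "x \<le> y" "y \<le> b" "0 \<le> c" "\<And>r. x < r \<Longrightarrow> r < y \<Longrightarrow> v r \<le> - c"
  shows "u y - u x \<le> - (c / b ^ n * (y - x))"
proof -
  have "u y - u x \<le> - (c / b ^ n) * (y - x)"
  proof (rule deriv_upper_bound_imp[OF assms(2) continuous_on_subset[OF sysD(1)] sysD(4)])
    fix r assume r: "x < r" "r < y"
    have "c / b ^ n \<le> - v r / r ^ n"
      using assms(1-4) r assms(5)[OF r] by (intro frac_le power_mono) auto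
    then show "v r / r ^ n \<le> - (c / b ^ n)" by simp
  qed (use assms(1) in auto)
  then show ?thesis by simp
qed

lemma u_mono:
  assumes "0 \<le> x" "x \<le> y" "\<And>r. x < r \<Longrightarrow> r < y \<Longrightarrow> 0 \<le> v r"
  shows "u x \<le> u y"
  using u_diff_ge_pos[of x y y 0] assms by simp

lemma u_antimono:
  assumes "0 \<le> x" "x \<le> y" "\<And>r. x < r \<Longrightarrow> r < y \<Longrightarrow> v r \<le> 0"
  shows "u y \<le> u x"
  using u_diff_le_neg[of x y y 0] assms by simp

text \<open>As \<open>v\<close> decreases, a positive \<open>v r\<close> is a lower bound for
  \<open>v\<close> on all of \<open>{s..r}\<close>; starting from a positive value, \<open>u\<close>
  cannot climb by more than \<open>u r\<close> there.\<close>

lemma v_le_of_pos: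
  assumes "0 < s" "s < r" "r \<le> t" "\<And>x. s < x \<Longrightarrow> x < r \<Longrightarrow> 0 \<le> q x" "0 < u s" "0 \<le> u r"
  shows "v r \<le> u r * t ^ n / (r - s)"
proof (cases "v r \<le> 0")
  case True
  moreover have "0 \<le> u r * t ^ n / (r - s)" using assms by simp
  ultimately show ?thesis by linarith
next
  case False
  have "v r / t ^ n * (r - s) \<le> u r - u s"
  proof (rule u_diff_ge_pos)
    fix x assume "s < x" "x < r"
    then show "v r \<le> v x" using assms by (intro v_antimono) auto
  qed (use assms False in auto)
  then have "v r / t ^ n * (r - s) \<le> u r" using assms by simp
  then show ?thesis using assms by (simp add: field_simps)
qed

text \<open>The mirror image: too negative a \<open>v r\<close> would bring \<open>u\<close> to 0
  before \<open>t\<close>.\<close>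

lemma v_ge_of_pos:
  assumes "0 < r" "r < t" "\<And>x. r < x \<Longrightarrow> x < t \<Longrightarrow> 0 \<le> q x" "0 < u t" "0 \<le> u r"
  shows "- (u r * t ^ n / (t - r)) \<le> v r"
proof (cases "v r \<ge> 0")
  case True
  moreover have "0 \<le> u r * t ^ n / (t - r)" using assms by simp
  ultimately show ?thesis by linarith
next
  case False
  have "u t - u r \<le> - (- v r / t ^ n * (t - r))"
  proof (rule u_diff_le_neg)
    fix x assume "r < x" "x < t"
    then show "v x \<le> - (- v r)" using v_antimono[of r x] assms by auto
  qed (use assms False in auto)
  then have "- v r / t ^ n * (t - r) \<le> u r" using assms by simp
  then show ?thesis using assms by (simp add: field_simps)
qed

text \<open>A Harnack inequality. In the variable with differential \<open>dr / r ^ n\<close> the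
  function \<open>u\<close> is concave, so it lies below its tangent at \<open>r\<close>; because
  \<open>r\<close> keeps a distance from both ends, the slope of this tangent is at most a multiple
  of \<open>u r\<close>. An interior value thus controls the maximum.\<close>

lemma interior_lower_bound:
  assumes s: "0 < s" "s < r1" "r1 < r2" "r2 < t"
    and q: "\<And>r. s \<le> r \<Longrightarrow> r \<le> t \<Longrightarrow> 0 \<le> q r"
    and pos: "\<And>r. s \<le> r \<Longrightarrow> r \<le> t \<Longrightarrow> 0 < u r"
    and r: "r1 \<le> r" "r \<le> r2" and x: "s \<le> x" "x \<le> t"
  shows "u x \<le> (1 + (t / s) ^ n * (t - s) * (1 / (r1 - s) + 1 / (t - r2))) * u r"
proof -
  define D where "D = (t / s) ^ n * (t - s) * (1 / (r1 - s) + 1 / (t - r2))"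
  have ur: "0 < u r" using pos[of r] r s by simp
  have D: "0 \<le> D" using s by (simp add: D_def)
  have D1: "(t / s) ^ n * (t - s) * (1 / (r1 - s)) \<le> D" "(t / s) ^ n * (t - s) * (1 / (t - r2)) \<le> D"
    unfolding D_def using s by (intro mult_left_mono; simp)+
  have "u x - u r \<le> D * u r"
  proof (cases "r \<le> x")
    case True
    show ?thesis
    proof (cases "v r \<le> 0")
      case v: True
      have "u x \<le> u r"
      proof (rule u_antimono)
        fix y assume "r < y" "y < x"
        then show "v y \<le> 0" using v_antimono[of r y] v q r s x by force
      qed (use True r s in auto)
      then show ?thesis using D ur mult_nonneg_nonneg[of D "u r"] by linarith
    next
      case v: False
      have "u x - u r \<le> v r / s ^ n * (x - r)"
      proof (rule u_diff_le_pos)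
        fix y assume "r < y" "y < x"
        then show "v y \<le> v r" using q r s x by (intro v_antimono) auto
      qed (use True r s v in auto)
      also have "\<dots> \<le> v r / s ^ n * (t - s)" using v s r x True by (intro mult_left_mono) auto
      also have "v r \<le> u r * t ^ n / (r - s)"
        using s r q pos[of s] ur by (intro v_le_of_pos) auto
      also have "u r * t ^ n / (r - s) \<le> u r * t ^ n / (r1 - s)"
        using s r ur by (intro divide_left_mono) auto
      finally have "u x - u r \<le> u r * t ^ n / (r1 - s) / s ^ n * (t - s)"
        using s by (simp add: divide_right_mono mult_right_mono)
      also have "\<dots> = (t / s) ^ n * (t - s) * (1 / (r1 - s)) * u r" by (simp add: power_divide mult_ac)
      also have "\<dots> \<le> D * u r" using D1 ur by (intro mult_right_mono) auto
      finally show ?thesis .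
    qed
  next
    case False
    show ?thesis
    proof (cases "v r \<ge> 0")
      case v: True
      have "u x \<le> u r"
      proof (rule u_mono)
        fix y assume "x < y" "y < r"
        then show "0 \<le> v y" using v_antimono[of y r] v q r s x by force
      qed (use False r s x in auto)
      then show ?thesis using D ur mult_nonneg_nonneg[of D "u r"] by linarith
    next
      case v: False
      have "- (- v r / s ^ n * (r - x)) \<le> u r - u x"
      proof (rule u_diff_ge_neg)
        fix y assume "x < y" "y < r"
        then show "- (- v r) \<le> v y" using v_antimono[of y r] q r s x by auto
      qed (use False r s v x in auto)
      then have "u x - u r \<le> - v r / s ^ n * (r - x)" by simp
      also have "\<dots> \<le> - v r / s ^ n * (t - s)" using v s r x False by (intro mult_left_mono) (auto simp: divide_nonpos_pos)
      also have "- v r \<le> u r * t ^ n / (t - r)"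
        using v_ge_of_pos[of r t] s r q pos[of t] ur by auto
      also have "u r * t ^ n / (t - r) \<le> u r * t ^ n / (t - r2)"
        using s r ur by (intro divide_left_mono) auto
      finally have "u x - u r \<le> u r * t ^ n / (t - r2) / s ^ n * (t - s)"
        using s by (simp add: divide_right_mono mult_right_mono)
      also have "\<dots> = (t / s) ^ n * (t - s) * (1 / (t - r2)) * u r" by (simp add: power_divide mult_ac)
      also have "\<dots> \<le> D * u r" using D1 ur by (intro mult_right_mono) auto
      finally show ?thesis .
    qed
  qed
  then show ?thesis by (simp add: D_def algebra_simps)
qed

text \<open>Let \<open>B\<close> be the maximum of \<open>u\<close>. If
  \<open>B / D \<ge> U\<close>, then \<open>u \<ge> B / D\<close> on \<open>{r1..r2}\<close>, and
  superlinearity makes \<open>v\<close> fall there by at least \<open>l * (B / D)\<close> times a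
  constant. Positivity at \<open>s\<close> and \<open>t\<close> allows \<open>v\<close> to fall only
  by a constant multiple of \<open>B\<close>. After cancelling \<open>B / D\<close> this is exactly
  what the condition on \<open>l\<close> forbids.\<close>

lemma apriori_bound:
  assumes s: "0 < s" "s < r1" "r1 < r2" "r2 < t" and c: "0 < c"
    and q: "\<And>r. s \<le> r \<Longrightarrow> r \<le> t \<Longrightarrow> 0 \<le> q r" and qc: "\<And>r. r1 \<le> r \<Longrightarrow> r \<le> r2 \<Longrightarrow> c \<le> q r"
    and pos: "\<And>r. s \<le> r \<Longrightarrow> r \<le> t \<Longrightarrow> 0 < u r"
    and D: "D = 1 + (t / s) ^ n * (t - s) * (1 / (r1 - s) + 1 / (t - r2))"
    and l: "D * t ^ n * (1 / (r1 - s) + 1 / (t - r2)) < l * (c * s ^ n * (r2 - r1))" and l0: "0 \<le> l"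
    and h: "\<And>x. U \<le> x \<Longrightarrow> l * x \<le> h x"
    and r: "s \<le> r" "r \<le> t"
  shows "u r \<le> D * U"
proof -
  have "continuous_on {s..t} u" by (rule continuous_on_subset[OF sysD(1)]) (use s in auto)
  then obtain z where z: "z \<in> {s..t}" and zmax: "\<And>x. x \<in> {s..t} \<Longrightarrow> u x \<le> u z"
    using continuous_attains_sup[of "{s..t}" u] s by auto
  define B where "B = u z"
  have B: "0 < B" using pos z by (simp add: B_def)
  have D0: "D > 0" using s unfolding D by (intro add_pos_nonneg mult_nonneg_nonneg) auto
  have low: "B / D \<le> u x" if "r1 \<le> x" "x \<le> r2" for x
  proof -
    have "u z \<le> D * u x" unfolding D using z by (intro interior_lower_bound[OF s q pos that]) auto
    then show ?thesis using D0 by (simp add: B_def field_simps)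
  qed
  have "B / D < U"
  proof (rule ccontr)
    assume "\<not> B / D < U"
    then have big: "U \<le> B / D" by simp
    have "v r2 - v r1 \<le> - (c * s ^ n * (l * (B / D)) * (r2 - r1))"
    proof (rule v_diff_le_neg)
      fix x assume x: "r1 < x" "x < r2"
      show "c * s ^ n * (l * (B / D)) \<le> q x * x ^ n * h (u x)"
      proof (intro mult_mono power_mono)
        have "l * (B / D) \<le> l * u x" using low[of x] x l0 by (intro mult_left_mono) auto
        also have "\<dots> \<le> h (u x)" using low[of x] x big by (intro h) auto
        finally show "l * (B / D) \<le> h (u x)" .
      qed (use x s c qc[of x] l0 B D0 in auto)
    qed (use s in auto)
    moreover have "v r1 \<le> B * t ^ n / (r1 - s)"
    proof -
      have "v r1 \<le> u r1 * t ^ n / (r1 - s)"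
        using s q pos[of s] pos[of r1] by (intro v_le_of_pos) auto
      also have "\<dots> \<le> B * t ^ n / (r1 - s)"
        using s zmax[of r1] by (intro divide_right_mono mult_right_mono) (auto simp: B_def)
      finally show ?thesis .
    qed
    moreover have "- (B * t ^ n / (t - r2)) \<le> v r2"
    proof -
      have "u r2 * t ^ n / (t - r2) \<le> B * t ^ n / (t - r2)"
        using s zmax[of r2] by (intro divide_right_mono mult_right_mono) (auto simp: B_def)
      moreover have "- (u r2 * t ^ n / (t - r2)) \<le> v r2"
        using s q pos[of t] pos[of r2] by (intro v_ge_of_pos) auto
      ultimately show ?thesis by linarith
    qed
    ultimately have "(c * s ^ n * (l * (B / D))) * (r2 - r1) \<le> B * t ^ n / (r1 - s) + B * t ^ n / (t - r2)"
      by linarith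
    moreover have "(B / D) * (l * (c * s ^ n * (r2 - r1))) = (c * s ^ n * (l * (B / D))) * (r2 - r1)"
      by (simp add: mult_ac)
    moreover have "(B / D) * (D * t ^ n * (1 / (r1 - s) + 1 / (t - r2))) = B * t ^ n / (r1 - s) + B * t ^ n / (t - r2)"
      using D0 by (simp add: distrib_left)
    ultimately have "(B / D) * (l * (c * s ^ n * (r2 - r1))) \<le> (B / D) * (D * t ^ n * (1 / (r1 - s) + 1 / (t - r2)))"
      by linarith
    moreover have "B / D > 0" using B D0 by simp
    ultimately have "l * (c * s ^ n * (r2 - r1)) \<le> D * t ^ n * (1 / (r1 - s) + 1 / (t - r2))"
      using mult_le_cancel_left_pos by blast
    then show False using l by simp
  qed
  then have "B \<le> D * U" using D0 by (simp add: field_simps)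
  then show ?thesis using zmax[of r] r by (simp add: B_def)
qed

text \<open>The bound \<open>v_ge_of_pos\<close> degenerates as its point approaches
  \<open>t\<close>. It is applied at the midpoint, whence the factor 2, and the further loss of
  \<open>v\<close> from there to \<open>t\<close> is bounded by the size of \<open>q\<close> and
  \<open>h\<close>.\<close>

lemma end_slope_bound:
  assumes s: "0 < s" "s < t"
    and q: "\<And>r. s \<le> r \<Longrightarrow> r \<le> t \<Longrightarrow> 0 \<le> q r" "\<And>r. s \<le> r \<Longrightarrow> r \<le> t \<Longrightarrow> q r \<le> Q"
    and pos: "\<And>r. s \<le> r \<Longrightarrow> r \<le> t \<Longrightarrow> 0 < u r" "\<And>r. s \<le> r \<Longrightarrow> r \<le> t \<Longrightarrow> u r \<le> M"
    and h: "\<And>x. 0 \<le> x \<Longrightarrow> x \<le> M \<Longrightarrow> h x \<le> H"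
  shows "- (M * t ^ n / (t - s) * 2 + Q * t ^ n * H * (t - s)) \<le> v t"
proof -
  define r where "r = (s + t) / 2"
  have r: "s < r" "r < t" "t - r = (t - s) / 2" using s by (auto simp: r_def field_simps)
  have Q0: "0 \<le> Q" using q[of s] s by simp
  have H0: "0 \<le> H" using h[of "u s"] h_nonneg[of "u s"] pos[of s] s by simp
  have "u r * t ^ n / (t - r) \<le> M * t ^ n / (t - r)"
    using s r pos(2)[of r] by (intro divide_right_mono mult_right_mono) auto
  moreover have "- (u r * t ^ n / (t - r)) \<le> v r"
    using s r q pos(1)[of t] pos(1)[of r] by (intro v_ge_of_pos) auto
  moreover have "- (Q * t ^ n * H * (t - r)) \<le> v t - v r"
  proof (rule v_diff_ge_neg)
    fix x assume x: "r < x" "x < t"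
    show "q x * x ^ n * h (u x) \<le> Q * t ^ n * H"
      using x r s q[of x] pos[of x] Q0 H0 h_nonneg
      by (intro mult_mono power_mono h) auto
  qed (use r s in auto)
  moreover have "(Q * t ^ n * H) * (t - r) \<le> Q * t ^ n * H * (t - s)"
    using r s Q0 H0 by (intro mult_left_mono) auto
  moreover have "M * t ^ n / (t - r) = M * t ^ n / (t - s) * 2" unfolding r(3) by simp
  ultimately show ?thesis by linarith
qed

text \<open>If \<open>v s < 0\<close>, then \<open>v \<le> 0\<close> on the whole interval because
  \<open>v\<close> increases; so \<open>u\<close> decreases to \<open>e\<close> and stays above it,
  and \<open>v\<close> gains at least \<open>K\<close> on \<open>{r1..r2}\<close>. Together with
  \<open>v t \<ge> - K\<close> this contradicts \<open>v s < 0\<close>. In the application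
  \<open>c\<close> carries the factor \<open>\<mu>\<close>.\<close>

lemma v_nonneg_at_level:
  assumes s: "0 < t" "t < r1" "r1 < r2" "r2 < s"
    and q: "\<And>r. t \<le> r \<Longrightarrow> r \<le> s \<Longrightarrow> q r \<le> 0" and qc: "\<And>r. r1 \<le> r \<Longrightarrow> r \<le> r2 \<Longrightarrow> q r \<le> - c" and c: "0 \<le> c"
    and h: "\<And>x. e \<le> x \<Longrightarrow> H \<le> h x" and H: "0 \<le> H"
    and K: "- K \<le> v t" "K \<le> c * t ^ n * H * (r2 - r1)" and u: "u s = e"
  shows "0 \<le> v s"
proof (rule ccontr)
  assume "\<not> 0 \<le> v s"
  then have vs: "v s < 0" by simp
  have vneg: "v r \<le> 0" if "t \<le> r" "r \<le> s" for r
    using v_mono[of r s] that q s vs by force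
  have ue: "e \<le> u r" if "t \<le> r" "r \<le> s" for r
  proof -
    have "u s \<le> u r" using that s vneg by (intro u_antimono) auto
    then show ?thesis using u by simp
  qed
  have "(c * t ^ n * H) * (r2 - r1) \<le> v r2 - v r1"
  proof (rule v_diff_ge)
    fix r assume r: "r1 < r" "r < r2"
    have "q r * r ^ n \<le> 0" using qc[of r] c r s by (intro mult_nonpos_nonneg) auto
    then have "c * t ^ n * H \<le> (- q r) * r ^ n * h (u r)"
      using r s qc[of r] c H h_nonneg ue[of r] by (intro mult_mono power_mono h) auto
    then show "c * t ^ n * H \<le> - (q r * r ^ n * h (u r))" by simp
  qed (use s in auto)
  moreover have "v t \<le> v r1" using s q by (intro v_mono) auto
  moreover have "v r2 \<le> v s" using s q by (intro v_mono) auto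
  ultimately show False using vs K by linarith
qed

text \<open>On \<open>{s..t}\<close> the solution stays below \<open>e * A\<close>, so the
  superlinear smallness of \<open>h\<close> lets \<open>v\<close> lose at most \<open>e / 2\<close>.
  In the first starting case \<open>u\<close> then keeps half of its height \<open>e\<close>; in the
  second \<open>v\<close> stays above \<open>e / 2\<close> and lifts \<open>u\<close>. From
  \<open>t\<close> on \<open>u\<close> has a lower bound proportional to \<open>e\<close>, and a
  strongly negative weight turns it into growth beyond \<open>M\<close>.\<close>

lemma small_then_large:
  assumes s: "0 < s" "s < t" "t < r1" "r1 < r2" "r2 < s'" and e: "0 < e"
    and start: "(u s = e \<and> 0 \<le> v s \<and> v s \<le> e) \<or> (0 < u s \<and> u s \<le> e \<and> v s = e)"
    and q: "\<And>r. s \<le> r \<Longrightarrow> r \<le> t \<Longrightarrow> 0 \<le> q r" "\<And>r. s \<le> r \<Longrightarrow> r \<le> t \<Longrightarrow> q r \<le> Q"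
    and qneg: "\<And>r. t \<le> r \<Longrightarrow> r \<le> s' \<Longrightarrow> q r \<le> 0"
    and qc: "\<And>r. r1 \<le> r \<Longrightarrow> r \<le> r2 \<Longrightarrow> q r \<le> - c" and c: "0 \<le> c"
    and A: "A = 1 + (t - s) / s ^ n"
    and h: "\<And>x. x \<le> e * A \<Longrightarrow> h x \<le> \<delta> * (e * A)"
    and dl: "0 \<le> \<delta>" "\<delta> * (A * Q * t ^ n * (t - s)) \<le> 1 / 2" "\<delta> * (A * Q * t ^ n * (t - s)) * ((s' - s) / s ^ n) \<le> 1 / 2"
    and H: "\<And>x. e * min (1 / 2) ((t - s) / (2 * s' ^ n)) \<le> x \<Longrightarrow> H \<le> h x" "0 \<le> H"
    and big: "e + 2 * s' ^ n * M / (r2 - r1) \<le> c * t ^ n * H * (r2 - r1) / 2" and M: "0 \<le> M"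
  shows "M < u s'"
proof -
  \<comment> \<open>The two entries belong to the two starting cases: half of the height
    \<open>e\<close>, or the rise over \<open>{s..t}\<close> at slope
    \<open>e / 2 / s' ^ n\<close>.\<close>
  define k where "k = min (1 / 2) ((t - s) / (2 * s' ^ n))"
  define \<eta> where "\<eta> = \<delta> * (A * Q * t ^ n * (t - s))"
  have k: "0 < k" using s by (simp add: k_def)
  have A0: "0 < A" using s by (simp add: A add_pos_pos)
  have Q0: "0 \<le> Q" using q[of s] s by simp
  have eta: "0 \<le> \<eta>" "\<eta> \<le> 1 / 2" "\<eta> * ((s' - s) / s ^ n) \<le> 1 / 2"
    using dl s A0 Q0 by (auto simp: \<eta>_def)
  have vs: "v s \<le> e" "0 \<le> v s" and us: "u s \<le> e" "0 < u s" using start e by auto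
  have u_le: "u r \<le> e * A" if "s \<le> r" "r \<le> t" for r
  proof -
    have "u r - u s \<le> e / s ^ n * (r - s)"
    proof (rule u_diff_le_pos)
      fix y assume "s < y" "y < r"
      then show "v y \<le> e" using v_antimono[of s y] vs q that s by force
    qed (use s e that in auto)
    also have "\<dots> \<le> e / s ^ n * (t - s)" using that s e by (intro mult_left_mono) auto
    finally show ?thesis using us by (simp add: A algebra_simps)
  qed
  have v_ge1: "v s - \<eta> * e \<le> v r" if r: "s \<le> r" "r \<le> t" for r
  proof -
    have "- (Q * t ^ n * (\<delta> * (e * A)) * (r - s)) \<le> v r - v s"
    proof (rule v_diff_ge_neg)
      fix x assume x: "s < x" "x < r"
      show "q x * x ^ n * h (u x) \<le> Q * t ^ n * (\<delta> * (e * A))"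
        using x r s q[of x] Q0 h_nonneg u_le[of x] by (intro mult_mono power_mono h) auto
    qed (use r s in auto)
    moreover have "(Q * t ^ n * (\<delta> * (e * A))) * (r - s) \<le> (Q * t ^ n * (\<delta> * (e * A))) * (t - s)"
      using r s Q0 dl e A0 by (intro mult_left_mono) auto
    moreover have "(Q * t ^ n * (\<delta> * (e * A))) * (t - s) = \<eta> * e" by (simp add: \<eta>_def)
    ultimately show ?thesis by linarith
  qed
  have v_ge: "v s - \<eta> * e \<le> v r" if r: "s \<le> r" "r \<le> s'" for r
  proof (cases "r \<le> t")
    case True then show ?thesis using v_ge1 r by simp
  next
    case False
    have "v t \<le> v r" using False r s qneg by (intro v_mono) auto
    then show ?thesis using v_ge1[of t] s by simp
  qed
  have eta_e: "\<eta> * e \<le> e / 2" using eta e by (simp add: mult.commute)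
  have u_ge: "e * k \<le> u r" if r: "t \<le> r" "r \<le> s'" for r
    using start
  proof
    assume st: "u s = e \<and> 0 \<le> v s \<and> v s \<le> e"
    have "- (\<eta> * e / s ^ n * (r - s)) \<le> u r - u s"
    proof (rule u_diff_ge_neg)
      fix y assume "s < y" "y < r"
      then show "- (\<eta> * e) \<le> v y" using v_ge[of y] st r by simp
    qed (use s eta e r in auto)
    moreover have "\<eta> * e / s ^ n * (r - s) \<le> \<eta> * e / s ^ n * (s' - s)"
      using s eta e r by (intro mult_left_mono) auto
    moreover have "\<eta> * e / s ^ n * (s' - s) = e * (\<eta> * ((s' - s) / s ^ n))" by simp
    moreover have "e * (\<eta> * ((s' - s) / s ^ n)) \<le> e * (1 / 2)" using eta e by (intro mult_left_mono) auto
    moreover have "e * k \<le> e * (1 / 2)" using e by (intro mult_left_mono) (auto simp: k_def)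
    ultimately show ?thesis using st by linarith
  next
    assume st: "0 < u s \<and> u s \<le> e \<and> v s = e"
    have "e / 2 / s' ^ n * (r - s) \<le> u r - u s"
    proof (rule u_diff_ge_pos)
      fix y assume "s < y" "y < r"
      then have "v s - \<eta> * e \<le> v y" using r by (intro v_ge) auto
      then show "e / 2 \<le> v y" using st eta_e by linarith
    qed (use s e r in auto)
    moreover have "e / 2 / s' ^ n * (t - s) \<le> e / 2 / s' ^ n * (r - s)"
      using s e r by (intro mult_left_mono) auto
    moreover have "e * k \<le> e * ((t - s) / (2 * s' ^ n))" using e by (intro mult_left_mono) (auto simp: k_def)
    moreover have "e * ((t - s) / (2 * s' ^ n)) = e / 2 / s' ^ n * (t - s)" by simp
    ultimately show ?thesis using st by linarith
  qed
  \<comment> \<open>On the first half of \<open>{r1..r2}\<close> the weight lifts \<open>v\<close>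
    to \<open>w\<close>; on the second half the slope \<open>w / s' ^ n\<close> raises
    \<open>u\<close> by exactly \<open>M\<close>, which explains the value of
    \<open>w\<close>.\<close>
  define z where "z = (r1 + r2) / 2"
  have z: "r1 < z" "z < r2" "z - r1 = (r2 - r1) / 2" "r2 - z = (r2 - r1) / 2" using s by (auto simp: z_def field_simps)
  define w where "w = 2 * s' ^ n * M / (r2 - r1)"
  have w0: "0 \<le> w" using s M by (simp add: w_def)
  have v_large: "w \<le> v r" if r: "z \<le> r" "r \<le> s'" for r
  proof -
    have "(c * t ^ n * H) * (z - r1) \<le> v z - v r1"
    proof (rule v_diff_ge)
      fix x assume x: "r1 < x" "x < z"
      have "q x * x ^ n \<le> 0" using qc[of x] c x s z by (intro mult_nonpos_nonneg) auto
      then have "c * t ^ n * H \<le> (- q x) * x ^ n * h (u x)"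
        using x s z qc[of x] c H(2) h_nonneg u_ge[of x]
        by (intro mult_mono power_mono H(1)) (auto simp: k_def)
      then show "c * t ^ n * H \<le> - (q x * x ^ n * h (u x))" by simp
    qed (use s z in auto)
    moreover have "v z \<le> v r" using s z r qneg by (intro v_mono) auto
    moreover have "- e / 2 \<le> v r1" using v_ge[of r1] s vs eta_e by simp
    moreover have "(c * t ^ n * H) * (z - r1) = c * t ^ n * H * (r2 - r1) / 2" using z by simp
    moreover have "e + w \<le> c * t ^ n * H * (r2 - r1) / 2" using big by (simp add: w_def)
    ultimately show ?thesis using e by linarith
  qed
  have "w / s' ^ n * (s' - z) \<le> u s' - u z"
    by (rule u_diff_ge_pos) (use s z w0 v_large in auto)
  moreover have "w / s' ^ n * (r2 - z) \<le> w / s' ^ n * (s' - z)"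
    using s z w0 by (intro mult_left_mono) auto
  moreover have "w / s' ^ n * (r2 - z) = M"
    unfolding z(4) w_def using s by simp
  moreover have "0 < u z" using u_ge[of z] s z mult_pos_pos[OF e k] by linarith
  ultimately show ?thesis by linarith
qed

end

section \<open>Counting solutions of the shooting problem\<close>

text \<open>The combinatorial core, free of differential equations; \<open>U i\<close> and
  \<open>V i\<close> stand for \<open>u\<close> and \<open>v\<close> at the i-th shooting point. At
  the next point both ends of an interval become nonpositive and the new point between them is the
  large one. One of the two halves is thus reversed, which is why unoriented segments replace
  intervals.\<close>

lemma shooting_count:
  fixes U V :: "nat \<Rightarrow> real \<Rightarrow> real" and e :: "nat \<Rightarrow> real" and good :: "real \<Rightarrow> bool"
  assumes cont: "\<And>i. continuous_on UNIV (U i)" "\<And>i. continuous_on UNIV (V i)"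
    and zero: "\<And>i. U i 0 = 0" "\<And>i. V i 0 = 0"
    and neg_v: "\<And>i d. i \<in> {1..m} \<Longrightarrow> 0 < d \<Longrightarrow> U i d \<le> 0 \<Longrightarrow> V i d < 0"
    and neg_u: "\<And>i d. i \<in> {1..m} \<Longrightarrow> 0 < d \<Longrightarrow> U i d \<le> 0 \<Longrightarrow> U (Suc i) d \<le> 0"
    and large: "\<And>i d. i \<in> {1..m} \<Longrightarrow> 0 < d \<Longrightarrow> M < U i d \<Longrightarrow> U (Suc i) d \<le> 0"
    and small: "\<And>i d. i \<in> {1..m} \<Longrightarrow> 0 < d \<Longrightarrow>
        (U i d = e i \<and> V i d \<le> e i) \<or> (0 < U i d \<and> U i d \<le> e i \<and> V i d = e i) \<Longrightarrow> M < U (Suc i) d"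
    and e: "\<And>i. i \<in> {1..m} \<Longrightarrow> 0 < e i \<and> e i \<le> M"
    and final: "\<And>p q. 0 < p \<Longrightarrow> 0 < q \<Longrightarrow> U (Suc m) p \<le> 0 \<Longrightarrow> M < U (Suc m) q \<Longrightarrow>
        \<exists>d\<in>open_segment p q. good d"
    and init: "0 < q0" "M < U 1 q0"
  shows "\<exists>F. finite F \<and> card F = 2 ^ m - 1 \<and> (\<forall>d\<in>F. 0 < d \<and> good d)"
proof -
  have exit: "\<exists>d\<in>open_segment p q. 0 < d \<and> M < U (Suc i) d"
    if i: "i \<in> {1..m}" and p: "0 \<le> p" "U i p \<le> 0" and q: "0 < q" "M < U i q" for i p q
  proof -
    \<comment> \<open>The maximum starts below \<open>e i\<close> at \<open>p\<close> because
      \<open>V\<close> is nonpositive wherever \<open>U\<close> is. Crossing the level with the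
      maximum instead of \<open>U\<close> bounds \<open>V\<close> from above as well.\<close>
    define f where "f d = max (U i d) (V i d)" for d
    have "V i p \<le> 0" using neg_v[OF i, of p] p zero(2)[of i] by (cases "p = 0") auto
    then have fp: "f p < e i" using p e[OF i] by (simp add: f_def)
    have fq: "e i < f q" using q e[OF i] by (auto simp: f_def less_max_iff_disj)
    have "continuous_on (closed_segment p q) f" unfolding f_def
      by (intro continuous_intros continuous_on_subset[OF cont(1)] continuous_on_subset[OF cont(2)]) auto
    then have "connected (f ` closed_segment p q)" by (intro connected_continuous_image) auto
    then have "{f p..f q} \<subseteq> f ` closed_segment p q" by (rule connected_contains_Icc) auto
    then obtain d where d: "d \<in> closed_segment p q" "f d = e i"
      using fp fq by (metis atLeastAtMost_iff imageE less_imp_le subsetD)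
    have neq: "d \<noteq> p" "d \<noteq> q" using d fp fq by auto
    then have seg: "d \<in> open_segment p q" using d by (simp add: open_segment_def)
    have d0: "0 < d" using d(1) neq p q by (auto simp: closed_segment_eq_real_ivl split: if_splits)
    have "(U i d = e i \<and> V i d \<le> e i) \<or> (U i d \<le> e i \<and> V i d = e i)"
      using d(2) by (auto simp: f_def max_def split: if_splits)
    moreover have "0 < U i d" if "V i d = e i"
      using neg_v[OF i d0] e[OF i] that by force
    ultimately have "M < U (Suc i) d" by (intro small[OF i d0]) auto
    then show ?thesis using seg d0 by blast
  qed
  have split: "open_segment p d \<inter> open_segment q d = {}" "open_segment p d \<subseteq> open_segment p q"
      "open_segment q d \<subseteq> open_segment p q"
    if "d \<in> open_segment p q" for p q d :: real
    using that by (auto simp: open_segment_eq_real_ivl split: if_splits)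
  \<comment> \<open>\<open>k\<close> is the number of splittings still to come, so the current
    shooting point has index \<open>Suc m - k\<close>.\<close>
  have nontriv: "\<exists>F. finite F \<and> card F = 2 ^ k \<and> F \<subseteq> open_segment p q \<and> (\<forall>d\<in>F. good d)"
    if "k \<le> m" "0 < p" "0 < q" "U (Suc m - k) p \<le> 0" "M < U (Suc m - k) q" for k p q
    using that
  proof (induction k arbitrary: p q)
    case 0
    then obtain d where "d \<in> open_segment p q" "good d" using final[of p q] by auto
    then show ?case by (intro exI[of _ "{d}"]) auto
  next
    case (Suc k)
    define i where "i = Suc m - Suc k"
    have i: "i \<in> {1..m}" "Suc i = Suc m - k" using Suc.prems by (auto simp: i_def)
    have iU: "U i p \<le> 0" "M < U i q" using Suc.prems by (auto simp: i_def)
    obtain d where d: "d \<in> open_segment p q" "0 < d" "M < U (Suc i) d"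
      using exit[OF i(1) less_imp_le[OF Suc.prems(2)] iU(1) Suc.prems(3) iU(2)] by blast
    have "U (Suc i) p \<le> 0" "U (Suc i) q \<le> 0"
      using neg_u[OF i(1)] large[OF i(1)] Suc.prems iU by auto
    then obtain F1 F2 where F: "finite F1" "card F1 = 2 ^ k" "F1 \<subseteq> open_segment p d" "\<forall>d\<in>F1. good d"
        "finite F2" "card F2 = 2 ^ k" "F2 \<subseteq> open_segment q d" "\<forall>d\<in>F2. good d"
      using Suc.IH[of p d] Suc.IH[of q d] Suc.prems d i(2) by auto
    then have "F1 \<inter> F2 = {}" using split(1)[OF d(1)] by blast
    then have "card (F1 \<union> F2) = 2 ^ Suc k" using F by (simp add: card_Un_disjoint)
    moreover have "F1 \<union> F2 \<subseteq> open_segment p q" using F split(2,3)[OF d(1)] by blast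
    ultimately show ?case using F by (intro exI[of _ "F1 \<union> F2"]) auto
  qed
  \<comment> \<open>The segment that begins at the trivial solution. \<open>final\<close> is
    available only for a positive left end, so this branch yields nothing at \<open>k = 0\<close>,
    and each step adds the \<open>2 ^ k\<close> of the other half:
    \<open>(2 ^ k - 1) + 2 ^ k = 2 ^ Suc k - 1\<close>.\<close>
  have triv: "\<exists>F. finite F \<and> card F = 2 ^ k - 1 \<and> F \<subseteq> open_segment 0 q \<and> (\<forall>d\<in>F. good d)"
    if "k \<le> m" "0 < q" "M < U (Suc m - k) q" for k q
    using that
  proof (induction k arbitrary: q)
    case 0
    then show ?case by (intro exI[of _ "{}"]) auto
  next
    case (Suc k)
    define i where "i = Suc m - Suc k"
    have i: "i \<in> {1..m}" "Suc i = Suc m - k" using Suc.prems by (auto simp: i_def)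
    have iU: "U i 0 \<le> 0" "M < U i q" using Suc.prems zero(1)[of i] by (auto simp: i_def)
    obtain d where d: "d \<in> open_segment 0 q" "0 < d" "M < U (Suc i) d"
      using exit[OF i(1) order_refl iU(1) Suc.prems(2) iU(2)] by blast
    have "U (Suc i) q \<le> 0" using large[OF i(1)] Suc.prems iU by auto
    then obtain F2 where F2: "finite F2" "card F2 = 2 ^ k" "F2 \<subseteq> open_segment q d" "\<forall>d\<in>F2. good d"
      using nontriv[of k q d] Suc.prems d i(2) by auto
    obtain F1 where F1: "finite F1" "card F1 = 2 ^ k - 1" "F1 \<subseteq> open_segment 0 d" "\<forall>d\<in>F1. good d"
      using Suc.IH[of d] Suc.prems d i(2) by auto
    have "F1 \<inter> F2 = {}" using split(1)[OF d(1)] F1 F2 by blast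
    then have "card (F1 \<union> F2) = 2 ^ Suc k - 1" using F1 F2 by (simp add: card_Un_disjoint)
    moreover have "F1 \<union> F2 \<subseteq> open_segment 0 q" using F1 F2 split(2,3)[OF d(1)] by blast
    ultimately show ?case using F1 F2 by (intro exI[of _ "F1 \<union> F2"]) auto
  qed
  obtain F where "finite F" "card F = 2 ^ m - 1" "F \<subseteq> open_segment 0 q0" "\<forall>d\<in>F. good d"
    using triv[of m q0] init by auto
  then show ?thesis using init(1) by (intro exI[of _ F]) (auto simp: open_segment_eq_real_ivl)
qed

text \<open>The two open sets are disjoint for the following reason. If \<open>u\<close> and
  \<open>v\<close> are positive at some point beyond \<open>t\<close>, then \<open>v\<close> stays
  positive and \<open>u\<close> increases from there on; and an earlier negative value of
  \<open>u\<close> would by persistence still be negative at that point.\<close>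

lemma decaying_solution_between:
  fixes u v :: "real \<Rightarrow> real \<Rightarrow> real"
  assumes flow: "\<And>d. radial_system n w h (u d) (v d)" "\<And>d. u d 0 = d"
    and cont: "\<And>r. 0 \<le> r \<Longrightarrow> continuous_on UNIV (\<lambda>d. u d r)" "\<And>r. 0 \<le> r \<Longrightarrow> continuous_on UNIV (\<lambda>d. v d r)"
    and w: "continuous_on {0..} w" and h: "L-lipschitz_on UNIV h"
    and h0: "\<And>x. x \<le> 0 \<Longrightarrow> h x = 0" and h_nonneg: "\<And>x. 0 \<le> h x"
    and t: "0 < t" "\<And>r. t < r \<Longrightarrow> w r \<le> 0"
    and p: "0 < p" "0 < R" "u p R \<le> 0" and q: "0 < q" "t \<le> T" "0 < u q T" "0 < v q T"
  shows "\<exists>d\<in>open_segment p q. (\<forall>r\<ge>0. 0 < u d r) \<and> (\<forall>r\<ge>t. v d r \<le> 0)"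
proof -
  have pers: "u d r < 0" if "0 < d" "0 < s" "u d s \<le> 0" "s < r" for d s r
    using radial_system_persistence[OF flow(1) w h h0, of d s r] flow(2) that by auto
  \<comment> \<open>Strict inequalities make both sets open. Nothing is lost in \<open>A\<close>,
    since a solution that reaches 0 is negative right afterwards. In \<open>B\<close> the condition
    \<open>0 < u\<close> is added so that the point cannot lie behind a zero.\<close>
  define A where "A = (\<Union>r\<in>{0..}. {d. u d r < 0})"
  define B where "B = (\<Union>r\<in>{t..}. {d. 0 < u d r} \<inter> {d. 0 < v d r})"
  have "open A" "open B" unfolding A_def B_def using t cont
    by (intro open_UN ballI open_Int open_Collect_less; force)+
  have pA: "p \<in> A" using pers[of p R "R + 1"] p by (auto simp: A_def intro!: bexI[of _ "R + 1"])
  have qB: "q \<in> B" using q by (auto simp: B_def)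
  have pos: "0 < d" if "d \<in> closed_segment p q" for d
    using that p q by (auto simp: closed_segment_eq_real_ivl split: if_splits)
  have AB: "A \<inter> B \<inter> closed_segment p q = {}"
  proof (rule ccontr)
    assume "A \<inter> B \<inter> closed_segment p q \<noteq> {}"
    then obtain d r1 r2 where d: "0 < d" and r1: "0 \<le> r1" "u d r1 < 0"
      and r2: "t \<le> r2" "0 < u d r2" "0 < v d r2"
      using pos by (auto simp: A_def B_def)
    interpret radial_solution n w h "u d" "v d" using flow h_nonneg by unfold_locales auto
    have "0 < r1" using r1 flow(2)[of d] d by (cases "r1 = 0") auto
    have "r2 \<le> r1" using pers[OF d \<open>0 < r1\<close> less_imp_le[OF r1(2)], of r2] r2 by force
    have "u d r2 \<le> u d r1"
    proof (rule u_mono)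
      fix r assume "r2 < r" "r < r1"
      then have "v d r2 \<le> v d r" using r2 t by (intro v_mono) auto
      then show "0 \<le> v d r" using r2 by simp
    qed (use \<open>r2 \<le> r1\<close> r2 t in auto)
    then show False using r1 r2 by simp
  qed
  have "\<not> closed_segment p q \<subseteq> A \<union> B"
    using connectedD[OF connected_segment(1)[of p q] \<open>open A\<close> \<open>open B\<close>] AB pA qB by auto
  then obtain d where d: "d \<in> closed_segment p q" "d \<notin> A" "d \<notin> B" by blast
  then have seg: "d \<in> open_segment p q" using pA qB by (auto simp: open_segment_def)
  have u0: "0 < u d r" if r: "0 \<le> r" for r
  proof (rule ccontr)
    assume n: "\<not> 0 < u d r"
    then have "0 < r" using r flow(2)[of d] pos[OF d(1)] by (cases "r = 0") auto
    then have "u d (r + 1) < 0" using pers[OF pos[OF d(1)], of r "r + 1"] n by auto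
    then show False using d(2) r by (auto simp: A_def)
  qed
  moreover have "v d r \<le> 0" if "t \<le> r" for r
    using d(3) u0[of r] that t by (force simp: B_def)
  ultimately show ?thesis using seg by blast
qed

section \<open>Decay at infinity\<close>

context radial_solution
begin

text \<open>Were \<open>u\<close> bounded below by a positive number, \<open>h u\<close> would be
  too, and the divergent weight integral would drive \<open>v\<close> above 0. For the derivative,
  \<open>v\<close> is negative and increasing, so over \<open>{r - 1..r}\<close> the function
  \<open>u\<close> drops by at least \<open>- v r / r ^ n\<close>, and this drop is less than
  \<open>u (r - 1)\<close>.\<close>

lemma decay:
  assumes pos: "\<And>r. 0 \<le> r \<Longrightarrow> 0 < u r" and t: "0 < t" and v: "\<And>r. t \<le> r \<Longrightarrow> v r \<le> 0"
    and q: "\<And>r. t < r \<Longrightarrow> q r = \<mu> * a r" "0 < \<mu>" "\<And>r. t < r \<Longrightarrow> a r < 0"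
    and a: "continuous_on {0..} a"
    and div: "filterlim (\<lambda>r. integral {t..r} (\<lambda>s. a s * s ^ n)) at_bot at_top"
    and h: "continuous_on UNIV h" "\<And>x. 0 < x \<Longrightarrow> 0 < h x"
  shows "(u \<longlongrightarrow> 0) at_top" "((\<lambda>r. v r / r ^ n) \<longlongrightarrow> 0) at_top"
proof -
  have anti: "u y \<le> u x" if "t \<le> x" "x \<le> y" for x y
    using that t v by (intro u_antimono) auto
  have ev: "\<forall>\<^sub>F r in at_top. u r < \<epsilon>" if "\<epsilon> > 0" for \<epsilon>
  proof -
    have "\<exists>z\<ge>t. u z < \<epsilon>"
    proof (rule ccontr)
      assume "\<not> (\<exists>z\<ge>t. u z < \<epsilon>)"
      then have ge: "\<epsilon> \<le> u z" if "t \<le> z" for z using that by force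
      obtain x0 where x0: "x0 \<in> {\<epsilon>..u t}" "\<And>x. x \<in> {\<epsilon>..u t} \<Longrightarrow> h x0 \<le> h x"
        using continuous_attains_inf[of "{\<epsilon>..u t}" h] ge[of t] continuous_on_subset[OF h(1)] by auto
      have c: "0 < h x0" using x0(1) that by (intro h) auto
      define F where "F r = integral {t..r} (\<lambda>s. a s * s ^ n)" for r
      have low: "\<mu> * h x0 * (- F R) \<le> v R - v t" if R: "t \<le> R" for R
      proof -
        have ca: "continuous_on {t..R} (\<lambda>s. a s * s ^ n)"
          by (intro continuous_intros continuous_on_subset[OF a]) (use t in auto)
        have dF: "(F has_real_derivative a r * r ^ n) (at r within {t..R})" if "r \<in> {t..R}" for r
          unfolding F_def using integral_has_real_derivative[OF ca that] .
        have "0 * (R - t) \<le> (v R + \<mu> * h x0 * F R) - (v t + \<mu> * h x0 * F t)"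
        proof (rule deriv_lower_bound_imp)
          show "continuous_on {t..R} (\<lambda>r. v r + \<mu> * h x0 * F r)"
            by (intro continuous_intros continuous_on_subset[OF sysD(2)] DERIV_continuous_on[OF dF])
               (use t in auto)
          fix r assume r: "t < r" "r < R"
          have "(F has_real_derivative a r * r ^ n) (at r)"
            using dF[of r] r at_within_interior[of r "{t..R}"] by simp
          then show "((\<lambda>r. v r + \<mu> * h x0 * F r) has_real_derivative
              - (q r * r ^ n * h (u r)) + \<mu> * h x0 * (a r * r ^ n)) (at r)"
            using sysD(5)[of r] r t by (intro DERIV_add DERIV_cmult) auto
          have "h x0 \<le> h (u r)" using x0(2)[of "u r"] ge[of r] anti[of t r] r by simp
          then have "(\<mu> * - a r * r ^ n) * h x0 \<le> (\<mu> * - a r * r ^ n) * h (u r)"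
            using r q(2) q(3)[of r] t by (intro mult_left_mono mult_nonneg_nonneg) auto
          then show "0 \<le> - (q r * r ^ n * h (u r)) + \<mu> * h x0 * (a r * r ^ n)"
            using q(1)[of r] r by (simp add: mult_ac)
        qed fact
        then show ?thesis by (simp add: F_def)
      qed
      \<comment> \<open>Chosen so that the lower bound \<open>low\<close> gives
        \<open>v R \<ge> 1\<close>, against \<open>v R \<le> 0\<close>.\<close>
      define K where "K = (1 - v t) / (\<mu> * h x0)"
      have "\<forall>\<^sub>F R in at_top. F R \<le> - K"
        using div unfolding F_def filterlim_at_bot by blast
      then have "\<forall>\<^sub>F R in at_top. F R \<le> - K \<and> t \<le> R"
        using eventually_ge_at_top[of t] by (rule eventually_conj)
      then obtain R where R: "F R \<le> - K" "t \<le> R"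
        by (metis (mono_tags, lifting) eventually_happens trivial_limit_at_top_linorder)
      have "\<mu> * h x0 * K \<le> \<mu> * h x0 * (- F R)" using R q(2) c by (intro mult_left_mono) auto
      moreover have "\<mu> * h x0 * K = 1 - v t" using q(2) c by (simp add: K_def)
      ultimately show False using low[OF R(2)] v[OF R(2)] by linarith
    qed
    then obtain z where z: "t \<le> z" "u z < \<epsilon>" by blast
    show ?thesis using eventually_ge_at_top[of z]
      by eventually_elim (use anti z in force)
  qed
  show lim: "(u \<longlongrightarrow> 0) at_top"
  proof (rule order_tendstoI)
    fix y :: real assume "y < 0"
    show "\<forall>\<^sub>F r in at_top. y < u r" using eventually_ge_at_top[of 0]
      by eventually_elim (use pos \<open>y < 0\<close> in force)
  qed (use ev in auto)
  have "((\<lambda>r. u (-1 + r)) \<longlongrightarrow> 0) at_top"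
    by (rule filterlim_compose[OF lim filterlim_tendsto_add_at_top[OF tendsto_const filterlim_ident]])
  moreover have "\<forall>\<^sub>F r in at_top. norm (v r / r ^ n) \<le> u (-1 + r)"
    using eventually_ge_at_top[of "t + 1"]
  proof eventually_elim
    case (elim r)
    have "u r - u (r - 1) \<le> - (- v r / r ^ n * (r - (r - 1)))"
    proof (rule u_diff_le_neg)
      fix y assume y: "r - 1 < y" "y < r"
      have "v y \<le> v r"
      proof (rule v_mono)
        fix x assume "y < x"
        then have "t < x" using y elim by simp
        then show "q x \<le> 0" using q(1)[of x] q(2) q(3)[of x] by (simp add: mult_pos_neg less_imp_le)
      qed (use y elim t in auto)
      then show "v y \<le> - (- v r)" by simp
    qed (use elim t v[of r] in auto)
    then have "- (v r / r ^ n) \<le> u (-1 + r)" using pos[of r] elim t by (simp add: algebra_simps)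
    moreover have "v r / r ^ n \<le> 0" using v[of r] elim t by (intro divide_nonpos_pos) auto
    ultimately show ?case by simp
  qed
  ultimately show "((\<lambda>r. v r / r ^ n) \<longlongrightarrow> 0) at_top" by (rule Lim_null_comparison[rotated])
qed

end

section \<open>Radial functions of class C2\<close>

text \<open>With \<open>w = u' / r\<close> the gradient of \<open>U\<close> is \<open>w\<close>
  times \<open>x\<close>, and the Hessian is \<open>w\<close> times the identity plus
  \<open>w' / r\<close> times the rank-one form of \<open>x\<close>. The trace is
  \<open>N * w + r * w'\<close>, which equals \<open>- f\<close> by the equation. Since
  \<open>r * w' = - (f + N * w)\<close> tends to 0 at the origin, the rank-one part vanishes there
  and the Hessian is continuous.\<close>

lemma radial_function_classical:
  fixes u v :: "real \<Rightarrow> real"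
  assumes sys: "radial_system (DIM('a::euclidean_space) - 1) q h u v"
    and q: "continuous_on {0..} q" and h: "continuous_on {0..} (\<lambda>r. h (u r))"
  shows "(u has_real_derivative 0) (at 0 within {0..})"
    and "C2 (\<lambda>x::'a. u (norm x))"
    and "laplacian (\<lambda>x::'a. u (norm x)) x + q (norm x) * h (u (norm x)) = 0"
proof -
  define N where "N = DIM('a)"
  define n where "n = N - 1"
  have n: "N = Suc n" using DIM_positive[where 'a='a] by (simp add: n_def N_def)
  have sys': "radial_system n q h u v" using sys by (simp add: n_def N_def)
  note D = radial_systemD[OF sys']
  define f where "f r = q r * h (u r)" for r
  have cf: "continuous_on {0..} f" unfolding f_def
    by (intro continuous_intros q h)
  (* w = u' / r, extended continuously to 0 *)
  define w where "w r = (if r = 0 then - f 0 / real N else v r / r ^ N)" for r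
  have dv: "(v has_real_derivative - (r ^ n * f r)) (at r)" if "0 < r" for r
    using D(5)[OF that] by (simp add: f_def mult_ac)
  have du: "(u has_real_derivative r * w r) (at r)" if "0 < r" for r
    using D(4)[OF that] that by (simp add: w_def n)
  have at0: "at (0::real) within {0..} = at_right 0"
    by (simp add: at_within_def set_eq_iff) (rule arg_cong[where f="\<lambda>s. inf (nhds 0) (principal s)"], auto)
  have f0: "(f \<longlongrightarrow> f 0) (at_right 0)" and v0: "(v \<longlongrightarrow> 0) (at_right 0)" and u0: "(u \<longlongrightarrow> u 0) (at_right 0)"
    using cf D(1,2,3) unfolding continuous_on_def at0[symmetric] by force+
  have dpow: "((\<lambda>r. r ^ N) has_real_derivative real N * r ^ n) (at r)" for r :: real
    using DERIV_pow[of N r] by (simp add: n)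
  \<comment> \<open>By l'Hospital the quotient \<open>v r / r ^ N\<close> has the limit of
    \<open>- f r / N\<close>.\<close>
  have w0: "(w \<longlongrightarrow> w 0) (at_right 0)"
  proof -
    have pos: "\<forall>\<^sub>F r::real in at_right 0. 0 < r" by (simp add: eventually_at_right_less)
    have "((\<lambda>r. v r / r ^ N) \<longlongrightarrow> - f 0 / real N) (at_right 0)"
    proof (rule lhopital_right_0)
      show "((\<lambda>r::real. r ^ N) \<longlongrightarrow> 0) (at_right 0)" by (intro tendsto_eq_intros) (auto simp: n)
      show "\<forall>\<^sub>F r::real in at_right 0. r ^ N \<noteq> 0" using pos by eventually_elim simp
      show "\<forall>\<^sub>F r::real in at_right 0. real N * r ^ n \<noteq> 0" using pos by eventually_elim (simp add: n)
      show "\<forall>\<^sub>F r in at_right 0. (v has_real_derivative - (r ^ n * f r)) (at r)"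
        using pos by eventually_elim (rule dv)
      show "\<forall>\<^sub>F r in at_right 0. ((\<lambda>r. r ^ N) has_real_derivative real N * r ^ n) (at r)"
        by (intro always_eventually allI dpow)
      have "((\<lambda>r. - f r / real N) \<longlongrightarrow> - f 0 / real N) (at_right 0)"
        by (intro tendsto_intros f0) (simp add: n)
      moreover have "\<forall>\<^sub>F r in at_right 0. - f r / real N = - (r ^ n * f r) / (real N * r ^ n)"
        using pos by eventually_elim simp
      ultimately show "((\<lambda>r. - (r ^ n * f r) / (real N * r ^ n)) \<longlongrightarrow> - f 0 / real N) (at_right 0)"
        by (rule Lim_transform_eventually)
    qed (rule v0)
    moreover have "\<forall>\<^sub>F r in at_right 0. v r / r ^ N = w r"
      using pos by eventually_elim (simp add: w_def)
    ultimately have "(w \<longlongrightarrow> - f 0 / real N) (at_right 0)" by (rule Lim_transform_eventually)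
    then show ?thesis by (simp add: w_def)
  qed
  \<comment> \<open>Obtained by differentiating \<open>r ^ N * w r = v r\<close> and inserting the
    equation for \<open>v\<close>.\<close>
  define w' where "w' r = - (f r + real N * w r) / r" for r
  have dw: "(w has_real_derivative w' r) (at r)" if r: "0 < r" for r
  proof -
    have "((\<lambda>r. v r / r ^ N) has_real_derivative
        (- (r ^ n * f r) * r ^ N - v r * (real N * r ^ n)) / (r ^ N * r ^ N)) (at r)"
      using r by (intro DERIV_divide dv dpow) auto
    moreover have "(- (r ^ n * f r) * r ^ N - v r * (real N * r ^ n)) / (r ^ N * r ^ N) = w' r"
      using r by (simp add: w'_def w_def n field_simps)
    ultimately have "((\<lambda>r. v r / r ^ N) has_real_derivative w' r) (at r)" by simp
    then show ?thesis
      by (rule has_field_derivative_transform_within_open[of _ _ _ "{0<..}"])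
         (use r in \<open>auto simp: w_def\<close>)
  qed
  have dq0: "((\<lambda>r. (u r - u 0) / r) \<longlongrightarrow> 0) (at_right 0)"
  proof (rule lhopital_right_0)
    have pos: "\<forall>\<^sub>F r::real in at_right 0. 0 < r" by (simp add: eventually_at_right_less)
    show "((\<lambda>r. u r - u 0) \<longlongrightarrow> 0) (at_right 0)" using tendsto_diff[OF u0 tendsto_const, of "u 0"] by simp
    show "\<forall>\<^sub>F r::real in at_right 0. r \<noteq> 0" using pos by eventually_elim simp
    show "\<forall>\<^sub>F r in at_right 0. ((\<lambda>r. u r - u 0) has_real_derivative r * w r) (at r)"
      using pos by eventually_elim (auto intro!: derivative_eq_intros du)
    show "((\<lambda>r. r * w r / 1) \<longlongrightarrow> 0) (at_right 0)"
      using tendsto_mult[OF tendsto_ident_at w0] by simp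
  qed (auto intro!: tendsto_ident_at)
  then show "(u has_real_derivative 0) (at 0 within {0..})"
    unfolding has_field_derivative_iff at0 by simp

  have norm0: "filterlim (norm :: 'a \<Rightarrow> real) (at_right 0) (at 0)"
    unfolding filterlim_at by (auto intro!: tendsto_norm_zero tendsto_ident_at simp: eventually_at_filter)
  have wn: "((\<lambda>x::'a. w (norm x)) \<longlongrightarrow> w 0) (at 0)" by (rule filterlim_compose[OF w0 norm0])
  have fn: "((\<lambda>x::'a. f (norm x)) \<longlongrightarrow> f 0) (at 0)" by (rule filterlim_compose[OF f0 norm0])
  define U where "U x = u (norm x)" for x :: 'a
  \<comment> \<open>\<open>J\<close> is the Riesz map of the inner product and \<open>P x\<close>
    below is the bilinear form with value \<open>(x \<bullet> k) * (x \<bullet> l)\<close>.\<close>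
  define J where "J = Blinfun (blinfun_inner_right :: 'a \<Rightarrow> 'a \<Rightarrow>\<^sub>L real)"
  have J: "blinfun_apply (blinfun_apply J k) l = k \<bullet> l" for k l
    unfolding J_def by (subst bounded_linear_Blinfun_apply[OF bounded_linear_blinfun_inner_right]) simp
  define D1 where "D1 x = w (norm x) *\<^sub>R J x" for x :: 'a
  define P where "P x = blinfun_scaleR_left (J x) o\<^sub>L J x" for x :: 'a
  have P: "P x k = (x \<bullet> k) *\<^sub>R J x" for x k
    by (simp add: P_def J)
  \<comment> \<open>This is \<open>w' r / r\<close>. Division by zero makes it 0 at the origin, so
    that \<open>D2 0\<close> reduces to the multiple \<open>w 0\<close> of \<open>J\<close>.\<close>
  define g2 where "g2 r = - (f r + real N * w r) / r\<^sup>2" for r :: real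
  define D2 where "D2 x = w (norm x) *\<^sub>R J + g2 (norm x) *\<^sub>R P x" for x :: 'a
  have dn: "(norm has_derivative (\<lambda>k. sgn x \<bullet> k)) (at x)" if "x \<noteq> 0" for x :: 'a
    using has_derivative_norm[OF that] by (simp add: inner_commute)
  have dU: "(U has_derivative blinfun_apply (D1 x)) (at x)" for x
  proof (cases "x = 0")
    case False
    have "(u has_derivative (*) (norm x * w (norm x))) (at (norm x))"
      using du[of "norm x"] False by (simp add: has_field_derivative_def)
    then have "(U has_derivative (\<lambda>k. norm x * w (norm x) * (sgn x \<bullet> k))) (at x)"
      unfolding U_def using dn[OF False] has_derivative_compose by fastforce
    moreover have "(\<lambda>k. norm x * w (norm x) * (sgn x \<bullet> k)) = blinfun_apply (D1 x)"
      using False by (simp add: fun_eq_iff D1_def scaleR_blinfun.rep_eq J sgn_div_norm)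
    ultimately show ?thesis by simp
  next
    case True
    have "((\<lambda>k::'a. (u (norm k) - u 0) / norm k) \<longlongrightarrow> 0) (at 0)"
      by (rule filterlim_compose[OF dq0 norm0])
    then have "((\<lambda>k::'a. norm ((u (norm k) - u 0) / norm k)) \<longlongrightarrow> 0) (at 0)"
      by (rule tendsto_norm_zero)
    then have "(U has_derivative (\<lambda>_. 0)) (at 0)"
      unfolding has_derivative_at by (simp add: U_def)
    moreover have "blinfun_apply (D1 x) = (\<lambda>_. 0)"
      using True by (simp add: fun_eq_iff D1_def scaleR_blinfun.rep_eq J)
    ultimately show ?thesis using True by simp
  qed
  have dD1: "(D1 has_derivative blinfun_apply (D2 x)) (at x)" for x
  proof (cases "x = 0")
    case False
    have "(w has_derivative (*) (w' (norm x))) (at (norm x))"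
      using dw[of "norm x"] False by (simp add: has_field_derivative_def)
    then have "((\<lambda>x. w (norm x)) has_derivative (\<lambda>k. w' (norm x) * (sgn x \<bullet> k))) (at x)"
      using dn[OF False] has_derivative_compose by fastforce
    from has_derivative_scaleR[OF this bounded_linear_imp_has_derivative[OF blinfun.bounded_linear_right, of J]]
    have "(D1 has_derivative (\<lambda>k. w (norm x) *\<^sub>R J k + (w' (norm x) * (sgn x \<bullet> k)) *\<^sub>R J x)) (at x)"
      by (simp add: D1_def [abs_def])
    moreover have "(\<lambda>k. w (norm x) *\<^sub>R J k + (w' (norm x) * (sgn x \<bullet> k)) *\<^sub>R J x) = blinfun_apply (D2 x)"
      using False by (simp add: fun_eq_iff D2_def plus_blinfun.rep_eq scaleR_blinfun.rep_eq P g2_def w'_def sgn_div_norm power2_eq_square divide_inverse mult_ac)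
    ultimately show ?thesis by simp
  next
    case True
    have "((\<lambda>k::'a. norm (w (norm k) - w 0) * norm J) \<longlongrightarrow> 0) (at 0)"
      using tendsto_mult[OF tendsto_norm_zero[OF tendsto_diff[OF wn tendsto_const[of "w 0"], simplified]] tendsto_const[of "norm J"]]
      by simp
    moreover have "norm (norm (D1 (0 + k) - D1 0 - D2 0 k) / norm k) \<le> norm (w (norm k) - w 0) * norm J" for k
    proof (cases "k = 0")
      case False
      have "D1 (0 + k) - D1 0 - D2 0 k = (w (norm k) - w 0) *\<^sub>R J k"
        by (simp add: D1_def D2_def g2_def scaleR_blinfun.rep_eq scaleR_diff_left)
      then have "norm (D1 (0 + k) - D1 0 - D2 0 k) \<le> norm (w (norm k) - w 0) * (norm J * norm k)"
        using norm_blinfun[of J k] by (simp add: mult_left_mono)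
      then show ?thesis using False by (simp add: field_simps)
    qed simp
    ultimately have "((\<lambda>k. norm (D1 (0 + k) - D1 0 - D2 0 k) / norm k) \<longlongrightarrow> 0) (at 0)"
      by (rule Lim_null_comparison[OF always_eventually[OF allI], rotated])
    then have "(D1 has_derivative blinfun_apply (D2 0)) (at 0)"
      unfolding has_derivative_at using blinfun.bounded_linear_right by blast
    then show ?thesis using True by simp
  qed
  have cD2: "continuous_on UNIV D2"
    unfolding continuous_on_eq_continuous_within
  proof
    fix x :: 'a
    show "isCont D2 x"
    proof (cases "x = 0")
      case False
      then have nx: "0 < norm x" by simp
      have cw: "isCont (\<lambda>x. w (norm x)) x"
        using isCont_o2[of x norm w] DERIV_isCont[OF dw[OF nx]] by simp
      have "isCont f (norm x)"
        using cf nx by (simp add: continuous_on_interior)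
      then have cfn: "isCont (\<lambda>x. f (norm x)) x"
        using isCont_o2[of x norm f] by simp
      have cJ: "isCont (\<lambda>x. blinfun_apply J x) x" by (intro continuous_intros)
      have cP: "isCont P x" unfolding P_def [abs_def]
        using cJ by (intro continuous_intros bounded_linear.continuous[OF bounded_linear_blinfun_scaleR_left])
      show ?thesis unfolding D2_def [abs_def] g2_def
        using cw cfn cP False by (intro continuous_intros) auto
    next
      case True
      have "((\<lambda>k::'a. norm (w (norm k) - w 0) * norm J + norm (f (norm k) + real N * w (norm k)) * norm J) \<longlongrightarrow> 0) (at 0)"
      proof -
        have "((\<lambda>k::'a. norm (w (norm k) - w 0) * norm J + norm (f (norm k) + real N * w (norm k)) * norm J)
            \<longlongrightarrow> norm (w 0 - w 0) * norm J + norm (f 0 + real N * w 0) * norm J) (at 0)"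
          by (intro tendsto_intros wn fn)
        \<comment> \<open>This cancellation, due to the value given to \<open>w 0\<close>, makes the
          rank-one part of the Hessian tend to 0.\<close>
        moreover have "f 0 + real N * w 0 = 0" by (simp add: w_def n)
        ultimately show ?thesis by simp
      qed
      moreover have "norm (D2 k - D2 0) \<le> norm (w (norm k) - w 0) * norm J + norm (f (norm k) + real N * w (norm k)) * norm J" for k
      proof -
        have "norm (P k) \<le> norm J * (norm k)\<^sup>2"
        proof (rule norm_blinfun_bound)
          fix l
          have "norm (P k l) = \<bar>k \<bullet> l\<bar> * norm (J k)" by (simp add: P)
          also have "\<dots> \<le> (norm k * norm l) * (norm J * norm k)"
            using norm_blinfun[of J k] Cauchy_Schwarz_ineq2[of k l] by (intro mult_mono) auto
          finally show "norm (P k l) \<le> norm J * (norm k)\<^sup>2 * norm l" by (simp add: power2_eq_square mult_ac)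
        qed simp
        then have "norm (g2 (norm k) *\<^sub>R P k) \<le> \<bar>g2 (norm k)\<bar> * (norm J * (norm k)\<^sup>2)"
          by (simp add: mult_left_mono)
        also have "\<dots> \<le> norm (f (norm k) + real N * w (norm k)) * norm J"
          using abs_minus_cancel[of "f (norm k) + real N * w (norm k)"]
          by (cases "k = 0") (simp_all add: g2_def del: abs_minus_cancel)
        finally have "norm (g2 (norm k) *\<^sub>R P k) \<le> norm (f (norm k) + real N * w (norm k)) * norm J" .
        moreover have "D2 k - D2 0 = (w (norm k) - w 0) *\<^sub>R J + g2 (norm k) *\<^sub>R P k"
          by (simp add: D2_def g2_def scaleR_diff_left)
        ultimately show ?thesis
          using norm_triangle_ineq[of "(w (norm k) - w 0) *\<^sub>R J" "g2 (norm k) *\<^sub>R P k"] by simp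
      qed
      ultimately have "((\<lambda>k. D2 k - D2 0) \<longlongrightarrow> 0) (at 0)"
        by (rule Lim_null_comparison[OF always_eventually[OF allI], rotated])
      then show ?thesis using True by (simp add: isCont_def LIM_zero_iff)
    qed
  qed
  show "C2 (\<lambda>x::'a. u (norm x))"
    unfolding C2_def U_def [symmetric, abs_def] using dU dD1 cD2 by blast
  have lap: "deriv (deriv (\<lambda>t. U (x + t *\<^sub>R b))) 0 = D2 x b b" for x b
  proof -
    have line: "((\<lambda>t. x + t *\<^sub>R b) has_derivative (\<lambda>t. t *\<^sub>R b)) (at t)" for t :: real
      by (auto intro!: derivative_eq_intros)
    have "((\<lambda>t. U (x + t *\<^sub>R b)) has_real_derivative D1 (x + t *\<^sub>R b) b) (at t)" for t
      using has_derivative_compose[OF line dU, of t]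
      by (simp add: has_field_derivative_def blinfun.scaleR_right mult.commute[of _ "blinfun_apply _ _"])
    then have d1: "deriv (\<lambda>t. U (x + t *\<^sub>R b)) = (\<lambda>t. D1 (x + t *\<^sub>R b) b)"
      by (intro ext DERIV_imp_deriv)
    have "((\<lambda>t. D1 (x + t *\<^sub>R b)) has_derivative (\<lambda>t. D2 x (t *\<^sub>R b))) (at 0)"
      using has_derivative_compose[OF line[of 0], of D1 "blinfun_apply (D2 x)"] dD1[of x] by simp
    then have "((\<lambda>t. D1 (x + t *\<^sub>R b) b) has_derivative (\<lambda>t. D2 x (t *\<^sub>R b) b)) (at 0)"
      by (rule bounded_linear.has_derivative[OF blinfun.bounded_linear_left])
    then have "((\<lambda>t. D1 (x + t *\<^sub>R b) b) has_real_derivative D2 x b b) (at 0)"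
      by (simp add: has_field_derivative_def blinfun.scaleR_right scaleR_blinfun.rep_eq mult.commute[of _ "blinfun_apply _ _"])
    then show ?thesis unfolding d1 by (rule DERIV_imp_deriv)
  qed
  have "laplacian U x = (\<Sum>b\<in>Basis. w (norm x) * (b \<bullet> b) + g2 (norm x) * ((x \<bullet> b) * (x \<bullet> b)))"
    unfolding laplacian_def lap
    by (intro sum.cong) (auto simp: D2_def plus_blinfun.rep_eq scaleR_blinfun.rep_eq P J)
  also have "\<dots> = w (norm x) * real N + g2 (norm x) * (norm x)\<^sup>2"
    by (simp add: sum.distrib N_def inner_Basis flip: sum_distrib_left euclidean_inner power2_norm_eq_inner)
  also have "\<dots> = - f (norm x)"
    by (cases "x = 0") (simp_all add: g2_def w_def n)
  finally show "laplacian (\<lambda>x::'a. u (norm x)) x + q (norm x) * h (u (norm x)) = 0"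
    by (simp add: U_def [abs_def] f_def)
qed

section \<open>Estimates uniform in the parameter\<close>

lemma weight_simps:
  "0 \<le> a r \<Longrightarrow> weight a \<mu> r = a r" "a r \<le> 0 \<Longrightarrow> weight a \<mu> r = \<mu> * a r"
  by (auto simp: weight_def max_def)

lemma continuous_on_weight: "continuous_on S a \<Longrightarrow> continuous_on S (weight a \<mu>)"
  unfolding weight_def [abs_def] by (intro continuous_intros)

lemma finite_strict_upper_bound:
  fixes f :: "'i \<Rightarrow> real"
  assumes "finite A"
  shows "\<exists>B>0. \<forall>i\<in>A. f i < B"
proof (intro exI[of _ "1 + (\<Sum>i\<in>A. \<bar>f i\<bar>)"] conjI ballI)
  show "0 < 1 + (\<Sum>i\<in>A. \<bar>f i\<bar>)" by (simp add: add_pos_nonneg sum_nonneg)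
  fix i assume "i \<in> A"
  then have "\<bar>f i\<bar> \<le> (\<Sum>i\<in>A. \<bar>f i\<bar>)" using assms by (intro member_le_sum) auto
  then show "f i < 1 + (\<Sum>i\<in>A. \<bar>f i\<bar>)" by linarith
qed

lemma interior_interval_pos:
  fixes f :: "real \<Rightarrow> real"
  assumes f: "continuous_on {x..y} f" and xy: "x < y"
    and nn: "\<And>r. r \<in> {x..y} \<Longrightarrow> 0 \<le> f r" and nz: "\<exists>r\<in>{x..y}. f r \<noteq> 0"
  shows "\<exists>r1 r2 c. x < r1 \<and> r1 < r2 \<and> r2 < y \<and> 0 < c \<and> (\<forall>r\<in>{r1..r2}. c \<le> f r)"
proof -
  obtain r where r: "r \<in> {x..y}" "0 < f r" using nn nz by force
  then obtain d where d: "0 < d" "\<And>z. z \<in> {x..y} \<Longrightarrow> dist z r < d \<Longrightarrow> dist (f z) (f r) < f r / 2"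
    using f unfolding continuous_on_iff by (metis half_gt_zero)
  \<comment> \<open>The neighbourhood of \<open>r\<close> is clipped to \<open>{x..y}\<close> and
    its middle third is taken, so that the result is strictly interior even if \<open>r\<close> is
    an end point.\<close>
  define lo where "lo = max x (r - d)"
  define hi where "hi = min y (r + d)"
  have lohi: "lo < hi" "x \<le> lo" "hi \<le> y" "r - d \<le> lo" "hi \<le> r + d"
    using r d xy by (auto simp: lo_def hi_def)
  define k where "k = (hi - lo) / 3"
  have "0 < k" using lohi unfolding k_def by simp
  have "hi = lo + 3 * k" by (simp add: k_def diff_divide_distrib)
  note k = \<open>0 < k\<close> this
  have "f r / 2 \<le> f z" if "z \<in> {lo + k..lo + 2 * k}" for z
  proof -
    have "dist z r < d" "z \<in> {x..y}" using that lohi k by (auto simp: dist_real_def)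
    then have "\<bar>f z - f r\<bar> < f r / 2" using d(2)[of z] by (simp add: dist_real_def)
    then show ?thesis using abs_ge_minus_self[of "f z - f r"] by linarith
  qed
  then show ?thesis using k lohi r
    by (intro exI[of _ "lo + k"] exI[of _ "lo + 2 * k"] exI[of _ "f r / 2"]) auto
qed

text \<open>The order of quantifiers is the point: \<open>D\<close> and \<open>l\<close> depend only
  on \<open>a\<close>, the interval and \<open>n\<close>. The nonlinearity may therefore be
  truncated afterwards, at a level above \<open>D * U\<close>, without circularity.\<close>

lemma apriori_uniform:
  fixes a :: "real \<Rightarrow> real"
  assumes a: "continuous_on {s..t} a" and st: "0 < s" "s < t"
    and nn: "\<And>r. r \<in> {s..t} \<Longrightarrow> 0 \<le> a r" and nz: "\<exists>r\<in>{s..t}. a r \<noteq> 0"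
  shows "\<exists>D l. \<forall>U q h u v. radial_solution n q h u v \<longrightarrow> 0 \<le> U \<longrightarrow> (\<forall>x\<ge>U. l * x \<le> h x) \<longrightarrow>
    (\<forall>r\<in>{s..t}. q r = a r \<and> 0 < u r) \<longrightarrow> (\<forall>r\<in>{s..t}. u r \<le> D * U)"
proof -
  obtain r1 r2 c where r: "s < r1" "r1 < r2" "r2 < t" and c: "0 < c" "\<And>r. r \<in> {r1..r2} \<Longrightarrow> c \<le> a r"
    using interior_interval_pos[OF a st(2) nn nz] by blast
  define D where "D = 1 + (t / s) ^ n * (t - s) * (1 / (r1 - s) + 1 / (t - r2))"
  define X where "X = D * t ^ n * (1 / (r1 - s) + 1 / (t - r2))"
  define Y where "Y = c * s ^ n * (r2 - r1)"
  have D0: "D > 0" using r st unfolding D_def by (intro add_pos_nonneg mult_nonneg_nonneg) auto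
  have Y: "0 < Y" using r st c by (simp add: Y_def)
  have X: "0 \<le> X" using D0 r st by (simp add: X_def)
  \<comment> \<open>Any number above \<open>X / Y\<close> makes the strict inequality of
    \<open>apriori_bound\<close> true.\<close>
  define l where "l = X / Y + 1"
  have l: "X < l * Y" "0 \<le> l" using Y X by (auto simp: l_def field_simps)
  have "u z \<le> D * U"
    if sol: "radial_solution n q h u v" and h: "\<And>x. U \<le> x \<Longrightarrow> l * x \<le> h x"
      and qu: "\<And>r. r \<in> {s..t} \<Longrightarrow> q r = a r \<and> 0 < u r" and z: "z \<in> {s..t}" for U q h u v z
    by (rule radial_solution.apriori_bound[OF sol st(1) r c(1) _ _ _ D_def l(1)[unfolded X_def Y_def] l(2) h])
       (use qu nn c(2) z r in auto)
  then show ?thesis by blast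
qed

text \<open>\<open>K\<close> is chosen before \<open>q\<close>, \<open>u\<close> and
  \<open>v\<close>, hence independently of the parameter \<open>\<mu>\<close> and of the initial
  value.\<close>

lemma end_slope_uniform:
  fixes a h :: "real \<Rightarrow> real"
  assumes a: "continuous_on {s..t} a" and st: "0 < s" "s < t"
    and nn: "\<And>r. r \<in> {s..t} \<Longrightarrow> 0 \<le> a r" and h: "continuous_on UNIV h"
  shows "\<exists>K. \<forall>q u v. radial_solution n q h u v \<longrightarrow>
    (\<forall>r\<in>{s..t}. q r = a r \<and> 0 < u r \<and> u r \<le> M) \<longrightarrow> - K \<le> v t"
proof -
  have "{s..t} \<noteq> {}" using st by simp
  then obtain x where x: "\<And>r. r \<in> {s..t} \<Longrightarrow> a r \<le> a x"
    using continuous_attains_sup[OF compact_Icc _ a] by blast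
  obtain H where H: "\<And>y. 0 \<le> y \<Longrightarrow> y \<le> M \<Longrightarrow> h y \<le> H"
  proof (cases "0 \<le> M")
    case True
    then have "{0..M} \<noteq> {}" by simp
    then obtain z where "\<And>y. y \<in> {0..M} \<Longrightarrow> h y \<le> h z"
      using continuous_attains_sup[OF compact_Icc _ continuous_on_subset[OF h subset_UNIV]] by blast
    then show ?thesis by (intro that[of "h z"]) auto
  qed (rule that[of 0], auto)
  have "- (M * t ^ n / (t - s) * 2 + a x * t ^ n * H * (t - s)) \<le> v t"
    if sol: "radial_solution n q h u v" and qu: "\<And>r. r \<in> {s..t} \<Longrightarrow> q r = a r \<and> 0 < u r \<and> u r \<le> M" for q u v
    by (rule radial_solution.end_slope_bound[OF sol st]) (use qu nn x H in auto)
  then show ?thesis by blast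
qed

text \<open>Here \<open>K\<close> is already fixed; the gain of \<open>v\<close> is proportional to
  \<open>\<mu>\<close>, so a threshold of the form \<open>K / Y\<close> suffices.\<close>

lemma v_nonneg_uniform:
  fixes a h :: "real \<Rightarrow> real"
  assumes a: "continuous_on {t..s} a" and st: "0 < t" "t < s"
    and np: "\<And>r. r \<in> {t..s} \<Longrightarrow> a r \<le> 0" and nz: "\<exists>r\<in>{t..s}. a r \<noteq> 0"
    and e: "0 < e" and hH: "\<And>x. 0 < x \<Longrightarrow> \<exists>H>0. \<forall>y\<ge>x. H \<le> h y"
  shows "\<exists>\<mu>0. \<forall>\<mu> q u v. \<mu>0 < \<mu> \<longrightarrow> 0 < \<mu> \<longrightarrow> radial_solution n q h u v \<longrightarrow>
    (\<forall>r\<in>{t..s}. q r = \<mu> * a r) \<longrightarrow> - K \<le> v t \<longrightarrow> u s = e \<longrightarrow> 0 \<le> v s"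
proof -
  obtain r1 r2 c where r: "t < r1" "r1 < r2" "r2 < s" and c: "0 < c" "\<And>r. r \<in> {r1..r2} \<Longrightarrow> c \<le> - a r"
    using interior_interval_pos[of t s "\<lambda>r. - a r"] a st np nz by (force intro: continuous_intros)
  obtain H where H: "0 < H" "\<And>y. e \<le> y \<Longrightarrow> H \<le> h y" using hH[OF e] by blast
  define Y where "Y = c * t ^ n * H * (r2 - r1)"
  have Y: "0 < Y" using c st H r by (simp add: Y_def)
  have "0 \<le> v s"
    if mu: "K / Y < \<mu>" "0 < \<mu>" and sol: "radial_solution n q h u v"
      and q: "\<And>r. r \<in> {t..s} \<Longrightarrow> q r = \<mu> * a r" and vt: "- K \<le> v t" and us: "u s = e" for \<mu> q u v
  proof (rule radial_solution.v_nonneg_at_level[OF sol st(1) r _ _ _ H(2) _ vt _ us])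
    fix x assume "t \<le> x" "x \<le> s"
    then show "q x \<le> 0" using q[of x] np[of x] mu(2) by (simp add: mult_nonneg_nonpos)
  next
    fix x assume x: "r1 \<le> x" "x \<le> r2"
    then have "\<mu> * c \<le> \<mu> * - a x" using c(2)[of x] mu(2) by (intro mult_left_mono) auto
    then show "q x \<le> - (\<mu> * c)" using q[of x] x r by simp
  next
    have "K \<le> \<mu> * Y" using mu(1) Y by (simp add: field_simps)
    then show "K \<le> \<mu> * c * t ^ n * H * (r2 - r1)" by (simp add: Y_def mult_ac)
  qed (use mu c H in auto)
  then show ?thesis by blast
qed

text \<open>The level \<open>e\<close> is governed by \<open>h\<close> near 0 and by
  \<open>a\<close> on \<open>{s..t}\<close>, where \<open>\<mu>\<close> does not act. It can thus be
  fixed first, and \<open>\<mu>0\<close> then compensates for its smallness.\<close>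

lemma small_then_large_uniform:
  fixes a h :: "real \<Rightarrow> real"
  assumes a: "continuous_on {s..s'} a" and st: "0 < s" "s < t" "t < s'"
    and nn: "\<And>r. r \<in> {s..t} \<Longrightarrow> 0 \<le> a r"
    and np: "\<And>r. r \<in> {t..s'} \<Longrightarrow> a r \<le> 0" and nz: "\<exists>r\<in>{t..s'}. a r \<noteq> 0"
    and hH: "\<And>x. 0 < x \<Longrightarrow> \<exists>H>0. \<forall>y\<ge>x. H \<le> h y" and h0: "\<And>x. x \<le> 0 \<Longrightarrow> h x = 0"
    and hs: "\<And>\<delta>. 0 < \<delta> \<Longrightarrow> \<exists>x0>0. \<forall>x. 0 < x \<longrightarrow> x \<le> x0 \<longrightarrow> h x \<le> \<delta> * x"
    and M: "0 < M"
  shows "\<exists>e \<mu>0. 0 < e \<and> e \<le> M \<and> (\<forall>\<mu> q u v. \<mu>0 < \<mu> \<longrightarrow> 0 < \<mu> \<longrightarrow> radial_solution n q h u v \<longrightarrow>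
    (\<forall>r\<in>{s..t}. q r = a r) \<longrightarrow> (\<forall>r\<in>{t..s'}. q r = \<mu> * a r) \<longrightarrow>
    (u s = e \<and> 0 \<le> v s \<and> v s \<le> e) \<or> (0 < u s \<and> u s \<le> e \<and> v s = e) \<longrightarrow> M < u s')"
proof -
  have a1: "continuous_on {s..t} a" and a2: "continuous_on {t..s'} a"
    by (rule continuous_on_subset[OF a]; use st in auto)+
  obtain r1 r2 c where r: "t < r1" "r1 < r2" "r2 < s'" and c: "0 < c" "\<And>r. r \<in> {r1..r2} \<Longrightarrow> c \<le> - a r"
    using interior_interval_pos[of t s' "\<lambda>r. - a r"] a2 st np nz by (force intro: continuous_intros)
  have "{s..t} \<noteq> {}" using st by simp
  then obtain x where x: "x \<in> {s..t}" "\<And>r. r \<in> {s..t} \<Longrightarrow> a r \<le> a x"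
    using continuous_attains_sup[OF compact_Icc _ a1] by blast
  define Q where "Q = a x"
  have Q: "0 \<le> Q" using nn x by (simp add: Q_def)
  define A where "A = 1 + (t - s) / s ^ n"
  have A: "0 < A" using st by (simp add: A_def add_pos_pos)
  define X where "X = A * Q * t ^ n * (t - s)"
  define Y where "Y = (s' - s) / s ^ n"
  have XY: "0 \<le> X" "0 \<le> Y" using A Q st by (auto simp: X_def Y_def)
  \<comment> \<open>A common bound for \<open>X\<close> and \<open>X * Y\<close>, so that a single
    \<open>\<delta>\<close> meets both smallness conditions of
    \<open>small_then_large\<close>.\<close>
  define T where "T = 1 + X + X * Y"
  have T: "0 < T" "X \<le> T" "X * Y \<le> T" using XY mult_nonneg_nonneg[OF XY] unfolding T_def by linarith+
  define \<delta> where "\<delta> = 1 / (2 * T)"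
  have d: "0 < \<delta>" "\<delta> * X \<le> 1 / 2" "\<delta> * X * Y \<le> 1 / 2"
    using T by (simp_all add: \<delta>_def)
  obtain x0 where x0: "0 < x0" "\<And>x. 0 < x \<Longrightarrow> x \<le> x0 \<Longrightarrow> h x \<le> \<delta> * x" using hs[OF d(1)] by blast
  \<comment> \<open>On \<open>{s..t}\<close> the solution can rise to \<open>e * A\<close>, and this
    must remain in the range where \<open>h x \<le> \<delta> * x\<close>.\<close>
  define e where "e = min M (x0 / A)"
  have e: "0 < e" "e \<le> M" "e * A \<le> x0" using M x0 A by (auto simp: e_def min_def field_simps split: if_splits)
  have hA: "h x \<le> \<delta> * (e * A)" if "x \<le> e * A" for x
  proof (cases "0 < x")
    case True
    have "h x \<le> \<delta> * x" using True that e by (intro x0) auto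
    also have "\<dots> \<le> \<delta> * (e * A)" using that d by (intro mult_left_mono) auto
    finally show ?thesis .
  next
    case False
    then show ?thesis using h0[of x] d e A by simp
  qed
  have "0 < e * min (1 / 2) ((t - s) / (2 * s' ^ n))" using e st by simp
  from hH[OF this] obtain H where H: "0 < H" "\<And>y. e * min (1 / 2) ((t - s) / (2 * s' ^ n)) \<le> y \<Longrightarrow> H \<le> h y"
    by blast
  \<comment> \<open>\<open>big\<close> reads \<open>W \<le> \<mu> * Z\<close>, whence the threshold
    \<open>W / Z\<close>.\<close>
  define Z where "Z = c * t ^ n * H * (r2 - r1) / 2"
  define W where "W = e + 2 * s' ^ n * M / (r2 - r1)"
  have Z: "0 < Z" using c st H r by (simp add: Z_def)
  have "M < u s'"
    if mu: "W / Z < \<mu>" "0 < \<mu>" and sol: "radial_solution n q h u v"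
      and q: "\<And>r. r \<in> {s..t} \<Longrightarrow> q r = a r" "\<And>r. r \<in> {t..s'} \<Longrightarrow> q r = \<mu> * a r"
      and start: "(u s = e \<and> 0 \<le> v s \<and> v s \<le> e) \<or> (0 < u s \<and> u s \<le> e \<and> v s = e)" for \<mu> q u v
  proof (rule radial_solution.small_then_large[OF sol st(1,2) r e(1) start _ _ _ _ _ A_def hA _
        d(2)[unfolded X_def] d(3)[unfolded X_def Y_def] H(2)])
    fix z assume "t \<le> z" "z \<le> s'"
    then show "q z \<le> 0" using q(2)[of z] np[of z] mu(2) by (simp add: mult_nonneg_nonpos)
  next
    fix z assume z: "r1 \<le> z" "z \<le> r2"
    then have "\<mu> * c \<le> \<mu> * - a z" using c(2)[of z] mu(2) by (intro mult_left_mono) auto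
    then show "q z \<le> - (\<mu> * c)" using q(2)[of z] z r by simp
  next
    have "W \<le> \<mu> * Z" using mu(1) Z by (simp add: field_simps)
    then show "e + 2 * s' ^ n * M / (r2 - r1) \<le> \<mu> * c * t ^ n * H * (r2 - r1) / 2"
      by (simp add: Z_def W_def mult_ac)
  qed (use q nn x mu c H M d in \<open>auto simp: Q_def\<close>)
  then show ?thesis using e by blast
qed

text \<open>The slope \<open>g M / M\<close> keeps the ratio to \<open>x\<close> constant above
  \<open>M\<close>, so the superlinear lower bound at \<open>M\<close> persists beyond it while the
  function becomes globally Lipschitz. For \<open>x \<le> 0\<close> the value is
  \<open>g 0 = 0\<close>, as persistence after a zero demands.\<close>

definition linear_extension :: "(real \<Rightarrow> real) \<Rightarrow> real \<Rightarrow> real \<Rightarrow> real" where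
  "linear_extension g M x = g (max 0 (min x M)) + g M / M * max 0 (x - M)"

lemma linear_extension_lipschitz:
  assumes g: "\<And>x. x \<ge> 0 \<Longrightarrow> \<exists>e>0. \<exists>L. L-lipschitz_on (cball x e \<inter> {0..}) g" and M: "0 < M"
  shows "\<exists>L. L-lipschitz_on UNIV (linear_extension g M)"
proof -
  \<comment> \<open>The passage from local to global Lipschitz continuity on a compact set is stated
    for families with a time parameter; the singleton \<open>{0}\<close> serves as a dummy
    time.\<close>
  have "local_lipschitz {0::real} {0..M} (\<lambda>_. g)"
    unfolding local_lipschitz_def
  proof (intro ballI)
    fix x t :: real assume x: "x \<in> {0..M}"
    obtain e L where "0 < e" "L-lipschitz_on (cball x e \<inter> {0..}) g" using g[of x] x by auto
    then have "L-lipschitz_on (cball x e \<inter> {0..M}) g" by (auto intro: lipschitz_on_subset)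
    with \<open>0 < e\<close> show "\<exists>u>0. \<exists>L. \<forall>t\<in>cball t u \<inter> {0}. L-lipschitz_on (cball x u \<inter> {0..M}) g" by blast
  qed
  then obtain L where L: "L-lipschitz_on {0..M} g"
    by (rule local_lipschitz_compact_implies_lipschitz[of "{0}" "{0..M}" "\<lambda>_. g"]) auto
  have "1-lipschitz_on UNIV (\<lambda>x. max 0 (min x M))" "1-lipschitz_on UNIV (\<lambda>x. max 0 (x - M))"
    by (auto intro!: lipschitz_onI simp: dist_real_def max_def min_def abs_if)
  moreover have "L-lipschitz_on ((\<lambda>x. max 0 (min x M)) ` UNIV) g"
    using M by (intro lipschitz_on_subset[OF L]) auto
  ultimately have "(L * 1 + \<bar>g M / M\<bar> * 1)-lipschitz_on UNIV (linear_extension g M)"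
    unfolding linear_extension_def [abs_def]
    by (intro lipschitz_on_add lipschitz_on_cmult_real lipschitz_on_compose2)
  then show ?thesis by blast
qed

text \<open>\<open>v\<close> increases, so it changes sign at most once and from minus to plus:
  \<open>u\<close> attains its maximum at an end point.\<close>

lemma (in radial_solution) convex_bound:
  assumes "0 \<le> x" "x \<le> r" "r \<le> y" "\<And>z. x < z \<Longrightarrow> z < y \<Longrightarrow> q z \<le> 0"
  shows "u r \<le> max (u x) (u y)"
proof (cases "v r \<le> 0")
  case True
  have "u r \<le> u x"
  proof (rule u_antimono)
    fix z assume "x < z" "z < r"
    then have "v z \<le> v r" using assms by (intro v_mono) auto
    then show "v z \<le> 0" using True by simp
  qed (use assms in auto)
  then show ?thesis by simp
next
  case False
  have "u r \<le> u y"
  proof (rule u_mono)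
    fix z assume "r < z" "z < y"
    then have "v r \<le> v z" using assms by (intro v_mono) auto
    then show "0 \<le> v z" using False by simp
  qed (use assms in auto)
  then show ?thesis by simp
qed

section \<open>Existence of decaying profiles\<close>

text \<open>The constants are fixed in the order \<open>D\<close> and \<open>l\<close>,
  \<open>U\<close>, \<open>M\<close> and \<open>h\<close>, the slopes \<open>K\<close>, the levels
  \<open>e\<close> with thresholds \<open>\<mu>1\<close>, the thresholds \<open>\<mu>2\<close>,
  which use both \<open>K\<close> and \<open>e\<close>, and finally \<open>\<mu>s\<close>.\<close>

lemma decaying_profiles_exist:
  fixes a g :: "real \<Rightarrow> real" and \<sigma> \<tau> :: "nat \<Rightarrow> real"
  assumes a_cont: "continuous_on {0..} a"
    and m_pos: "m \<ge> 1"
    and tau0: "\<tau> 0 = 0"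
    and points: "\<And>i. i \<in> {1..m} \<Longrightarrow> \<tau> (i - 1) < \<sigma> i \<and> \<sigma> i < \<tau> i"
    and a_nonneg: "\<And>i. i \<in> {1..m} \<Longrightarrow>
          (\<forall>r\<in>{\<sigma> i..\<tau> i}. a r \<ge> 0) \<and> (\<exists>r\<in>{\<sigma> i..\<tau> i}. a r \<noteq> 0)"
    and a_nonpos: "\<And>i. i \<in> {0..m - 1} \<Longrightarrow>
          (\<forall>r\<in>{\<tau> i..\<sigma> (i + 1)}. a r \<le> 0) \<and> (\<exists>r\<in>{\<tau> i..\<sigma> (i + 1)}. a r \<noteq> 0)"
    and a_neg: "\<And>r. r > \<tau> m \<Longrightarrow> a r < 0"
    and a_int: "filterlim (\<lambda>r. integral {\<tau> m..r} (\<lambda>s. a s * s ^ n)) at_bot at_top"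
    and g_lip: "\<And>u. u \<ge> 0 \<Longrightarrow> \<exists>e>0. \<exists>L. L-lipschitz_on (cball u e \<inter> {0..}) g"
    and g0: "g 0 = 0"
    and g_pos: "\<And>u. u > 0 \<Longrightarrow> g u > 0"
    and g_lim0: "((\<lambda>u. g u / u) \<longlongrightarrow> 0) (at_right 0)"
    and g_lim_inf: "filterlim (\<lambda>u. g u / u) at_top at_top"
  shows "\<exists>\<mu>star>0. \<forall>\<mu>>\<mu>star. \<exists>F u v. finite F \<and> card F = 2 ^ m - 1 \<and>
    (\<forall>d\<in>F. radial_system n (weight a \<mu>) g (u d) (v d) \<and> continuous_on {0..} (\<lambda>r. g (u d r)) \<and>
       u d 0 = d \<and> (\<forall>r\<ge>0. 0 < u d r) \<and>
       (u d \<longlongrightarrow> 0) at_top \<and> ((\<lambda>r. v d r / r ^ n) \<longlongrightarrow> 0) at_top)"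
proof -
  \<comment> \<open>The extra point \<open>s (Suc m) = \<tau> m + 1\<close> makes the beginning of
    the last unbounded interval look like the other intervals of nonpositive weight.\<close>
  define s where "s i = (if i = 0 then 0 else if i \<le> m then \<sigma> i else \<tau> m + 1)" for i
  have s_eq: "s i = \<sigma> i" if "i \<in> {1..m}" for i using that by (auto simp: s_def)
  have tau_nn: "0 \<le> \<tau> i" if "i \<le> m" for i
    using that
  proof (induction i)
    case (Suc i)
    then show ?case using points[of "Suc i"] by auto
  qed (simp add: tau0)
  have s_pos: "0 < s i" and s_tau: "s i < \<tau> i" if "i \<in> {1..m}" for i
  proof -
    show "s i < \<tau> i" using points[OF that] s_eq[OF that] by simp
    have "0 \<le> \<tau> (i - 1)" using that by (intro tau_nn) auto
    then show "0 < s i" using points[OF that] s_eq[OF that] by linarith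
  qed
  have tau_s: "\<tau> i < s (Suc i)" if "i \<le> m" for i
    using that points[of "Suc i"] s_eq[of "Suc i"] by (cases "i = m") (auto simp: s_def)
  have tau_pos: "0 < \<tau> i" if "i \<in> {1..m}" for i using s_pos[OF that] s_tau[OF that] by simp
  have s_nn: "0 \<le> s i" for i
    using s_pos[of i] tau_nn[of m] by (cases "i \<in> {1..m}") (auto simp: s_def)
  have s1: "0 < s 1" using s_pos[of 1] m_pos by simp
  have sSuc: "0 < s (Suc i)" if "i \<le> m" for i using tau_s[OF that] tau_nn[OF that] by simp

  have ca: "continuous_on {x..y} a" if "0 \<le> x" for x y
    by (rule continuous_on_subset[OF a_cont]) (use that in auto)
  have a_nn: "0 \<le> a r" if "i \<in> {1..m}" "r \<in> {s i..\<tau> i}" for i r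
    using a_nonneg[OF that(1)] s_eq[OF that(1)] that(2) by auto
  have a_nz: "\<exists>r\<in>{s i..\<tau> i}. a r \<noteq> 0" if "i \<in> {1..m}" for i
    using a_nonneg[OF that] s_eq[OF that] by auto
  have a_np: "a r \<le> 0" if i: "i \<le> m" and r: "r \<in> {\<tau> i..s (Suc i)}" for i r
  proof (cases "i = m")
    case False
    then have "Suc i \<in> {1..m}" "i \<in> {0..m - 1}" using i by auto
    then show ?thesis using a_nonpos[of i] s_eq[of "Suc i"] r by simp
  next
    case True
    \<comment> \<open>Beyond \<open>\<tau> m\<close> the weight is known to be negative only at
      later points; at \<open>\<tau> m\<close> itself the sign follows by continuity.\<close>
    have r': "r \<in> closure {\<tau> m<..<\<tau> m + 1}" using r True by (simp add: s_def)
    have c: "continuous_on (closure {\<tau> m<..<\<tau> m + 1}) a" using ca tau_nn[of m] by simp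
    show ?thesis
      by (rule continuous_le_on_closure[OF c r']) (simp add: a_neg less_imp_le)
  qed
  have a_nz': "\<exists>r\<in>{\<tau> i..s (Suc i)}. a r \<noteq> 0" if i: "i \<le> m" for i
  proof (cases "i = m")
    case False
    then have "Suc i \<in> {1..m}" "i \<in> {0..m - 1}" using i by auto
    then show ?thesis using a_nonpos[of i] s_eq[of "Suc i"] by simp
  next
    case True
    then show ?thesis using a_neg[of "\<tau> m + 1"] by (intro bexI[of _ "\<tau> m + 1"]) (simp_all add: s_def)
  qed

  have "\<forall>i\<in>{1..m}. \<exists>D l. \<forall>U q h u v. radial_solution n q h u v \<longrightarrow> 0 \<le> U \<longrightarrow> (\<forall>x\<ge>U. l * x \<le> h x) \<longrightarrow>
      (\<forall>r\<in>{s i..\<tau> i}. q r = a r \<and> 0 < u r) \<longrightarrow> (\<forall>r\<in>{s i..\<tau> i}. u r \<le> D * U)"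
    using s_pos s_tau a_nn a_nz ca s_nn by (intro ballI apriori_uniform) auto
  then obtain D l where apriori: "\<And>i U q h u v. i \<in> {1..m} \<Longrightarrow> radial_solution n q h u v \<Longrightarrow> 0 \<le> U \<Longrightarrow>
      (\<forall>x\<ge>U. l i * x \<le> h x) \<Longrightarrow> (\<forall>r\<in>{s i..\<tau> i}. q r = a r \<and> 0 < u r) \<Longrightarrow> (\<forall>r\<in>{s i..\<tau> i}. u r \<le> D i * U)"
    by metis
  obtain lmax where lmax: "0 < lmax" "\<And>i. i \<in> {1..m} \<Longrightarrow> l i < lmax"
    using finite_strict_upper_bound[of "{1..m}" l] by auto
  obtain U0 where U0: "\<And>x. U0 \<le> x \<Longrightarrow> lmax \<le> g x / x"
    using g_lim_inf unfolding filterlim_at_top eventually_at_top_linorder by blast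
  define U where "U = max 1 U0"
  have U_pos: "0 < U" by (simp add: U_def)
  have U_le: "lmax * x \<le> g x" if "U \<le> x" for x
    using U0[of x] that by (simp add: U_def pos_le_divide_eq)
  note U = U_pos U_le
  obtain B where B: "0 < B" "\<And>i. i \<in> {1..m} \<Longrightarrow> D i * U < B"
    using finite_strict_upper_bound[of "{1..m}" "\<lambda>i. D i * U"] by auto
  \<comment> \<open>\<open>M \<ge> U\<close> ensures that the slope \<open>g M / M\<close> of the
    extension is at least \<open>lmax\<close>; \<open>M > D i * U\<close> puts \<open>M\<close>
    above every a priori bound.\<close>
  define M where "M = U + B"
  have M: "0 < M" "U \<le> M" "\<And>i. i \<in> {1..m} \<Longrightarrow> D i * U < M"
    using U B by (fastforce simp: M_def)+

  define h where "h = linear_extension g M"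
  have h_low: "h x = 0" if "x \<le> 0" for x using that M g0 by (simp add: h_def linear_extension_def)
  have h_mid: "h x = g x" if "0 \<le> x" "x \<le> M" for x using that by (simp add: h_def linear_extension_def)
  have h_high: "h x = g M / M * x" if "M \<le> x" for x
    using that M by (simp add: h_def linear_extension_def field_simps)
  have h_pos: "0 < h x" if "0 < x" for x
    using that g_pos[of x] g_pos[OF M(1)] M(1) h_mid[of x] h_high[of x] by (cases "x \<le> M") auto
  have h_nn: "0 \<le> h x" for x using h_low[of x] h_pos[of x] by (cases "x \<le> 0") auto
  obtain L where hL: "L-lipschitz_on UNIV h"
    unfolding h_def using linear_extension_lipschitz[OF g_lip M(1)] by blast
  have ch: "continuous_on UNIV h" by (rule lipschitz_on_continuous_on[OF hL])
  have h_l: "\<forall>x\<ge>U. l i * x \<le> h x" if i: "i \<in> {1..m}" for i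
  proof (intro allI impI)
    fix x assume x: "U \<le> x"
    have "l i * x \<le> lmax * x" using lmax(2)[OF i] x U by (intro mult_right_mono) auto
    also have "\<dots> \<le> h x"
    proof (cases "x \<le> M")
      case True
      then show ?thesis using h_mid[of x] U x by simp
    next
      case False
      have "lmax \<le> g M / M" using U(2)[OF M(2)] M by (simp add: field_simps)
      then have "lmax * x \<le> g M / M * x" using U(1) x by (intro mult_right_mono) auto
      then show ?thesis using False h_high[of x] by simp
    qed
    finally show "l i * x \<le> h x" .
  qed
  have hH: "\<exists>H>0. \<forall>y\<ge>x. H \<le> h y" if x: "0 < x" for x
  proof -
    have "{min x M..M} \<noteq> {}" by simp
    then obtain z where z: "z \<in> {min x M..M}" "\<And>y. y \<in> {min x M..M} \<Longrightarrow> h z \<le> h y"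
      using continuous_attains_inf[OF compact_Icc _ continuous_on_subset[OF ch subset_UNIV]] by blast
    have "h z \<le> h y" if y: "x \<le> y" for y
    proof (cases "y \<le> M")
      case True
      then show ?thesis using y by (intro z) auto
    next
      case False
      have "h z \<le> h M" using x M by (intro z) auto
      also have "h M = g M / M * M" using h_high[of M] by simp
      also have "\<dots> \<le> g M / M * y"
        using False M(1) g_pos[OF M(1)] by (intro mult_left_mono) auto
      also have "\<dots> = h y" using h_high[of y] False by simp
      finally show ?thesis .
    qed
    moreover have "0 < h z" using z(1) x M by (intro h_pos) (auto simp: min_def split: if_splits)
    ultimately show ?thesis by blast
  qed
  have hs: "\<exists>x0>0. \<forall>x. 0 < x \<longrightarrow> x \<le> x0 \<longrightarrow> h x \<le> \<delta> * x" if "0 < \<delta>" for \<delta>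
  proof -
    have "\<forall>\<^sub>F x in at_right 0. g x / x < \<delta>" using order_tendstoD(2)[OF g_lim0 that] .
    then obtain b where b: "0 < b" "\<And>x. 0 < x \<Longrightarrow> x < b \<Longrightarrow> g x / x < \<delta>"
      unfolding eventually_at_right_field by auto
    have "h x \<le> \<delta> * x" if "0 < x" "x \<le> min M (b / 2)" for x
    proof -
      have "g x / x < \<delta>" using that b(1) by (intro b(2)) auto
      then show ?thesis using that h_mid[of x] by (simp add: field_simps)
    qed
    then show ?thesis using M b by (intro exI[of _ "min M (b / 2)"]) auto
  qed

  have "\<forall>i\<in>{1..m}. \<exists>K. \<forall>q u v. radial_solution n q h u v \<longrightarrow>
      (\<forall>r\<in>{s i..\<tau> i}. q r = a r \<and> 0 < u r \<and> u r \<le> M) \<longrightarrow> - K \<le> v (\<tau> i)"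
    using s_pos s_tau a_nn ca s_nn ch by (intro ballI end_slope_uniform) auto
  then obtain K where slope: "\<And>i q u v. i \<in> {1..m} \<Longrightarrow> radial_solution n q h u v \<Longrightarrow>
      (\<forall>r\<in>{s i..\<tau> i}. q r = a r \<and> 0 < u r \<and> u r \<le> M) \<Longrightarrow> - K i \<le> v (\<tau> i)"
    by metis
  have "\<forall>i\<in>{1..m}. \<exists>e \<mu>0. 0 < e \<and> e \<le> M \<and> (\<forall>\<mu> q u v. \<mu>0 < \<mu> \<longrightarrow> 0 < \<mu> \<longrightarrow> radial_solution n q h u v \<longrightarrow>
      (\<forall>r\<in>{s i..\<tau> i}. q r = a r) \<longrightarrow> (\<forall>r\<in>{\<tau> i..s (Suc i)}. q r = \<mu> * a r) \<longrightarrow>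
      (u (s i) = e \<and> 0 \<le> v (s i) \<and> v (s i) \<le> e) \<or> (0 < u (s i) \<and> u (s i) \<le> e \<and> v (s i) = e) \<longrightarrow>
      M < u (s (Suc i)))"
  proof (intro ballI small_then_large_uniform)
    fix i assume i: "i \<in> {1..m}"
    show "continuous_on {s i..s (Suc i)} a" "0 < s i" "s i < \<tau> i" "\<tau> i < s (Suc i)" "0 < M"
      "\<exists>r\<in>{\<tau> i..s (Suc i)}. a r \<noteq> 0"
      using i ca s_nn s_pos s_tau tau_s a_nz' M by auto
    show "0 \<le> a r" if "r \<in> {s i..\<tau> i}" for r using a_nn[OF i that] .
    show "a r \<le> 0" if "r \<in> {\<tau> i..s (Suc i)}" for r using a_np[of i r] i that by simp
  qed (use hH h_low hs in blast)+
  then obtain e \<mu>1 where e: "\<And>i. i \<in> {1..m} \<Longrightarrow> 0 < e i \<and> e i \<le> M"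
    and small: "\<And>i \<mu> q u v. i \<in> {1..m} \<Longrightarrow> \<mu>1 i < \<mu> \<Longrightarrow> 0 < \<mu> \<Longrightarrow> radial_solution n q h u v \<Longrightarrow>
      (\<forall>r\<in>{s i..\<tau> i}. q r = a r) \<Longrightarrow> (\<forall>r\<in>{\<tau> i..s (Suc i)}. q r = \<mu> * a r) \<Longrightarrow>
      (u (s i) = e i \<and> 0 \<le> v (s i) \<and> v (s i) \<le> e i) \<or> (0 < u (s i) \<and> u (s i) \<le> e i \<and> v (s i) = e i) \<Longrightarrow>
      M < u (s (Suc i))"
    by metis
  \<comment> \<open>The sign of \<open>v\<close> at \<open>s 2\<close>, ..., \<open>s m\<close> is
    obtained from the slope bound at the preceding \<open>\<tau> i\<close>; at \<open>s 1\<close> it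
    comes from \<open>v_s1\<close> below.\<close>
  have "\<forall>i\<in>{1..<m}. \<exists>\<mu>0. \<forall>\<mu> q u v. \<mu>0 < \<mu> \<longrightarrow> 0 < \<mu> \<longrightarrow> radial_solution n q h u v \<longrightarrow>
      (\<forall>r\<in>{\<tau> i..s (Suc i)}. q r = \<mu> * a r) \<longrightarrow> - K i \<le> v (\<tau> i) \<longrightarrow> u (s (Suc i)) = e (Suc i) \<longrightarrow> 0 \<le> v (s (Suc i))"
  proof (intro ballI v_nonneg_uniform)
    fix i assume i: "i \<in> {1..<m}"
    show "continuous_on {\<tau> i..s (Suc i)} a" "0 < \<tau> i" "\<tau> i < s (Suc i)" "0 < e (Suc i)"
      "\<exists>r\<in>{\<tau> i..s (Suc i)}. a r \<noteq> 0"
      using i ca tau_nn[of i] tau_pos[of i] tau_s[of i] a_nz'[of i] e[of "Suc i"] by auto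
    show "a r \<le> 0" if "r \<in> {\<tau> i..s (Suc i)}" for r using a_np[of i r] i that by simp
  qed (use hH in blast)
  then obtain \<mu>2 where level: "\<And>i \<mu> q u v. i \<in> {1..<m} \<Longrightarrow> \<mu>2 i < \<mu> \<Longrightarrow> 0 < \<mu> \<Longrightarrow> radial_solution n q h u v \<Longrightarrow>
      (\<forall>r\<in>{\<tau> i..s (Suc i)}. q r = \<mu> * a r) \<Longrightarrow> - K i \<le> v (\<tau> i) \<Longrightarrow> u (s (Suc i)) = e (Suc i) \<Longrightarrow> 0 \<le> v (s (Suc i))"
    by metis
  obtain \<mu>s where mus: "0 < \<mu>s" "\<And>i. i \<in> {1..m} \<Longrightarrow> max (\<mu>1 i) (\<mu>2 i) < \<mu>s"
    using finite_strict_upper_bound[of "{1..m}" "\<lambda>i. max (\<mu>1 i) (\<mu>2 i)"] by auto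

  show ?thesis
  proof (intro exI[of _ \<mu>s] conjI allI impI mus(1))
    fix \<mu> assume mu: "\<mu>s < \<mu>"
    have mu0: "0 < \<mu>" using mu mus by simp
    define q where "q = weight a \<mu>"
    have cq: "continuous_on {0..} q" unfolding q_def by (rule continuous_on_weight[OF a_cont])
    have q_a: "q r = a r" if "i \<in> {1..m}" "r \<in> {s i..\<tau> i}" for i r
      using a_nn[OF that] by (simp add: q_def weight_simps)
    have q_mua: "q r = \<mu> * a r" if "i \<le> m" "r \<in> {\<tau> i..s (Suc i)}" for i r
      using a_np[OF that] by (simp add: q_def weight_simps)
    have q_mua': "q r = \<mu> * a r" if "\<tau> m < r" for r
      using a_neg[OF that] by (simp add: q_def weight_simps)
    have q_np: "q r \<le> 0" if "i \<le> m" "r \<in> {\<tau> i..s (Suc i)}" for i r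
      using q_mua[OF that] a_np[OF that] mu0 by (simp add: mult_nonneg_nonpos)
    have q_np': "q r \<le> 0" if "\<tau> m < r" for r
      using q_mua'[OF that] a_neg[OF that] mu0 by (simp add: mult_nonneg_nonpos)
    obtain u v where sys: "\<And>d. radial_system n q h (u d) (v d)" and u0: "\<And>d. u d 0 = d"
      and cont: "\<And>r. 0 \<le> r \<Longrightarrow> continuous_on UNIV (\<lambda>d. u d r)" "\<And>r. 0 \<le> r \<Longrightarrow> continuous_on UNIV (\<lambda>d. v d r)"
      and zero: "\<And>r. 0 \<le> r \<Longrightarrow> u 0 r = 0 \<and> v 0 r = 0"
      using radial_flow_exists[OF cq hL, of n] h_low[of 0] by auto
    have sol: "radial_solution n q h (u d) (v d)" for d
      by unfold_locales (use sys h_nn in auto)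
    have pers: "v d r < 0 \<and> (z < r \<longrightarrow> u d r < 0)" if "0 < d" "0 < z" "u d z \<le> 0" "z \<le> r" for d z r
      using radial_system_persistence[OF sys cq hL h_low] u0 that by metis
    have before: "0 < u d r" if "0 < d" "0 < u d R" "0 \<le> r" "r \<le> R" for d r R
    proof (rule ccontr)
      assume "\<not> 0 < u d r"
      then show False using pers[of d r R] u0[of d] that by (cases "r = 0"; cases "r = R") auto
    qed
    \<comment> \<open>Contrapositively, a value at least \<open>M\<close> at \<open>s i\<close>
      forces a zero no later than \<open>\<tau> i\<close>. This yields the hypothesis
      \<open>large\<close> of \<open>shooting_count\<close>.\<close>
    have bound: "u d r < M" if d: "0 < d" and i: "i \<in> {1..m}" and pos: "0 < u d (\<tau> i)"
      and r: "r \<in> {s i..\<tau> i}" for d i r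
    proof -
      have "\<forall>r\<in>{s i..\<tau> i}. q r = a r \<and> 0 < u d r"
        using q_a[OF i] before[OF d pos] s_nn[of i] by auto
      then have "u d r \<le> D i * U"
        using apriori[OF i sol less_imp_le[OF U(1)] h_l[OF i]] r by blast
      then show ?thesis using M(3)[OF i] by simp
    qed
    \<comment> \<open>Since \<open>\<tau> 0 = 0\<close>, the weight is nonpositive up to
      \<open>s 1\<close> and \<open>v\<close> increases from 0. Hence
      \<open>u d (s 1) \<ge> d\<close>, so that \<open>d = M + 1\<close> can serve as the first
      large end.\<close>
    have v_s1: "0 \<le> v d (s 1)" "\<And>r. 0 \<le> r \<Longrightarrow> r \<le> s 1 \<Longrightarrow> 0 \<le> v d r" for d
    proof -
      interpret radial_solution n q h "u d" "v d" by (rule sol)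
      show nn: "0 \<le> v d r" if "0 \<le> r" "r \<le> s 1" for r
        using v_mono[of 0 r] sysD(3) q_np[of 0] that tau0 by auto
      then show "0 \<le> v d (s 1)" using s1 by simp
    qed
    have u_s1: "u d 0 \<le> u d (s 1)" for d
      using radial_solution.u_mono[OF sol, of 0 "s 1"] v_s1 s1 by auto
    define good where "good d \<longleftrightarrow> (\<forall>r\<ge>0. 0 < u d r) \<and> (\<forall>r\<ge>\<tau> m. v d r \<le> 0)" for d
    have "\<exists>F. finite F \<and> card F = 2 ^ m - 1 \<and> (\<forall>d\<in>F. 0 < d \<and> good d)"
    proof (rule shooting_count[where U = "\<lambda>i d. u d (s i)" and V = "\<lambda>i d. v d (s i)" and M = M and e = e])
      fix i show "continuous_on UNIV (\<lambda>d. u d (s i))" "continuous_on UNIV (\<lambda>d. v d (s i))"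
        "u 0 (s i) = 0" "v 0 (s i) = 0"
        using cont zero s_nn by auto
    next
      fix i d assume i: "i \<in> {1..m}" and d: "0 < d" and le: "u d (s i) \<le> 0"
      show "v d (s i) < 0" using pers[OF d s_pos[OF i] le] by simp
      show "u d (s (Suc i)) \<le> 0"
        using pers[OF d s_pos[OF i] le, of "s (Suc i)"] s_tau[OF i] tau_s[of i] i by auto
    next
      fix i d assume i: "i \<in> {1..m}" and d: "0 < d" and large: "M < u d (s i)"
      show "u d (s (Suc i)) \<le> 0"
      proof (rule ccontr)
        assume "\<not> u d (s (Suc i)) \<le> 0"
        then have "0 < u d (\<tau> i)"
          using before[OF d, of "s (Suc i)" "\<tau> i"] tau_nn[of i] tau_s[of i] i by auto
        then show False using bound[OF d i, of "s i"] s_tau[OF i] large by simp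
      qed
    next
      fix i d assume i: "i \<in> {1..m}" and d: "0 < d"
        and start: "(u d (s i) = e i \<and> v d (s i) \<le> e i) \<or> (0 < u d (s i) \<and> u d (s i) \<le> e i \<and> v d (s i) = e i)"
      have "0 \<le> v d (s i)" if eq: "u d (s i) = e i"
      proof (cases "i = 1")
        case True
        then show ?thesis using v_s1 by simp
      next
        case False
        \<comment> \<open>The solution is positive up to \<open>s i\<close>, so the slope bound
          holds at \<open>\<tau> j\<close>, and reaching the height \<open>e i\<close> at
          \<open>s i\<close> then forces \<open>v d (s i) \<ge> 0\<close>.\<close>
        define j where "j = i - 1"
        have j: "j \<in> {1..<m}" "j \<in> {1..m}" "i = Suc j" using False i by (auto simp: j_def)
        have pos: "0 < u d r" if "0 \<le> r" "r \<le> s i" for r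
          using before[OF d _ that] eq e[OF i] by simp
        have "0 < u d (\<tau> j)" using tau_nn[of j] tau_s[of j] j by (intro pos) auto
        then have "\<forall>r\<in>{s j..\<tau> j}. q r = a r \<and> 0 < u d r \<and> u d r \<le> M"
          using q_a[OF j(2)] bound[OF d j(2)] before[OF d] s_nn[of j] by force
        then have "- K j \<le> v d (\<tau> j)" by (rule slope[OF j(2) sol])
        moreover have "\<mu>2 j < \<mu>" using mus(2)[OF j(2)] mu by simp
        ultimately show ?thesis using level[OF j(1) _ mu0 sol[of d]] q_mua[of j] eq j by simp
      qed
      moreover have "\<mu>1 i < \<mu>" using mus(2)[OF i] mu by simp
      ultimately show "M < u d (s (Suc i))"
        using small[OF i _ mu0 sol[of d]] q_a[OF i] q_mua[of i] i start by auto
    next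
      show "0 < e i \<and> e i \<le> M" if "i \<in> {1..m}" for i using e[OF that] .
    next
      fix p d assume p: "0 < p" "u p (s (Suc m)) \<le> 0" and d: "0 < d" "M < u d (s (Suc m))"
      have pos: "0 < u d r" if "0 \<le> r" "r \<le> s (Suc m)" for r
        using before[OF d(1) _ that] d(2) M by simp
      have m: "m \<in> {1..m}" using m_pos by simp
      \<comment> \<open>Between \<open>\<tau> m\<close> and \<open>s (Suc m)\<close> the solution
        climbs from below \<open>M\<close> to above \<open>M\<close>, so \<open>v\<close> is
        positive somewhere.\<close>
      have "\<exists>T\<ge>\<tau> m. T \<le> s (Suc m) \<and> 0 < v d T"
      proof (rule ccontr)
        assume none: "\<not> (\<exists>T\<ge>\<tau> m. T \<le> s (Suc m) \<and> 0 < v d T)"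
        have "u d (s (Suc m)) \<le> u d (\<tau> m)"
          using none tau_nn[of m] tau_s[of m] by (intro radial_solution.u_antimono[OF sol]) (auto simp: not_less)
        moreover have "u d (\<tau> m) < M"
          using bound[OF d(1) m, of "\<tau> m"] pos[of "\<tau> m"] tau_nn[of m] tau_s[of m] s_tau[OF m] by auto
        ultimately show False using d(2) by simp
      qed
      then obtain T where T: "\<tau> m \<le> T" "T \<le> s (Suc m)" "0 < v d T" by blast
      have "\<exists>x\<in>open_segment p d. (\<forall>r\<ge>0. 0 < u x r) \<and> (\<forall>r\<ge>\<tau> m. v x r \<le> 0)"
        by (rule decaying_solution_between[OF sys u0 cont cq hL h_low h_nn tau_pos[OF m] q_np' p(1) sSuc[of m] p(2) d(1) T(1) _ T(3)])
           (use T tau_nn[of m] pos[of T] in auto)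
      then show "\<exists>x\<in>open_segment p d. good x" by (simp add: good_def)
    next
      show "0 < M + 1" "M < u (M + 1) (s 1)" using M u_s1[of "M + 1"] u0[of "M + 1"] by auto
    qed
    then obtain F where F: "finite F" "card F = 2 ^ m - 1" "\<And>d. d \<in> F \<Longrightarrow> 0 < d" "\<And>d. d \<in> F \<Longrightarrow> good d"
      by blast
    have "radial_system n (weight a \<mu>) g (u d) (v d) \<and> continuous_on {0..} (\<lambda>r. g (u d r)) \<and>
       u d 0 = d \<and> (\<forall>r\<ge>0. 0 < u d r) \<and>
       (u d \<longlongrightarrow> 0) at_top \<and> ((\<lambda>r. v d r / r ^ n) \<longlongrightarrow> 0) at_top" if "d \<in> F" for d
    proof -
      have d: "0 < d" and pos: "\<And>r. 0 \<le> r \<Longrightarrow> 0 < u d r" and vm: "\<And>r. \<tau> m \<le> r \<Longrightarrow> v d r \<le> 0"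
        using F(3,4)[OF that] by (auto simp: good_def)
      interpret radial_solution n q h "u d" "v d" by (rule sol)
      have bd: "u d r \<le> M" if "i \<in> {1..m}" "r \<in> {s i..\<tau> i}" for i r
        using bound[OF d that(1) pos that(2)] tau_nn[of i] that(1) by auto
      \<comment> \<open>Removing the truncation: the a priori bound covers the intervals of
        nonnegative weight, and on those between them \<open>u\<close> is bounded by its end
        values.\<close>
      have le_tau: "\<forall>r\<in>{0..\<tau> i}. u d r \<le> M" if "i \<le> m" for i
        using that
      proof (induction i)
        case 0
        have "u d 0 \<le> M" using u_s1[of d] bd[of 1 "s 1"] m_pos s_tau[of 1] by auto
        then show ?case using tau0 by auto
      next
        case (Suc i)
        have i: "Suc i \<in> {1..m}" using Suc.prems by simp
        show ?case
        proof
          fix r assume r: "r \<in> {0..\<tau> (Suc i)}"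
          consider "r \<le> \<tau> i" | "\<tau> i \<le> r" "r \<le> s (Suc i)" | "s (Suc i) \<le> r" by linarith
          then show "u d r \<le> M"
          proof cases
            case 1
            then show ?thesis using Suc r by auto
          next
            case 2
            have "u d r \<le> max (u d (\<tau> i)) (u d (s (Suc i)))"
              using 2 tau_nn[of i] q_np[of i] Suc.prems by (intro convex_bound) auto
            moreover have "u d (\<tau> i) \<le> M" using Suc tau_nn[of i] by auto
            moreover have "u d (s (Suc i)) \<le> M" using bd[OF i] s_tau[OF i] by auto
            ultimately show ?thesis by simp
          next
            case 3
            then show ?thesis using bd[OF i] r by auto
          qed
        qed
      qed
      have le_M: "u d r \<le> M" if "0 \<le> r" for r
      proof (cases "r \<le> \<tau> m")
        case True
        then show ?thesis using le_tau[of m] that by auto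
      next
        case False
        then have "u d r \<le> u d (\<tau> m)" using tau_nn[of m] vm by (intro u_antimono) auto
        also have "u d (\<tau> m) \<le> M" using le_tau[of m] tau_nn[of m] by simp
        finally show ?thesis .
      qed
      have hg: "h (u d r) = g (u d r)" if "0 \<le> r" for r
        using h_mid[of "u d r"] pos[OF that] le_M[OF that] by simp
      have "radial_system n (weight a \<mu>) g (u d) (v d)"
        using sys hg unfolding radial_system_def q_def by simp
      moreover have "continuous_on {0..} (\<lambda>r. h (u d r))"
        by (rule continuous_on_compose2[OF ch sysD(1)]) auto
      then have "continuous_on {0..} (\<lambda>r. g (u d r))"
        by (rule continuous_on_eq) (use hg in auto)
      moreover have "(u d \<longlongrightarrow> 0) at_top" "((\<lambda>r. v d r / r ^ n) \<longlongrightarrow> 0) at_top"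
        using decay[OF pos _ vm q_mua' mu0 a_neg a_cont a_int ch h_pos] tau_pos[of m] m_pos by auto
      ultimately show ?thesis using u0 pos by blast
    qed
    then show "\<exists>F u v. finite F \<and> card F = 2 ^ m - 1 \<and>
      (\<forall>d\<in>F. radial_system n (weight a \<mu>) g (u d) (v d) \<and> continuous_on {0..} (\<lambda>r. g (u d r)) \<and>
       u d 0 = d \<and> (\<forall>r\<ge>0. 0 < u d r) \<and>
       (u d \<longlongrightarrow> 0) at_top \<and> ((\<lambda>r. v d r / r ^ n) \<longlongrightarrow> 0) at_top)"
      using F(1,2) by blast
  qed
qed

section \<open>From profiles to functions on the whole space\<close>

lemma radial_homoclinic_solution_of_profile:
  fixes u v :: "real \<Rightarrow> real"
  assumes sys: "radial_system (DIM('a::euclidean_space) - 1) q g u v"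
    and q: "continuous_on {0..} q" and g: "continuous_on {0..} (\<lambda>r. g (u r))"
    and lim: "(u \<longlongrightarrow> 0) at_top" "((\<lambda>r. v r / r ^ (DIM('a) - 1)) \<longlongrightarrow> 0) at_top"
  shows "radial_homoclinic_solution q g (\<lambda>x::'a. u (norm x))"
proof -
  define n where "n = DIM('a) - 1"
  note classical = radial_function_classical[OF sys q g]
  note D = radial_systemD[OF sys[folded n_def]]
  have "radial_profile_solution DIM('a) q g u (\<lambda>r. v r / r ^ n)"
    unfolding radial_profile_solution_def n_def[symmetric]
  proof (intro conjI allI impI)
    \<comment> \<open>Because \<open>v 0 = 0\<close>, the quotient is 0 at the origin for every
      \<open>n\<close>, in agreement with the one-sided derivative of \<open>u\<close>
      there.\<close>
    show "v 0 / 0 ^ n = 0" using D(3) by simp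
    show "(u has_real_derivative v r / r ^ n) (at r within {0..})" if "0 \<le> r" for r
      using that classical(1) D(3) has_field_derivative_at_within[OF D(4)] by (cases "r = 0") auto
    fix r :: real assume r: "0 < r"
    have "((\<lambda>s. s ^ n * (v s / s ^ n)) has_real_derivative - (q r * r ^ n * g (u r))) (at r)"
      by (rule has_field_derivative_transform_within_open[OF D(5)[OF r], of "{0<..}"]) (use r in auto)
    then show "\<exists>d. ((\<lambda>s. s ^ n * (v s / s ^ n)) has_real_derivative d) (at r) \<and>
        d + r ^ n * q r * g (u r) = 0"
      by (intro exI[of _ "- (q r * r ^ n * g (u r))"]) simp
  qed
  then show ?thesis
    unfolding radial_homoclinic_solution_def classical_solution_def
    using classical(2,3) lim unfolding n_def by blast
qed

theorem theorem4p2: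
  fixes a g G :: "real \<Rightarrow> real"
    and m :: nat
    and \<sigma> \<tau> :: "nat \<Rightarrow> real"
  assumes a_cont: "continuous_on {0..} a"
    and m_pos: "m \<ge> 1"
    and tau0: "\<tau> 0 = 0"
    and points: "\<And>i. i \<in> {1..m} \<Longrightarrow> \<tau> (i - 1) < \<sigma> i \<and> \<sigma> i < \<tau> i"
    and a_nonneg: "\<And>i. i \<in> {1..m} \<Longrightarrow>
          (\<forall>r\<in>{\<sigma> i..\<tau> i}. a r \<ge> 0) \<and> (\<exists>r\<in>{\<sigma> i..\<tau> i}. a r \<noteq> 0)"
    and a_nonpos: "\<And>i. i \<in> {0..m - 1} \<Longrightarrow>
          (\<forall>r\<in>{\<tau> i..\<sigma> (i + 1)}. a r \<le> 0) \<and> (\<exists>r\<in>{\<tau> i..\<sigma> (i + 1)}. a r \<noteq> 0)"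
    and a_neg: "\<And>r. r > \<tau> m \<Longrightarrow> a r < 0"
    and a_int: "filterlim (\<lambda>r. integral {\<tau> m..r} (\<lambda>s. a s * s ^ (CARD('n) - 1))) at_bot at_top"
    and g_lip: "\<And>u. u \<ge> 0 \<Longrightarrow> \<exists>e>0. \<exists>L. L-lipschitz_on (cball u e \<inter> {0..}) g"
    and G_def: "\<And>u. u \<ge> 0 \<Longrightarrow> G u = integral {0..u} g"
    and g0: "g 0 = 0"
    and g_pos: "\<And>u. u > 0 \<Longrightarrow> g u > 0"
    and g_lim0: "((\<lambda>u. g u / u) \<longlongrightarrow> 0) (at_right 0)"
    and g_lim_inf: "filterlim (\<lambda>u. g u / u) at_top at_top"
    and G_int: "(\<integral>\<^sup>+\<xi>\<in>{1..}. ennreal (1 / sqrt (G \<xi>)) \<partial>lborel) < \<infinity>"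
    and G_lim: "((\<lambda>u. \<integral>\<^sup>+\<xi>\<in>{u<..}. ennreal (1 / sqrt (G \<xi> - G u)) \<partial>lborel) \<longlongrightarrow> 0) at_top"
  shows "\<exists>\<mu>star>0. \<forall>\<mu>>\<mu>star.
           \<exists>S :: (real ^ 'n \<Rightarrow> real) set.
             finite S \<and> card S = 2 ^ m - 1 \<and>
             (\<forall>U\<in>S. radial_homoclinic_solution (weight a \<mu>) g U \<and> (\<forall>x. U x > 0))"
proof -
  define n where "n = CARD('n) - 1"
  have n: "n = DIM(real ^ 'n) - 1" by (simp add: n_def)
  obtain \<mu>s where mus: "0 < \<mu>s" and profiles: "\<And>\<mu>. \<mu>s < \<mu> \<Longrightarrow> \<exists>F u v. finite F \<and> card F = 2 ^ m - 1 \<and>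
    (\<forall>d\<in>F. radial_system n (weight a \<mu>) g (u d) (v d) \<and> continuous_on {0..} (\<lambda>r. g (u d r)) \<and>
       u d 0 = d \<and> (\<forall>r\<ge>0. 0 < u d r) \<and>
       (u d \<longlongrightarrow> 0) at_top \<and> ((\<lambda>r. v d r / r ^ n) \<longlongrightarrow> 0) at_top)"
    using decaying_profiles_exist[OF a_cont m_pos tau0 points a_nonneg a_nonpos a_neg
        a_int[folded n_def] g_lip g0 g_pos g_lim0 g_lim_inf] by blast
  show ?thesis
  proof (intro exI[of _ \<mu>s] conjI allI impI mus)
    fix \<mu> assume "\<mu>s < \<mu>"
    from profiles[OF this] obtain F u v where F: "finite F" "card F = 2 ^ m - 1"
      and prof: "\<And>d. d \<in> F \<Longrightarrow> radial_system n (weight a \<mu>) g (u d) (v d)"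
        "\<And>d. d \<in> F \<Longrightarrow> continuous_on {0..} (\<lambda>r. g (u d r))"
        "\<And>d. d \<in> F \<Longrightarrow> u d 0 = d" "\<And>d r. d \<in> F \<Longrightarrow> 0 \<le> r \<Longrightarrow> 0 < u d r"
        "\<And>d. d \<in> F \<Longrightarrow> (u d \<longlongrightarrow> 0) at_top" "\<And>d. d \<in> F \<Longrightarrow> ((\<lambda>r. v d r / r ^ n) \<longlongrightarrow> 0) at_top"
      by blast
    define \<Phi> where "\<Phi> d = (\<lambda>x :: real ^ 'n. u d (norm x))" for d
    \<comment> \<open>The initial height is the value at the origin, so distinct heights give
      distinct functions.\<close>
    have "inj_on \<Phi> F"
    proof (rule inj_onI)
      fix d d' assume d: "d \<in> F" "d' \<in> F" "\<Phi> d = \<Phi> d'"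
      then have "\<Phi> d 0 = \<Phi> d' 0" by simp
      then show "d = d'" using prof(3) d by (simp add: \<Phi>_def)
    qed
    then have "card (\<Phi> ` F) = 2 ^ m - 1" using F by (simp add: card_image)
    moreover have "radial_homoclinic_solution (weight a \<mu>) g (\<Phi> d) \<and> (\<forall>x. \<Phi> d x > 0)" if "d \<in> F" for d
      using radial_homoclinic_solution_of_profile[where 'a = "real ^ 'n", of "weight a \<mu>" g "u d" "v d"]
        prof[OF that] continuous_on_weight[OF a_cont] n
      by (simp add: \<Phi>_def)
    ultimately show "\<exists>S :: (real ^ 'n \<Rightarrow> real) set. finite S \<and> card S = 2 ^ m - 1 \<and>
        (\<forall>U\<in>S. radial_homoclinic_solution (weight a \<mu>) g U \<and> (\<forall>x. U x > 0))"
      using F(1) by (intro exI[of _ "\<Phi> ` F"]) auto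
  qed
qed

end
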